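(* Let $I=[-a,b]$ be a finite segment, let $h$ satisfy conditions (i) and (ii) stated in the context, and put $\alpha=\frac{2}{m+2}$. Let $\mathbf Q_\varepsilon$ be either of the operators $\mathbf Q_{\varepsilon,D}$ and $\mathbf Q_{\varepsilon,N}$. Then $$\lim_{\varepsilon\to0}\left\|(\varepsilon^{2\alpha}\mathbf Q_\varepsilon)^{-1}\oplus\mathbf 0_{L^2(\mathbb R\setminus I)}-(\varepsilon^{2\alpha}\mathbf H_\varepsilon)^{-1}\right\|=0 .$$
   Context: Let $I=[-a,b]$ be a finite segment with $a,b>0$ and $h:I\to(0,\infty)$ a continuous function. Conditions: (i) $x=0$ is the only point of global maximum of $h$ on $I$. (ii) $h$ is $C^1$ on $I\setminus\{0\}$, and in a neighborhood of $x=0$ it admits the expansion $h(x)=M-c_+x^m+O(x^{m+1})$ for $x>0$ and $h(x)=M-c_-|x|^m+O(|x|^{m+1})$ for $x<0$, where $M,c_+,c_->0$ and $m\ge1$ (so $M=h(0)$). For $\varepsilon>0$ let $$W_\varepsilon(x)=\frac{\pi^2}{\varepsilon^2}\Bigl(\frac1{h^2(x)}-\frac1{M^2}\Bigr)+\Bigl(\frac{\pi^2}{3}+\frac14\Bigr)\frac{h'(x)^2}{h^2(x)},\qquad \mathbf q_\varepsilon[\chi]=\int_I\bigl(\chi'(x)^2+W_\varepsilon(x)\chi^2(x)\bigr)dx .$$ The form $\mathbf q_\varepsilon$ is considered on $H^1(I)$, where it is positive definite and closed in $L^2(I)$, or on $H^{1,0}(I)=H^1_0(I)$, with the same properties. The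 corresponding self-adjoint operators on $L^2(I)$, acting as $\mathbf Q_\varepsilon\chi=-\chi''+W_\varepsilon\chi$, are denoted by $\mathbf Q_{\varepsilon,N}$ (form domain $H^1(I)$, Neumann conditions) and $\mathbf Q_{\varepsilon,D}$ (form domain $H^{1,0}(I)$, Dirichlet conditions). Let $q(x)=2\pi^2M^{-3}c_+x^m$ for $x>0$ and $q(x)=2\pi^2M^{-3}c_-|x|^m$ for $x<0$, and for $\varepsilon>0$ let $\mathbf H_\varepsilon=-\frac{d^2}{dx^2}+\varepsilon^{-2}q(x)$ on $L^2(\mathbb R)$. $\mathbf 0_{\mathfrak Z}$ denotes the zero operator on the Hilbert space $\mathfrak Z$, and the direct sum is with respect to $L^2(\mathbb R)=L^2(I)\oplus L^2(\mathbb R\setminus I)$. The norm is the operator norm.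
   Formalization: It is additionally assumed that h' is square integrable on I; conditions (i), (ii) do not imply this (h = 1−|x|+x² sin(|x|^{-2}) near 0, m = 1), and without it the form q_ε is not finite on H¹(I) or H¹₀(I), so Q_ε is undefined. *)

theory Defs
  imports "HOL-Analysis.Analysis" "HOL-Library.Landau_Symbols"
begin

subsection \<open>The spaces $L^2(S)$, $H^1(S)$ and $H^1_0(S)$\<close>

text \<open>Elements of $L^2(S)$ are represented by functions on the whole line that vanish off \<open>S\<close>.
  Hence $L^2(S)$ is a subspace of $L^2(\mathbb R)$, the orthogonal decomposition
  $L^2(\mathbb R) = L^2(S) \oplus L^2(\mathbb R \setminus S)$ is internal, and the integrals below,
  written over the line, are integrals over \<open>S\<close>.  No quotient by almost everywhere equality is
  taken.\<close>

definition L2 :: "real set \<Rightarrow> (real \<Rightarrow> complex) set" where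
  "L2 S = {f \<in> borel_measurable lborel.
     integrable lborel (\<lambda>x. (cmod (f x))\<^sup>2) \<and> (\<forall>x. x \<notin> S \<longrightarrow> f x = 0)}"

definition l2_inner :: "(real \<Rightarrow> complex) \<Rightarrow> (real \<Rightarrow> complex) \<Rightarrow> complex" where
  "l2_inner f g = (\<integral>x. f x * cnj (g x) \<partial>lborel)"

definition l2_norm :: "(real \<Rightarrow> complex) \<Rightarrow> real" where
  "l2_norm f = sqrt (\<integral>x. (cmod (f x))\<^sup>2 \<partial>lborel)"

text \<open>Sobolev spaces on an interval follow Brezis, Functional Analysis, Sobolev Spaces and Partial
  Differential Equations, Chapter 8: test functions are $C^1$ with compact support in the interior,
  and $H^1_0$ is the closure of the test functions in $H^1$.\<close>

definition C1c :: "real set \<Rightarrow> (real \<Rightarrow> complex) set" where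
  "C1c U = {\<phi>. \<phi> C1_differentiable_on UNIV \<and>
     (\<exists>K. compact K \<and> K \<subseteq> U \<and> (\<forall>x. x \<notin> K \<longrightarrow> \<phi> x = 0))}"

definition is_weak_deriv :: "real set \<Rightarrow> (real \<Rightarrow> complex) \<Rightarrow> (real \<Rightarrow> complex) \<Rightarrow> bool" where
  "is_weak_deriv S u v \<longleftrightarrow> (\<forall>\<phi> \<in> C1c (interior S).
     (\<integral>x. u x * vector_derivative \<phi> (at x) \<partial>lborel) = - (\<integral>x. v x * \<phi> x \<partial>lborel))"

definition H1 :: "real set \<Rightarrow> (real \<Rightarrow> complex) set" where
  "H1 S = {u \<in> L2 S. \<exists>v \<in> L2 S. is_weak_deriv S u v}"

text \<open>On an interval \<open>S\<close> the choice below is unique up to null sets.\<close>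

definition weak_deriv :: "real set \<Rightarrow> (real \<Rightarrow> complex) \<Rightarrow> real \<Rightarrow> complex" where
  "weak_deriv S u = (SOME v. v \<in> L2 S \<and> is_weak_deriv S u v)"

definition h1_norm :: "real set \<Rightarrow> (real \<Rightarrow> complex) \<Rightarrow> real" where
  "h1_norm S u = sqrt ((l2_norm u)\<^sup>2 + (l2_norm (weak_deriv S u))\<^sup>2)"

definition H10 :: "real set \<Rightarrow> (real \<Rightarrow> complex) set" where
  "H10 S = {u \<in> H1 S. \<exists>\<phi>. (\<forall>n. \<phi> n \<in> C1c (interior S)) \<and>
     (\<lambda>n::nat. h1_norm S (\<lambda>x. u x - \<phi> n x)) \<longlonglongrightarrow> 0}"


subsection \<open>Operators in $L^2(\mathbb R)$ as graphs\<close>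

text \<open>A (possibly unbounded) operator is given by its graph, a set of pairs (argument, value); the
  inverse of an operator is the converse relation.\<close>

type_synonym l2_op = "((real \<Rightarrow> complex) \<times> (real \<Rightarrow> complex)) set"

definition scale_op :: "real \<Rightarrow> l2_op \<Rightarrow> l2_op" where
  "scale_op c A = {(u, \<lambda>x. of_real c * f x) | u f. (u, f) \<in> A}"

definition zero_op :: "real set \<Rightarrow> l2_op" where
  "zero_op S = {(u, \<lambda>x. 0) | u. u \<in> L2 S}"

definition dsum_op :: "l2_op \<Rightarrow> l2_op \<Rightarrow> l2_op" where
  "dsum_op A B = {(\<lambda>x. u1 x + u2 x, \<lambda>x. v1 x + v2 x) | u1 u2 v1 v2. (u1, v1) \<in> A \<and> (u2, v2) \<in> B}"

definition diff_op :: "l2_op \<Rightarrow> l2_op \<Rightarrow> l2_op" where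
  "diff_op A B = {(u, \<lambda>x. v x - w x) | u v w. (u, v) \<in> A \<and> (u, w) \<in> B}"

text \<open>The norm is \<open>\<infinity>\<close> if \<open>A\<close> is not everywhere defined on $L^2(\mathbb R)$ or not bounded.  It is also
  \<open>\<infinity>\<close> if the linear relation \<open>A\<close> is not single-valued modulo null sets, since the values at \<open>0\<close> then
  have arbitrarily large norm.\<close>

definition op_norm :: "l2_op \<Rightarrow> ennreal" where
  "op_norm A =
     (if Domain A = L2 UNIV \<and> Range A \<subseteq> L2 UNIV
      then SUP (u, v) \<in> {(u, v) \<in> A. l2_norm u \<le> 1}. ennreal (l2_norm v)
      else \<infinity>)"


subsection \<open>Schroedinger operators defined by quadratic forms\<close>

text \<open>The sesquilinear form whose diagonal is
  $\int_S (|u'|^2 + V |u|^2)\,dx$, and the operator that the first representation theorem associates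
  with it on the form domain \<open>D\<close>.\<close>

definition schroed_form ::
  "real set \<Rightarrow> (real \<Rightarrow> real) \<Rightarrow> (real \<Rightarrow> complex) \<Rightarrow> (real \<Rightarrow> complex) \<Rightarrow> complex" where
  "schroed_form S V u w =
     (\<integral>x. weak_deriv S u x * cnj (weak_deriv S w x) + of_real (V x) * u x * cnj (w x) \<partial>lborel)"

definition form_op :: "real set \<Rightarrow> (real \<Rightarrow> real) \<Rightarrow> (real \<Rightarrow> complex) set \<Rightarrow> l2_op" where
  "form_op S V D =
     {(u, f). u \<in> D \<and> f \<in> L2 S \<and> (\<forall>w \<in> D. schroed_form S V u w = l2_inner f w)}"

text \<open>In \<open>W_pot\<close> the function \<open>h'\<close> stands for the derivative of \<open>h\<close> off \<open>0\<close>.\<close>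

definition W_pot :: "(real \<Rightarrow> real) \<Rightarrow> (real \<Rightarrow> real) \<Rightarrow> real \<Rightarrow> real \<Rightarrow> real \<Rightarrow> real" where
  "W_pot h h' M \<epsilon> x = pi\<^sup>2 / \<epsilon>\<^sup>2 * (1 / (h x)\<^sup>2 - 1 / M\<^sup>2) + (pi\<^sup>2 / 3 + 1 / 4) * ((h' x)\<^sup>2 / (h x)\<^sup>2)"

definition Q_N ::
  "real set \<Rightarrow> (real \<Rightarrow> real) \<Rightarrow> (real \<Rightarrow> real) \<Rightarrow> real \<Rightarrow> real \<Rightarrow> l2_op" where
  "Q_N I h h' M \<epsilon> = form_op I (W_pot h h' M \<epsilon>) (H1 I)"

definition Q_D ::
  "real set \<Rightarrow> (real \<Rightarrow> real) \<Rightarrow> (real \<Rightarrow> real) \<Rightarrow> real \<Rightarrow> real \<Rightarrow> l2_op" where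
  "Q_D I h h' M \<epsilon> = form_op I (W_pot h h' M \<epsilon>) (H10 I)"

definition q_pot :: "real \<Rightarrow> real \<Rightarrow> real \<Rightarrow> real \<Rightarrow> real \<Rightarrow> real" where
  "q_pot M cp cm m x = 2 * pi\<^sup>2 / M ^ 3 * (if x > 0 then cp else cm) * \<bar>x\<bar> powr m"

text \<open>The self-adjoint realisation of $-d^2/dx^2 + V$ on the line, for \<open>V \<ge> 0\<close>, as a form sum.\<close>

definition schroed_line :: "(real \<Rightarrow> real) \<Rightarrow> l2_op" where
  "schroed_line V =
     form_op UNIV V {u \<in> H1 UNIV. integrable lborel (\<lambda>x. V x * (cmod (u x))\<^sup>2)}"

definition H_op :: "real \<Rightarrow> real \<Rightarrow> real \<Rightarrow> real \<Rightarrow> real \<Rightarrow> l2_op" where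
  "H_op M cp cm m \<epsilon> = schroed_line (\<lambda>x. q_pot M cp cm m x / \<epsilon>\<^sup>2)"

end

theory Submission
  imports Defs
begin


text \<open>Both operators have their low lying spectrum at the scale $\varepsilon^{-2\alpha}$, and their
  resolvents live on the length scale $r = \varepsilon^\alpha$ around the maximum of \<open>h\<close>, where the
  potential $W_\varepsilon$ is a small perturbation of $\varepsilon^{-2} q$. The proof makes this precise without
  rescaling.

  Write \<open>Q\<close> and \<open>H\<close> for the two operators. For $f \in L^2(\mathbb R)$ let $u = Q^{-1} (f|_I)$,
  $y = H^{-1} f$, $g = u - y$ and $w = H^{-1} g$. Symmetry of \<open>H\<close> gives
  $\|g\|^2 = \langle u, g\rangle - \langle f, w\rangle$. Let \<open>\<theta>\<close> be a $C^1$ cutoff that is \<open>1\<close> near \<open>0\<close> and has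
  compact support in the interior of \<open>I\<close>. Then \<open>\<theta>u\<close> may be used as a test function in the equation
  of \<open>w\<close> and \<open>\<theta>w\<close> in the equation of \<open>u\<close>, for Dirichlet and for Neumann conditions alike, and up to the
  pairings with $(1 - \theta) u$ and $(1 - \theta) w$ the norm $\|g\|^2$ becomes
  \[ \int \theta' u \bar w' - \theta' u' \bar w + (\varepsilon^{-2} q - W_\varepsilon) \theta u \bar w . \]
  All terms are small compared with $r^2 \|f\| \|g\|$ (lemma \<open>resolvent_difference_bound\<close>). The terms outside the
  set $\theta = 1$ are small since there the potentials are at least of order $\varepsilon^{-2}$, much larger than
  the energy scale $r^{-2}$. The main part of the difference of the potentials is at most
  $\eta \varepsilon^{-2} q$ on the support of \<open>\<theta>\<close>, where \<open>\<eta>\<close> is as small as one likes if the support is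
  small (\<open>V0_approx\<close>). The remaining part $h'^2/h^2$ is only integrable, and is handled by the Sobolev
  inequality on intervals of length \<open>r\<close> (\<open>sobolev_sup_bound\<close>).

  The a priori bounds on \<open>u\<close> and \<open>w\<close> come from the coercivity estimate
  $\|u\|^2 \le C r^2 (\|u'\|^2 + \langle V u, u\rangle)$, an elementary inequality between the masses in $[-r,r]$ and
  in $[r,3r]$ (\<open>energy_coercive\<close>).

  The norm of an operator that is not everywhere defined is infinite, so the equations must also be
  shown to be solvable for every right hand side. This is the representation theorem for closed forms
  (\<open>form_op_surjective\<close>), proved by minimising the energy. It needs the completeness of $L^2$ and of the form
  domains, and hence the basic theory of weak derivatives on an interval: their uniqueness, the continuous
  representative of an $H^1$ function (\<open>weak_deriv_representative\<close>), and the fact that functions of $H^1$ with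
  compact support in the interior belong to $H^1_0$ (\<open>cutoff_H10\<close>).\<close>

section \<open>The space $L^2$\<close>

lemma L2_I:
  assumes "f \<in> borel_measurable borel" "integrable lborel (\<lambda>x. (cmod (f x))\<^sup>2)"
    "\<And>x. x \<notin> S \<Longrightarrow> f x = 0"
  shows "f \<in> L2 S"
  using assms unfolding L2_def by simp

lemma L2_measurable [measurable_dest]: "f \<in> L2 S \<Longrightarrow> f \<in> borel_measurable borel"
  unfolding L2_def by simp

lemma L2_sq_integrable: "f \<in> L2 S \<Longrightarrow> integrable lborel (\<lambda>x. (cmod (f x))\<^sup>2)"
  unfolding L2_def by simp

lemma L2_zero_off: "f \<in> L2 S \<Longrightarrow> x \<notin> S \<Longrightarrow> f x = 0"
  unfolding L2_def by simp

lemma L2_mono: "S \<subseteq> T \<Longrightarrow> f \<in> L2 S \<Longrightarrow> f \<in> L2 T"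
  unfolding L2_def by auto

lemma L2_UNIV: "f \<in> L2 S \<Longrightarrow> f \<in> L2 UNIV"
  by (rule L2_mono) auto

lemma L2_norm_nonneg [simp]: "0 \<le> l2_norm f"
  unfolding l2_norm_def by simp

lemma l2_norm_sq: "(l2_norm f)\<^sup>2 = (\<integral>x. (cmod (f x))\<^sup>2 \<partial>lborel)"
  unfolding l2_norm_def by simp

lemma sq_norm_add_le: "(cmod (a + b))\<^sup>2 \<le> 2 * (cmod a)\<^sup>2 + 2 * (cmod b)\<^sup>2"
proof -
  have "(cmod (a + b))\<^sup>2 \<le> (cmod a + cmod b)\<^sup>2"
    by (intro power_mono norm_triangle_ineq) auto
  also have "\<dots> \<le> 2 * (cmod a)\<^sup>2 + 2 * (cmod b)\<^sup>2"
    using zero_le_power2[of "cmod a - cmod b"] by (simp add: power2_eq_square algebra_simps)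
  finally show ?thesis .
qed

lemma L2_dominated:
  assumes "f \<in> borel_measurable borel" "g \<in> L2 T" "\<And>x. cmod (f x) \<le> C * cmod (g x)"
    "\<And>x. x \<notin> S \<Longrightarrow> f x = 0"
  shows "f \<in> L2 S"
proof (rule L2_I)
  show "integrable lborel (\<lambda>x. (cmod (f x))\<^sup>2)"
  proof (rule Bochner_Integration.integrable_bound)
    show "integrable lborel (\<lambda>x. C\<^sup>2 * (cmod (g x))\<^sup>2)"
      using L2_sq_integrable[OF assms(2)] by simp
    show "AE x in lborel. norm ((cmod (f x))\<^sup>2) \<le> norm (C\<^sup>2 * (cmod (g x))\<^sup>2)"
      using assms(3) by (auto simp: power_mult_distrib[symmetric] intro!: power_mono)
  qed (use assms(1) in measurable)
qed (use assms in auto)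

lemma L2_add:
  assumes "f \<in> L2 S" "g \<in> L2 S" shows "(\<lambda>x. f x + g x) \<in> L2 S"
proof (rule L2_I)
  have [measurable]: "f \<in> borel_measurable borel" "g \<in> borel_measurable borel"
    using assms by (auto intro: L2_measurable)
  show "(\<lambda>x. f x + g x) \<in> borel_measurable borel" by measurable
  show "integrable lborel (\<lambda>x. (cmod (f x + g x))\<^sup>2)"
  proof (rule Bochner_Integration.integrable_bound)
    show "integrable lborel (\<lambda>x. 2 * (cmod (f x))\<^sup>2 + 2 * (cmod (g x))\<^sup>2)"
      using assms by (intro Bochner_Integration.integrable_add integrable_mult_right) (auto intro: L2_sq_integrable)
    show "AE x in lborel. norm ((cmod (f x + g x))\<^sup>2)
        \<le> norm (2 * (cmod (f x))\<^sup>2 + 2 * (cmod (g x))\<^sup>2)"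
      using sq_norm_add_le by auto
  qed measurable
qed (use assms in \<open>simp add: L2_zero_off\<close>)

lemma L2_cmult: "f \<in> L2 S \<Longrightarrow> (\<lambda>x. c * f x) \<in> L2 S"
  by (rule L2_dominated[where C = "cmod c"]) (auto simp: norm_mult dest: L2_zero_off intro: L2_measurable)

lemma L2_diff: "f \<in> L2 S \<Longrightarrow> g \<in> L2 S \<Longrightarrow> (\<lambda>x. f x - g x) \<in> L2 S"
  using L2_add[of f S "\<lambda>x. -1 * g x"] L2_cmult[of g S "-1"] by simp

lemma L2_0: "(\<lambda>x. 0) \<in> L2 S"
  by (rule L2_I) auto

lemma L2_restrict:
  assumes "f \<in> L2 T" "S \<in> sets borel" shows "(\<lambda>x. indicator S x * f x) \<in> L2 S"
  by (rule L2_dominated[OF _ assms(1), where C = 1])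
    (use assms in \<open>auto simp: norm_mult indicator_def L2_measurable split: if_splits\<close>)

lemma L2_norm_prod_integrable:
  assumes "f \<in> L2 S" "g \<in> L2 T" shows "integrable lborel (\<lambda>x. cmod (f x) * cmod (g x))"
proof (rule Bochner_Integration.integrable_bound)
  have [measurable]: "f \<in> borel_measurable borel" "g \<in> borel_measurable borel"
    using assms by (auto intro: L2_measurable)
  show "(\<lambda>x. cmod (f x) * cmod (g x)) \<in> borel_measurable lborel" by measurable
  show "integrable lborel (\<lambda>x. (cmod (f x))\<^sup>2 + (cmod (g x))\<^sup>2)"
    using assms by (auto intro: L2_sq_integrable)
  have "cmod (f x) * cmod (g x) \<le> (cmod (f x))\<^sup>2 + (cmod (g x))\<^sup>2" for x
    using zero_le_power2[of "cmod (f x) - cmod (g x)"] zero_le_power2[of "cmod (f x)"]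
      zero_le_power2[of "cmod (g x)"]
    unfolding power2_diff using mult_nonneg_nonneg[OF norm_ge_zero[of "f x"] norm_ge_zero[of "g x"]]
    by linarith
  then show "AE x in lborel. norm (cmod (f x) * cmod (g x))
      \<le> norm ((cmod (f x))\<^sup>2 + (cmod (g x))\<^sup>2)" by auto
qed

lemma L2_prod_integrable:
  assumes "f \<in> L2 S" "g \<in> L2 T" shows "integrable lborel (\<lambda>x. f x * g x)"
  by (rule Bochner_Integration.integrable_bound[OF L2_norm_prod_integrable[OF assms]])
    (use assms in \<open>auto simp: norm_mult L2_measurable\<close>)

lemma L2_cnj: "f \<in> L2 S \<Longrightarrow> (\<lambda>x. cnj (f x)) \<in> L2 S"
  by (rule L2_dominated[where C = 1 and g = f])
    (auto dest: L2_zero_off L2_measurable intro: borel_measurable_continuous_on[of cnj] continuous_intros)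

lemma L2_inner_integrable:
  assumes "f \<in> L2 S" "g \<in> L2 T" shows "integrable lborel (\<lambda>x. f x * cnj (g x))"
  using L2_prod_integrable[OF assms(1) L2_cnj[OF assms(2)]] .

text \<open>The Cauchy-Schwarz inequality, from the sign of $\int (|f| - t |g|)^2$ for all \<open>t\<close>.\<close>

lemma integral_norm_prod_le:
  assumes "f \<in> L2 S" "g \<in> L2 T"
  shows "(\<integral>x. cmod (f x) * cmod (g x) \<partial>lborel) \<le> l2_norm f * l2_norm g"
proof -
  define a b c where "a = (\<integral>x. (cmod (f x))\<^sup>2 \<partial>lborel)" and "b = (\<integral>x. (cmod (g x))\<^sup>2 \<partial>lborel)"
    and "c = (\<integral>x. cmod (f x) * cmod (g x) \<partial>lborel)"
  have i: "integrable lborel (\<lambda>x. (cmod (f x))\<^sup>2)" "integrable lborel (\<lambda>x. (cmod (g x))\<^sup>2)"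
    "integrable lborel (\<lambda>x. cmod (f x) * cmod (g x))"
    using assms by (auto intro: L2_sq_integrable L2_norm_prod_integrable)
  have q: "0 \<le> a - 2 * t * c + t\<^sup>2 * b" for t
  proof -
    have "0 \<le> (\<integral>x. (cmod (f x) - t * cmod (g x))\<^sup>2 \<partial>lborel)" by simp
    also have "\<dots> = (\<integral>x. (cmod (f x))\<^sup>2 - 2 * t * (cmod (f x) * cmod (g x)) + t\<^sup>2 * (cmod (g x))\<^sup>2 \<partial>lborel)"
      by (intro Bochner_Integration.integral_cong) (auto simp: power2_eq_square algebra_simps)
    also have "\<dots> = a - 2 * t * c + t\<^sup>2 * b"
      using i by (simp add: a_def b_def c_def)
    finally show ?thesis .
  qed
  have nn: "0 \<le> a" "0 \<le> b" "0 \<le> c" unfolding a_def b_def c_def by auto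
  have "c\<^sup>2 \<le> a * b"
  proof (cases "b = 0")
    case True
    have "c = 0"
    proof (rule ccontr)
      assume "c \<noteq> 0"
      then show False using q[of "(a + 1) / (2 * c)"] True nn by (simp add: field_simps)
    qed
    then show ?thesis using nn by simp
  next
    case False
    then show ?thesis using q[of "c / b"] nn by (simp add: field_simps power2_eq_square)
  qed
  then have "c \<le> sqrt (a * b)" by (rule real_le_rsqrt)
  then show ?thesis unfolding l2_norm_def a_def b_def c_def by (simp add: real_sqrt_mult)
qed

lemma norm_integral_prod_le:
  assumes "f \<in> L2 S" "g \<in> L2 T"
  shows "cmod (\<integral>x. f x * g x \<partial>lborel) \<le> l2_norm f * l2_norm g"
proof -
  have "cmod (\<integral>x. f x * g x \<partial>lborel) \<le> (\<integral>x. cmod (f x * g x) \<partial>lborel)"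
    by (rule integral_norm_bound)
  also have "\<dots> \<le> l2_norm f * l2_norm g"
    using integral_norm_prod_le[OF assms] by (simp add: norm_mult)
  finally show ?thesis .
qed

lemma l2_norm_cnj [simp]: "l2_norm (\<lambda>x. cnj (f x)) = l2_norm f"
  unfolding l2_norm_def by simp

lemma norm_l2_inner_le:
  assumes "f \<in> L2 S" "g \<in> L2 T" shows "cmod (l2_inner f g) \<le> l2_norm f * l2_norm g"
  using norm_integral_prod_le[OF assms(1) L2_cnj[OF assms(2)]] by (simp add: l2_inner_def)

lemma l2_norm_cmult: "l2_norm (\<lambda>x. c * f x) = cmod c * l2_norm f"
  unfolding l2_norm_def by (simp add: norm_mult power_mult_distrib real_sqrt_mult)

lemma l2_norm_minus: "l2_norm (\<lambda>x. f x - g x) = l2_norm (\<lambda>x. g x - f x)"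
  unfolding l2_norm_def by (simp add: norm_minus_commute)

lemma l2_norm_mono:
  assumes "f \<in> borel_measurable borel" "g \<in> L2 T" "AE x in lborel. cmod (f x) \<le> cmod (g x)"
  shows "l2_norm f \<le> l2_norm g"
  unfolding l2_norm_def
proof (intro real_sqrt_le_mono integral_mono_AE)
  show "integrable lborel (\<lambda>x. (cmod (g x))\<^sup>2)" by (rule L2_sq_integrable[OF assms(2)])
  show le: "AE x in lborel. (cmod (f x))\<^sup>2 \<le> (cmod (g x))\<^sup>2"
    using assms(3) by eventually_elim (auto intro: power_mono)
  show "integrable lborel (\<lambda>x. (cmod (f x))\<^sup>2)"
    by (rule Bochner_Integration.integrable_bound[OF L2_sq_integrable[OF assms(2)]])
      (use assms(1) le in auto)
qed

lemma l2_norm_cong_AE: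
  assumes "f \<in> borel_measurable borel" "g \<in> borel_measurable borel"
    "AE x in lborel. f x = g x"
  shows "l2_norm f = l2_norm g"
proof -
  have "(\<integral>x. (cmod (f x))\<^sup>2 \<partial>lborel) = (\<integral>x. (cmod (g x))\<^sup>2 \<partial>lborel)"
    by (rule integral_cong_AE) (use assms in auto)
  then show ?thesis unfolding l2_norm_def by simp
qed

lemma l2_norm_triangle:
  assumes "f \<in> L2 S" "g \<in> L2 T"
  shows "l2_norm (\<lambda>x. f x + g x) \<le> l2_norm f + l2_norm g"
proof (rule power2_le_imp_le)
  note f = L2_UNIV[OF assms(1)] and g = L2_UNIV[OF assms(2)]
  have "(l2_norm (\<lambda>x. f x + g x))\<^sup>2 \<le>
      (\<integral>x. (cmod (f x))\<^sup>2 + 2 * (cmod (f x) * cmod (g x)) + (cmod (g x))\<^sup>2 \<partial>lborel)"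
    unfolding l2_norm_sq
  proof (rule integral_mono)
    show "integrable lborel (\<lambda>x. (cmod (f x + g x))\<^sup>2)" by (rule L2_sq_integrable[OF L2_add[OF f g]])
    show "integrable lborel (\<lambda>x. (cmod (f x))\<^sup>2 + 2 * (cmod (f x) * cmod (g x)) + (cmod (g x))\<^sup>2)"
      using f g by (intro Bochner_Integration.integrable_add integrable_mult_right)
        (auto intro: L2_sq_integrable L2_norm_prod_integrable)
    show "(cmod (f x + g x))\<^sup>2 \<le> (cmod (f x))\<^sup>2 + 2 * (cmod (f x) * cmod (g x)) + (cmod (g x))\<^sup>2" for x
      using power_mono[OF norm_triangle_ineq[of "f x" "g x"] norm_ge_zero, of 2]
      by (simp add: power2_sum)
  qed
  also have "\<dots> = (l2_norm f)\<^sup>2 + 2 * (\<integral>x. cmod (f x) * cmod (g x) \<partial>lborel) + (l2_norm g)\<^sup>2"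
    using L2_sq_integrable[OF f] L2_sq_integrable[OF g] L2_norm_prod_integrable[OF f g]
    by (simp add: l2_norm_sq)
  also have "\<dots> \<le> (l2_norm f + l2_norm g)\<^sup>2"
    using integral_norm_prod_le[OF f g] by (simp add: power2_sum)
  finally show "(l2_norm (\<lambda>x. f x + g x))\<^sup>2 \<le> (l2_norm f + l2_norm g)\<^sup>2" .
qed simp

lemma l2_norm_triangle_diff:
  assumes "f \<in> L2 S" "g \<in> L2 T" "k \<in> L2 U"
  shows "l2_norm (\<lambda>x. f x - k x) \<le> l2_norm (\<lambda>x. f x - g x) + l2_norm (\<lambda>x. g x - k x)"
  using l2_norm_triangle[OF L2_diff[OF assms(1,2)[THEN L2_UNIV]] L2_diff[OF assms(2,3)[THEN L2_UNIV]]]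
  by simp

text \<open>Completeness. A Cauchy sequence in $L^2$ need not be integrable, but after multiplication by a
  fixed strictly positive $L^2$ function it is a Cauchy sequence in $L^1$, which gives a subsequence
  that converges almost everywhere; Fatou's lemma identifies the pointwise limit as the limit in
  norm.\<close>

lemma L2_complete:
  assumes f: "\<And>n::nat. f n \<in> L2 S"
    and cauchy: "\<And>e. e > 0 \<Longrightarrow> \<exists>N. \<forall>i\<ge>N. \<forall>j\<ge>N. l2_norm (\<lambda>x. f i x - f j x) < e"
  obtains g r where "g \<in> L2 S" "strict_mono (r :: nat \<Rightarrow> nat)" "AE x in lborel. (\<lambda>n. f (r n) x) \<longlonglongrightarrow> g x"
    "(\<lambda>n. l2_norm (\<lambda>x. f n x - g x)) \<longlonglongrightarrow> 0"
proof -
  have [measurable]: "f n \<in> borel_measurable borel" for n using f by (auto intro: L2_measurable)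
  \<comment> \<open>The square root of an integrable positive function is a positive element of $L^2$.\<close>
  obtain k :: "real \<Rightarrow> ennreal" where k [measurable]: "k \<in> borel_measurable lborel"
    and kfin: "integral\<^sup>N lborel k \<noteq> \<infinity>" and kpos: "\<And>x. 0 < k x" "\<And>x. k x < \<infinity>"
    using sigma_finite_measure.Ex_finite_integrable_function[OF sigma_finite_lborel] by auto
  define p :: "real \<Rightarrow> complex" where "p x = of_real (sqrt (enn2real (k x)))" for x
  have pm [measurable]: "p \<in> borel_measurable borel" unfolding p_def using k by simp
  have p2: "(cmod (p x))\<^sup>2 = enn2real (k x)" for x unfolding p_def by simp
  have p0: "p x \<noteq> 0" for x using kpos[of x] unfolding p_def
    by (auto simp: enn2real_eq_0_iff)
  have p: "p \<in> L2 UNIV"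
  proof (rule L2_I)
    show "integrable lborel (\<lambda>x. (cmod (p x))\<^sup>2)"
      unfolding p2
    proof (rule integrableI_nonneg)
      have "(\<integral>\<^sup>+x. ennreal (enn2real (k x)) \<partial>lborel) = integral\<^sup>N lborel k"
        by (intro nn_integral_cong) (use kpos in \<open>auto simp: less_top\<close>)
      then show "(\<integral>\<^sup>+x. ennreal (enn2real (k x)) \<partial>lborel) < \<infinity>" using kfin by (simp add: less_top)
    qed auto
  qed auto
  have fd: "(\<lambda>x. f i x - f j x) \<in> L2 UNIV" for i j
    by (intro L2_diff L2_UNIV[OF f])
  have "\<exists>N. \<forall>i\<ge>N. \<forall>j\<ge>N. (\<integral>x. norm (p x * f i x - p x * f j x) \<partial>lborel) < e" if "e > 0" for e
  proof -
    define c where "c = l2_norm p + 1"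
    have c: "c > 0" unfolding c_def by (simp add: add_nonneg_pos)
    obtain N where N: "\<And>i j. i \<ge> N \<Longrightarrow> j \<ge> N \<Longrightarrow> l2_norm (\<lambda>x. f i x - f j x) < e / c"
      using cauchy[of "e / c"] \<open>e > 0\<close> c by auto
    have "(\<integral>x. norm (p x * f i x - p x * f j x) \<partial>lborel) < e" if "i \<ge> N" "j \<ge> N" for i j
    proof -
      have "(\<integral>x. norm (p x * f i x - p x * f j x) \<partial>lborel)
          = (\<integral>x. cmod (p x) * cmod (f i x - f j x) \<partial>lborel)"
        by (simp add: norm_mult[symmetric] right_diff_distrib)
      also have "\<dots> \<le> l2_norm p * l2_norm (\<lambda>x. f i x - f j x)"
        by (rule integral_norm_prod_le[OF p fd])
      also have "\<dots> \<le> c * l2_norm (\<lambda>x. f i x - f j x)"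
        by (intro mult_right_mono) (auto simp: c_def)
      also have "\<dots> < c * (e / c)" using N[OF that] c by (intro mult_strict_left_mono)
      finally show ?thesis using c by simp
    qed
    then show ?thesis by blast
  qed
  moreover have "integrable lborel (\<lambda>x. p x * f n x)" for n by (rule L2_prod_integrable[OF p f])
  ultimately obtain r where r: "strict_mono (r :: nat \<Rightarrow> nat)"
    and ae: "AE x in lborel. Cauchy (\<lambda>i. p x * f (r i) x)"
    using cauchy_L1_AE_cauchy_subseq[of lborel "\<lambda>n x. p x * f n x"] by blast
  define g where "g x = (if Cauchy (\<lambda>i. f (r i) x) then lim (\<lambda>i. f (r i) x) else 0)" for x
  have [measurable]: "g \<in> borel_measurable borel" unfolding g_def by measurable
  have conv: "AE x in lborel. (\<lambda>n. f (r n) x) \<longlonglongrightarrow> g x"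
    using ae
  proof eventually_elim
    case (elim x)
    then have "convergent (\<lambda>i. p x * f (r i) x)" by (simp add: Cauchy_convergent_iff)
    then have "convergent (\<lambda>i. f (r i) x)"
      using p0[of x] by (simp add: convergent_mult_const_iff)
    then show ?case unfolding g_def by (simp add: Cauchy_convergent_iff convergent_LIMSEQ_iff)
  qed
  have goff: "g x = 0" if "x \<notin> S" for x
    using L2_zero_off[OF f that] unfolding g_def by simp
  have key: "(\<integral>\<^sup>+x. ennreal ((cmod (f n x - g x))\<^sup>2) \<partial>lborel) \<le> ennreal (e\<^sup>2)"
    if e: "e > 0" and N: "\<forall>i\<ge>N. \<forall>j\<ge>N. l2_norm (\<lambda>x. f i x - f j x) < e" and n: "n \<ge> N" for e N n
  proof -
    have "(\<integral>\<^sup>+x. ennreal ((cmod (f n x - g x))\<^sup>2) \<partial>lborel)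
        = (\<integral>\<^sup>+x. liminf (\<lambda>i. ennreal ((cmod (f n x - f (r i) x))\<^sup>2)) \<partial>lborel)"
    proof (rule nn_integral_cong_AE)
      show "AE x in lborel. ennreal ((cmod (f n x - g x))\<^sup>2)
          = liminf (\<lambda>i. ennreal ((cmod (f n x - f (r i) x))\<^sup>2))"
        using conv
      proof eventually_elim
        case (elim x)
        have "(\<lambda>i. ennreal ((cmod (f n x - f (r i) x))\<^sup>2)) \<longlonglongrightarrow> ennreal ((cmod (f n x - g x))\<^sup>2)"
          using elim by (intro tendsto_intros)
        then show ?case by (rule lim_imp_Liminf[symmetric, rotated]) simp
      qed
    qed
    also have "\<dots> \<le> liminf (\<lambda>i. \<integral>\<^sup>+x. ennreal ((cmod (f n x - f (r i) x))\<^sup>2) \<partial>lborel)"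
      by (rule nn_integral_liminf) measurable
    also have "\<dots> \<le> ennreal (e\<^sup>2)"
    proof (rule Liminf_le)
      have "\<forall>\<^sub>F i in sequentially. i \<ge> N" by (rule eventually_ge_at_top)
      then show "\<forall>\<^sub>F i in sequentially.
          (\<integral>\<^sup>+x. ennreal ((cmod (f n x - f (r i) x))\<^sup>2) \<partial>lborel) \<le> ennreal (e\<^sup>2)"
      proof eventually_elim
        case (elim i)
        have "r i \<ge> N" using seq_suble[OF r, of i] elim by simp
        then have "l2_norm (\<lambda>x. f n x - f (r i) x) < e" using N n by blast
        then have "(l2_norm (\<lambda>x. f n x - f (r i) x))\<^sup>2 \<le> e\<^sup>2"
          by (intro power_mono) auto
        then show ?case
          using L2_sq_integrable[OF fd] by (simp add: nn_integral_eq_integral l2_norm_sq ennreal_leI)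
      qed
    qed simp
    finally show ?thesis .
  qed
  have gL2: "g \<in> L2 S"
  proof -
    obtain N where N: "\<forall>i\<ge>N. \<forall>j\<ge>N. l2_norm (\<lambda>x. f i x - f j x) < 1" using cauchy[of 1] by auto
    have "(\<lambda>x. f N x - g x) \<in> L2 S"
    proof (rule L2_I)
      show "integrable lborel (\<lambda>x. (cmod (f N x - g x))\<^sup>2)"
        by (rule integrableI_nonneg)
          (use key[OF _ N order_refl] in \<open>auto simp: less_top[symmetric] top_unique
              intro: le_less_trans[of _ "ennreal 1"]\<close>)
    qed (use goff L2_zero_off[OF f] in auto)
    from L2_diff[OF f[of N] this] show ?thesis by simp
  qed
  have "(\<lambda>n. l2_norm (\<lambda>x. f n x - g x)) \<longlonglongrightarrow> 0"
  proof (rule LIMSEQ_I)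
    fix e :: real assume e: "e > 0"
    obtain N where N: "\<forall>i\<ge>N. \<forall>j\<ge>N. l2_norm (\<lambda>x. f i x - f j x) < e / 2"
      using cauchy[of "e / 2"] e by auto
    have "l2_norm (\<lambda>x. f n x - g x) < e" if "n \<ge> N" for n
    proof -
      have "ennreal ((l2_norm (\<lambda>x. f n x - g x))\<^sup>2) \<le> ennreal ((e / 2)\<^sup>2)"
        using key[OF _ N that] e L2_sq_integrable[OF L2_diff[OF f[of n] gL2]]
        by (simp add: nn_integral_eq_integral l2_norm_sq)
      then have "(l2_norm (\<lambda>x. f n x - g x))\<^sup>2 \<le> (e / 2)\<^sup>2" by (simp add: ennreal_le_iff)
      then have "l2_norm (\<lambda>x. f n x - g x) \<le> e / 2" by (rule power2_le_imp_le) (use e in simp)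
      then show ?thesis using e by simp
    qed
    then show "\<exists>N. \<forall>n\<ge>N. norm (l2_norm (\<lambda>x. f n x - g x) - 0) < e" by auto
  qed
  with gL2 r conv show thesis by (rule that)
qed

section \<open>Minimising a quadratic functional\<close>

text \<open>The Riesz representation theorem in the form needed here: on a real vector space \<open>D\<close> of
  functions that is complete for the quadratic form \<open>B\<close>, the functional $\frac12 B(u,u) - l(u)$ has a
  minimiser, whose Euler equation is \<open>B u w = l w\<close>. The parallelogram identity makes every minimising
  sequence a Cauchy sequence.\<close>

lemma riesz_representation:
  fixes D :: "(real \<Rightarrow> complex) set" and B :: "(real \<Rightarrow> complex) \<Rightarrow> (real \<Rightarrow> complex) \<Rightarrow> real"
  assumes zero: "(\<lambda>x. 0) \<in> D"
    and comb: "\<And>u w t. u \<in> D \<Longrightarrow> w \<in> D \<Longrightarrow> (\<lambda>x. u x + of_real t * w x) \<in> D"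
    and B_comb: "\<And>u w z t. u \<in> D \<Longrightarrow> w \<in> D \<Longrightarrow> z \<in> D \<Longrightarrow> B (\<lambda>x. u x + of_real t * w x) z = B u z + t * B w z"
    and B_sym: "\<And>u w. u \<in> D \<Longrightarrow> w \<in> D \<Longrightarrow> B u w = B w u"
    and B_nonneg: "\<And>u. u \<in> D \<Longrightarrow> B u u \<ge> 0"
    and l_comb: "\<And>u w t. u \<in> D \<Longrightarrow> w \<in> D \<Longrightarrow> l (\<lambda>x. u x + of_real t * w x) = l u + t * l w"
    and l_bounded: "\<And>u. u \<in> D \<Longrightarrow> (l u)\<^sup>2 \<le> K * B u u"
    and complete: "\<And>s::nat \<Rightarrow> real \<Rightarrow> complex. (\<And>n. s n \<in> D) \<Longrightarrow>
        (\<And>e. e > 0 \<Longrightarrow> \<exists>N. \<forall>i\<ge>N. \<forall>j\<ge>N. B (\<lambda>x. s i x - s j x) (\<lambda>x. s i x - s j x) < e) \<Longrightarrow>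
        \<exists>u\<in>D. (\<lambda>n. B (\<lambda>x. s n x - u x) (\<lambda>x. s n x - u x)) \<longlonglongrightarrow> 0"
  obtains u where "u \<in> D" "\<And>w. w \<in> D \<Longrightarrow> B u w = l w"
proof -
  define J where "J u = B u u / 2 - l u" for u
  have diff: "(\<lambda>x. u x - w x) \<in> D" if "u \<in> D" "w \<in> D" for u w
    using comb[OF that, of "-1"] by simp
  have expand: "J (\<lambda>x. u x + of_real t * w x) = J u + t * (B u w - l w) + t\<^sup>2 / 2 * B w w"
    if "u \<in> D" "w \<in> D" for u w t
  proof -
    have "B (\<lambda>x. u x + of_real t * w x) (\<lambda>x. u x + of_real t * w x)
        = B u (\<lambda>x. u x + of_real t * w x) + t * B w (\<lambda>x. u x + of_real t * w x)"
      using that comb[OF that] by (rule B_comb)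
    also have "B u (\<lambda>x. u x + of_real t * w x) = B u u + t * B w u"
      using B_sym[OF that(1) comb[OF that]] B_comb[OF that that(1)] by simp
    also have "B w (\<lambda>x. u x + of_real t * w x) = B u w + t * B w w"
      using B_sym[OF that(2) comb[OF that]] B_comb[OF that that(2)] by simp
    finally show ?thesis
      using B_sym[OF that] l_comb[OF that] unfolding J_def
      by (simp add: field_simps power2_eq_square)
  qed
  have bdd: "J u \<ge> - \<bar>K\<bar> / 2" if "u \<in> D" for u
  proof -
    define b where "b = B u u"
    have b: "b \<ge> 0" unfolding b_def by (rule B_nonneg[OF that])
    have "(l u)\<^sup>2 \<le> \<bar>K\<bar> * b"
      using l_bounded[OF that] b unfolding b_def
      by (meson abs_ge_self mult_right_mono order_trans)
    also have "\<dots> \<le> ((\<bar>K\<bar> + b) / 2)\<^sup>2"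
      using zero_le_power2[of "\<bar>K\<bar> - b"] by (simp add: power2_eq_square field_simps)
    finally have "l u \<le> (\<bar>K\<bar> + b) / 2"
      by (rule power2_le_imp_le) (use b in auto)
    then show ?thesis unfolding J_def b_def[symmetric] by (simp add: field_simps)
  qed
  define i where "i = Inf (J ` D)"
  have bb: "bdd_below (J ` D)" using bdd by (intro bdd_belowI2)
  have i_le: "i \<le> J u" if "u \<in> D" for u unfolding i_def by (rule cINF_lower[OF bb that])
  have "\<exists>u\<in>D. J u < i + e" if "e > 0" for e
    using cInf_lessD[of "J ` D" "i + e"] zero that unfolding i_def by auto
  then have "\<exists>u\<in>D. J u < i + 1 / real (Suc n)" for n by simp
  then obtain s where s: "\<And>n. s n \<in> D" "\<And>n. J (s n) < i + 1 / real (Suc n)" by metis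
  have par: "B (\<lambda>x. s a x - s b x) (\<lambda>x. s a x - s b x) / 4 \<le> J (s a) + J (s b) - 2 * i" for a b
  proof -
    let ?d = "\<lambda>x. s a x - s b x"
    have d: "?d \<in> D" by (rule diff[OF s(1) s(1)])
    have "J (s a) = J (s b) + (B (s b) ?d - l ?d) + B ?d ?d / 2"
      using expand[OF s(1)[of b] d, of 1] by simp
    moreover
    have "i \<le> J (s b) + 1 / 2 * (B (s b) ?d - l ?d) + (1 / 2)\<^sup>2 / 2 * B ?d ?d"
      using i_le[OF comb[OF s(1)[of b] d]] expand[OF s(1)[of b] d] by metis
    then have "i \<le> J (s b) + (B (s b) ?d - l ?d) / 2 + B ?d ?d / 8"
      by (simp add: power2_eq_square)
    ultimately show ?thesis by (simp add: field_simps)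
  qed
  have "\<exists>N. \<forall>a\<ge>N. \<forall>b\<ge>N. B (\<lambda>x. s a x - s b x) (\<lambda>x. s a x - s b x) < e" if "e > 0" for e
  proof -
    obtain N where N: "1 / real (Suc N) < e / 8" using nat_approx_posE[of "e / 8"] \<open>e > 0\<close> by auto
    have "B (\<lambda>x. s a x - s b x) (\<lambda>x. s a x - s b x) < e" if "a \<ge> N" "b \<ge> N" for a b
    proof -
      have "1 / real (Suc a) \<le> 1 / real (Suc N)" "1 / real (Suc b) \<le> 1 / real (Suc N)"
        using that by (auto intro!: divide_left_mono)
      then show ?thesis using par[of a b] s(2)[of a] s(2)[of b] N by linarith
    qed
    then show ?thesis by blast
  qed
  from complete[OF s(1) this] obtain u where u: "u \<in> D"
    and lim: "(\<lambda>n. B (\<lambda>x. s n x - u x) (\<lambda>x. s n x - u x)) \<longlonglongrightarrow> 0" by blast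
  \<comment> \<open>\<open>J\<close> is continuous for the norm given by \<open>B\<close>, so the limit of a minimising sequence is a minimiser.\<close>
  have J_le: "J u \<le> i"
  proof -
    have lin: "\<bar>B u w\<bar> \<le> sqrt (B u u) * sqrt (B w w)" if "w \<in> D" for w
    proof -
      have q: "0 \<le> B u u + 2 * t * B u w + t\<^sup>2 * B w w" for t
      proof -
        have "B (\<lambda>x. u x + of_real t * w x) (\<lambda>x. u x + of_real t * w x)
            = B u u + 2 * t * B u w + t\<^sup>2 * B w w"
          using B_comb[OF u that comb[OF u that, of t], of t]
            B_sym[OF u comb[OF u that, of t]] B_comb[OF u that u, of t]
            B_sym[OF that comb[OF u that, of t]] B_comb[OF u that that, of t] B_sym[OF u that]
          by (simp add: algebra_simps power2_eq_square)
        then show ?thesis using B_nonneg[OF comb[OF u that, of t]] by simp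
      qed
      have "(B u w)\<^sup>2 \<le> B u u * B w w"
      proof (cases "B w w = 0")
        case True
        have "B u w = 0"
        proof (rule ccontr)
          assume "B u w \<noteq> 0"
          then show False using q[of "- (B u u + 1) / (2 * B u w)"] True B_nonneg[OF u]
            by (simp add: field_simps)
        qed
        then show ?thesis using True by simp
      next
        case False
        then show ?thesis using q[of "- B u w / B w w"] B_nonneg[OF that]
          by (simp add: field_simps power2_eq_square)
      qed
      then have "\<bar>B u w\<bar> \<le> sqrt (B u u * B w w)" by (intro real_le_rsqrt) simp
      then show ?thesis by (simp add: real_sqrt_mult)
    qed
    define c where "c = sqrt (B u u) + sqrt \<bar>K\<bar> "
    have l: "\<bar>l w\<bar> \<le> sqrt \<bar>K\<bar> * sqrt (B w w)" if "w \<in> D" for w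
    proof -
      have "(l w)\<^sup>2 \<le> \<bar>K\<bar> * B w w" using l_bounded[OF that] B_nonneg[OF that]
        by (meson abs_ge_self mult_right_mono order_trans)
      then have "\<bar>l w\<bar> \<le> sqrt (\<bar>K\<bar> * B w w)" by (intro real_le_rsqrt) simp
      then show ?thesis by (simp add: real_sqrt_mult)
    qed
    have J_s: "J u \<le> J (s n) + c * sqrt (B (\<lambda>x. s n x - u x) (\<lambda>x. s n x - u x))" for n
    proof -
      let ?d = "\<lambda>x. s n x - u x"
      have d: "?d \<in> D" by (rule diff[OF s(1) u])
      have "J (s n) = J u + (B u ?d - l ?d) + B ?d ?d / 2"
        using expand[OF u d, of 1] by simp
      then show ?thesis using lin[OF d] l[OF d] B_nonneg[OF d] unfolding c_def
        by (simp add: algebra_simps)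
    qed
    have "(\<lambda>n. J u - c * sqrt (B (\<lambda>x. s n x - u x) (\<lambda>x. s n x - u x)) - 1 / real (Suc n)) \<longlonglongrightarrow> J u - c * sqrt 0 - 0"
      by (intro tendsto_intros lim LIMSEQ_Suc[OF lim_1_over_n])
    then have "J u - c * sqrt 0 - 0 \<le> i"
    proof (rule LIMSEQ_le_const2, intro exI allI impI)
      fix n
      show "J u - c * sqrt (B (\<lambda>x. s n x - u x) (\<lambda>x. s n x - u x)) - 1 / real (Suc n) \<le> i"
        using J_s[of n] s(2)[of n] by linarith
    qed
    then show ?thesis by simp
  qed
  have "B u w = l w" if w: "w \<in> D" for w
  proof -
    define L b where "L = B u w - l w" and "b = B w w"
    have b: "b \<ge> 0" unfolding b_def by (rule B_nonneg[OF w])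
    have pos: "0 \<le> t * L + t\<^sup>2 / 2 * b" for t
      using i_le[OF comb[OF u w, of t]] J_le expand[OF u w, of t] unfolding L_def b_def by simp
    define c where "c = b + 1"
    have c: "c > 0" "b / (2 * c) < 1" using b unfolding c_def by auto
    \<comment> \<open>The minimum of the quadratic polynomial in \<open>t\<close> is near $t = -L/b$; enlarging \<open>b\<close> avoids division by zero.\<close>
    have "0 \<le> - L / c * L + (- L / c)\<^sup>2 / 2 * b" by (rule pos)
    also have "\<dots> = - (L\<^sup>2 / c * (1 - b / (2 * c)))"
      using c(1) by (simp add: field_simps power2_eq_square)
    finally have "L\<^sup>2 / c * (1 - b / (2 * c)) \<le> 0" by simp
    moreover have "1 - b / (2 * c) > 0" using c(2) by simp
    ultimately have "L\<^sup>2 / c \<le> 0" by (metis mult_pos_pos not_le)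
    then have "L = 0" using c(1) by (simp add: divide_le_0_iff)
    then show ?thesis unfolding L_def by simp
  qed
  with u show thesis by (rule that)
qed


section \<open>Test functions\<close>

lemma C1c_I:
  assumes "\<And>x. (\<phi> has_vector_derivative \<phi>' x) (at x)" "continuous_on UNIV \<phi>'" "compact K" "K \<subseteq> U"
    "\<And>x. x \<notin> K \<Longrightarrow> \<phi> x = 0"
  shows "\<phi> \<in> C1c U"
  using assms unfolding C1c_def C1_differentiable_on_def by blast

lemma C1c_E:
  assumes "\<phi> \<in> C1c U"
  obtains \<phi>' K where "\<And>x. (\<phi> has_vector_derivative \<phi>' x) (at x)" "continuous_on UNIV \<phi>'"
    "continuous_on UNIV \<phi>" "compact K" "K \<subseteq> U" "\<And>x. x \<notin> K \<Longrightarrow> \<phi> x = 0" "\<And>x. x \<notin> K \<Longrightarrow> \<phi>' x = 0"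
    "(\<lambda>x. vector_derivative \<phi> (at x)) = \<phi>'"
proof -
  obtain \<phi>' K where \<phi>: "\<And>x. (\<phi> has_vector_derivative \<phi>' x) (at x)" "continuous_on UNIV \<phi>'"
    and K: "compact K" "K \<subseteq> U" "\<And>x. x \<notin> K \<Longrightarrow> \<phi> x = 0"
    using assms unfolding C1c_def C1_differentiable_on_def by blast
  have "\<phi>' x = 0" if "x \<notin> K" for x
  proof -
    have "(\<phi> has_vector_derivative 0) (at x)"
      by (rule has_vector_derivative_transform_within_open[of "\<lambda>_. 0" 0 x "- K"])
        (use K that compact_imp_closed in auto)
    then show ?thesis using \<phi>(1) vector_derivative_unique_at by blast
  qed
  moreover have "continuous_on UNIV \<phi>"
    using \<phi>(1) by (intro continuous_at_imp_continuous_on ballI) (auto intro: has_vector_derivative_continuous)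
  moreover have "(\<lambda>x. vector_derivative \<phi> (at x)) = \<phi>'"
    using \<phi>(1) by (auto intro: vector_derivative_at)
  ultimately show thesis using \<phi> K that by metis
qed

lemma C1c_mono: "\<phi> \<in> C1c U \<Longrightarrow> U \<subseteq> V \<Longrightarrow> \<phi> \<in> C1c V"
  unfolding C1c_def by blast

lemma borel_measurable_continuous: "continuous_on UNIV f \<Longrightarrow> f \<in> borel_measurable borel"
  for f :: "real \<Rightarrow> complex"
  by (rule borel_measurable_continuous_onI)

lemma continuous_compact_support_L2:
  fixes f :: "real \<Rightarrow> complex"
  assumes "continuous_on UNIV f" "compact K" "K \<subseteq> S" "\<And>x. x \<notin> K \<Longrightarrow> f x = 0"
  shows "f \<in> L2 S"
proof (rule L2_I)
  show "f \<in> borel_measurable borel" by (rule borel_measurable_continuous[OF assms(1)])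
  have "integrable lborel (\<lambda>x. indicator K x *\<^sub>R (cmod (f x))\<^sup>2)"
    by (rule borel_integrable_compact[OF assms(2)]) (intro continuous_intros continuous_on_subset[OF assms(1)] subset_UNIV)
  also have "(\<lambda>x. indicator K x *\<^sub>R (cmod (f x))\<^sup>2) = (\<lambda>x. (cmod (f x))\<^sup>2)"
    using assms(4) by (auto simp: fun_eq_iff split: split_indicator)
  finally show "integrable lborel (\<lambda>x. (cmod (f x))\<^sup>2)" .
qed (use assms in auto)

lemma continuous_compact_support_integrable:
  fixes f :: "real \<Rightarrow> complex"
  assumes "continuous_on UNIV f" "compact K" "\<And>x. x \<notin> K \<Longrightarrow> f x = 0"
  shows "integrable lborel f"
proof -
  have "integrable lborel (\<lambda>x. indicator K x *\<^sub>R f x)"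
    by (rule borel_integrable_compact[OF assms(2)]) (intro continuous_on_subset[OF assms(1)] subset_UNIV)
  also have "(\<lambda>x. indicator K x *\<^sub>R f x) = f"
    using assms(3) by (auto simp: indicator_def)
  finally show ?thesis .
qed

lemma continuous_compact_support_bounded:
  fixes f :: "real \<Rightarrow> complex"
  assumes "continuous_on UNIV f" "compact K" "\<And>x. x \<notin> K \<Longrightarrow> f x = 0"
  obtains C where "C > 0" "\<And>x. cmod (f x) \<le> C"
proof -
  have "bounded (f ` K)"
    by (rule compact_imp_bounded[OF compact_continuous_image[OF continuous_on_subset[OF assms(1)] assms(2)]]) simp
  then obtain C where C: "\<And>y. y \<in> f ` K \<Longrightarrow> cmod y \<le> C" unfolding bounded_iff by blast
  have "cmod (f x) \<le> max C 1" for x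
    using C[of "f x"] assms(3)[of x] by (cases "x \<in> K") (auto simp: max_def)
  then show thesis by (rule that[rotated]) auto
qed

lemma integral_deriv_compact_support:
  fixes f :: "real \<Rightarrow> complex"
  assumes "\<And>x. (f has_vector_derivative f' x) (at x)" "continuous_on UNIV f'" "compact K"
    "\<And>x. x \<notin> K \<Longrightarrow> f x = 0" "\<And>x. x \<notin> K \<Longrightarrow> f' x = 0"
  shows "(\<integral>x. f' x \<partial>lborel) = 0"
proof -
  obtain A where A: "\<And>x. x \<in> K \<Longrightarrow> norm x \<le> A" "A > 0"
    using compact_imp_bounded[OF assms(3)] bounded_pos[of K] by blast
  have "(\<integral>x. indicator {-(A+1)..A+1} x *\<^sub>R f' x \<partial>lborel) = f (A+1) - f (-(A+1))"
    by (rule integral_FTC_Icc) (use A assms in \<open>auto intro: has_vector_derivative_at_within continuous_on_subset\<close>)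
  moreover have "indicator {-(A+1)..A+1} x *\<^sub>R f' x = f' x" for x
    using A(1)[of x] assms(5)[of x] by (cases "x \<in> K") (auto simp: indicator_def)
  moreover have "f (A+1) = 0" "f (-(A+1)) = 0"
    using A(1)[of "A+1"] A(1)[of "-(A+1)"] A(2) assms(4) by auto
  ultimately show ?thesis by simp
qed

text \<open>Every continuous function with compact support and mean zero is the derivative of a test function.
  This is what makes the definition of the weak derivative usable in the lemma of du Bois-Reymond.\<close>

lemma continuous_zero_mean_antiderivative:
  fixes \<psi> :: "real \<Rightarrow> complex"
  assumes cont: "continuous_on UNIV \<psi>" and "c \<le> d" and off: "\<And>x. x \<notin> {c..d} \<Longrightarrow> \<psi> x = 0"
    and mean: "(\<integral>x. \<psi> x \<partial>lborel) = 0"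
  obtains \<phi> where "\<And>x. (\<phi> has_vector_derivative \<psi> x) (at x)" "\<And>x. x \<notin> {c<..<d} \<Longrightarrow> \<phi> x = 0"
proof -
  obtain F where F: "\<And>x. (F has_vector_derivative \<psi> x) (at x)"
    using einterval_antiderivative[of "-\<infinity>" \<infinity> \<psi>] cont by (auto simp: continuous_on_eq_continuous_at)
  define \<phi> where "\<phi> x = F x - F c" for x
  have FTC: "(\<integral>x. indicator {s..t} x *\<^sub>R \<psi> x \<partial>lborel) = \<phi> t - \<phi> s" if "s \<le> t" for s t
    unfolding \<phi>_def using F that cont
    by (subst integral_FTC_Icc[of s t F]) (auto intro: has_vector_derivative_at_within continuous_on_subset)
  have "(\<phi> has_vector_derivative \<psi> x) (at x)" for x
    unfolding \<phi>_def using F by (auto intro!: derivative_eq_intros)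
  moreover have "\<phi> x = 0" if "x \<notin> {c<..<d}" for x
  proof (cases "x \<le> c")
    case True
    have "(\<integral>t. indicator {x..c} t *\<^sub>R \<psi> t \<partial>lborel) = (\<integral>t. 0 \<partial>(lborel::real measure))"
      using borel_measurable_continuous[OF cont] AE_lborel_singleton[of c]
      by (intro integral_cong_AE) (auto simp: off indicator_def)
    then show ?thesis using FTC[OF True] by (simp add: \<phi>_def)
  next
    case False
    then have x: "x \<ge> d" using that by auto
    have "(\<integral>t. indicator {c..x} t *\<^sub>R \<psi> t \<partial>lborel) = (\<integral>t. \<psi> t \<partial>lborel)"
      using x off by (intro Bochner_Integration.integral_cong) (auto simp: indicator_def)
    then show ?thesis using FTC[of c x] False mean by (simp add: \<phi>_def)
  qed
  ultimately show thesis by (rule that)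
qed

text \<open>The square of the positive part is $C^1$; bumps and cutoffs are assembled from it.\<close>

lemma pos_part_sq_deriv: "((\<lambda>x::real. (max 0 x)\<^sup>2) has_real_derivative 2 * max 0 x) (at x)"
proof -
  consider "x < 0" | "x = 0" | "x > 0" by linarith
  then show ?thesis
  proof cases
    case 1
    have "((\<lambda>x::real. 0) has_real_derivative 2 * max 0 x) (at x)" using 1 by simp
    then show ?thesis
      by (rule has_field_derivative_transform_within_open[of _ _ _ "{..<0}"]) (use 1 in auto)
  next
    case 2
    have "((\<lambda>h::real. (max 0 h)\<^sup>2 / h) \<longlongrightarrow> 0) (at 0)"
    proof (rule Lim_null_comparison)
      show "\<forall>\<^sub>F h::real in at 0. norm ((max 0 h)\<^sup>2 / h) \<le> \<bar>h\<bar>"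
        by (rule always_eventually) (auto simp: max_def power2_eq_square)
      show "((\<lambda>h::real. \<bar>h\<bar>) \<longlongrightarrow> 0) (at 0)" by (intro tendsto_rabs_zero tendsto_ident_at)
    qed
    then show ?thesis using 2 by (simp add: has_field_derivative_iff)
  next
    case 3
    have "((\<lambda>x::real. x\<^sup>2) has_real_derivative 2 * max 0 x) (at x)"
      using 3 by (auto intro!: derivative_eq_intros)
    then show ?thesis
      by (rule has_field_derivative_transform_within_open[of _ _ _ "{0<..}"]) (use 3 in auto)
  qed
qed


text \<open>On its support $[c,d]$ the bump is a polynomial with double zeros at the end points, which makes it $C^1$.\<close>

definition bump :: "real \<Rightarrow> real \<Rightarrow> real \<Rightarrow> real" where
  "bump c d x = (max 0 (x - c))\<^sup>2 * (max 0 (d - x))\<^sup>2"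

definition bump' :: "real \<Rightarrow> real \<Rightarrow> real \<Rightarrow> real" where
  "bump' c d x = 2 * max 0 (x - c) * (max 0 (d - x))\<^sup>2 - 2 * max 0 (d - x) * (max 0 (x - c))\<^sup>2"

lemma bump_deriv: "(bump c d has_real_derivative bump' c d x) (at x)"
proof -
  have "((\<lambda>x. (max 0 (x - c))\<^sup>2) has_real_derivative 2 * max 0 (x - c) * 1) (at x)"
    by (rule DERIV_chain2[OF pos_part_sq_deriv]) (auto intro!: derivative_eq_intros)
  moreover have "((\<lambda>x. (max 0 (d - x))\<^sup>2) has_real_derivative 2 * max 0 (d - x) * (-1)) (at x)"
    by (rule DERIV_chain2[OF pos_part_sq_deriv]) (auto intro!: derivative_eq_intros)
  ultimately show ?thesis
    using DERIV_mult[of "\<lambda>x. (max 0 (x - c))\<^sup>2" _ x UNIV "\<lambda>x. (max 0 (d - x))\<^sup>2"]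
    unfolding bump_def[abs_def] bump'_def by (fastforce simp: algebra_simps)
qed

lemma bump_continuous: "continuous_on A (bump c d)"
  unfolding bump_def[abs_def] by (intro continuous_intros)

lemma bump'_continuous: "continuous_on A (bump' c d)"
  unfolding bump'_def[abs_def] by (intro continuous_intros)

lemma bump_zero: "x \<notin> {c<..<d} \<Longrightarrow> bump c d x = 0"
  unfolding bump_def by (auto simp: max_def)

lemma bump_pos: "x \<in> {c<..<d} \<Longrightarrow> bump c d x > 0"
  unfolding bump_def by (auto simp: max_def)

lemma bump_nonneg: "bump c d x \<ge> 0"
  unfolding bump_def by auto

lemma bump_cont_cplx: "continuous_on A (\<lambda>x. complex_of_real (bump c d x))"
  by (intro continuous_intros bump_continuous)

lemma bump_mult_C1c:
  assumes "\<And>x. (p has_vector_derivative p' x) (at x)" "continuous_on UNIV p'"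
  shows "(\<lambda>x. of_real (bump c d x) * p x) \<in> C1c {c..d}"
proof (rule C1c_I[where K = "{c..d}"])
  show "((\<lambda>x. of_real (bump c d x) * p x) has_vector_derivative
      of_real (bump c d x) * p' x + of_real (bump' c d x) * p x) (at x)" for x
    by (intro has_vector_derivative_mult has_vector_derivative_of_real bump_deriv assms)
  have "continuous_on UNIV p"
    using assms(1) by (intro continuous_at_imp_continuous_on ballI) (auto intro: has_vector_derivative_continuous)
  then show "continuous_on UNIV (\<lambda>x. of_real (bump c d x) * p' x + of_real (bump' c d x) * p x)"
    by (intro continuous_intros assms bump_continuous bump'_continuous)
  show "of_real (bump c d x) * p x = 0" if "x \<notin> {c..d}" for x
    using bump_zero[of x c d] that by auto
qed auto

lemma bump_integral_pos:
  assumes "c < d" shows "(\<integral>x. bump c d x \<partial>lborel) > 0"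
proof -
  have int: "integrable lborel (bump c d)"
  proof -
    have "integrable lborel (\<lambda>x. indicator {c..d} x *\<^sub>R bump c d x)"
      by (rule borel_integrable_compact) (auto intro: bump_continuous)
    also have "(\<lambda>x. indicator {c..d} x *\<^sub>R bump c d x) = bump c d"
      using bump_zero[of _ c d] by (auto simp: fun_eq_iff split: split_indicator)
    finally show ?thesis .
  qed
  have "(\<integral>x. bump c d x \<partial>lborel) \<noteq> 0"
  proof
    assume "(\<integral>x. bump c d x \<partial>lborel) = 0"
    then have "AE x in lborel. bump c d x = 0"
      using integral_nonneg_eq_0_iff_AE[OF int] bump_nonneg by auto
    then have "AE x in lborel. x \<notin> {c<..<d}"
      by eventually_elim (use bump_pos in force)
    then have "emeasure lborel {c<..<d} = 0"
      by (subst (asm) AE_iff_measurable[of "{c<..<d}"]) auto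
    then show False using assms by simp
  qed
  moreover have "(\<integral>x. bump c d x \<partial>lborel) \<ge> 0" using bump_nonneg by auto
  ultimately show ?thesis by simp
qed

section \<open>The fundamental lemma of the calculus of variations\<close>

text \<open>A truncation that keeps continuity and turns pointwise convergence into dominated
  convergence.\<close>

definition clip :: "real \<Rightarrow> complex \<Rightarrow> complex" where
  "clip K z = of_real (K / max K (cmod z)) * z"

lemma clip_bound: "K > 0 \<Longrightarrow> cmod (clip K z) \<le> K"
proof -
  assume K: "K > 0"
  have "cmod (clip K z) = K / max K (cmod z) * cmod z"
    unfolding clip_def using K by (simp add: norm_mult norm_divide)
  also have "\<dots> \<le> K" using K by (simp add: field_simps max_def)
  finally show ?thesis .
qed

lemma clip_continuous: "K > 0 \<Longrightarrow> continuous_on A (clip K)"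
  unfolding clip_def[abs_def] by (intro continuous_intros) auto

lemma clip_id: "cmod z \<le> K \<Longrightarrow> K > 0 \<Longrightarrow> clip K z = z"
  unfolding clip_def by (simp add: max_def)

lemma clip_le: "K > 0 \<Longrightarrow> cmod (clip K z) \<le> cmod z"
proof -
  assume K: "K > 0"
  have "cmod (clip K z) = K / max K (cmod z) * cmod z"
    unfolding clip_def using K by (simp add: norm_mult norm_divide)
  also have "\<dots> \<le> 1 * cmod z" using K by (intro mult_right_mono) (auto simp: divide_le_eq_1 max_def)
  finally show ?thesis by simp
qed

lemma continuous_AE_approx:
  fixes f :: "real \<Rightarrow> complex"
  assumes "f \<in> borel_measurable borel"
  obtains g where "\<And>n::nat. continuous_on UNIV (g n)" "AE x in lborel. (\<lambda>n. g n x) \<longlonglongrightarrow> f x"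
proof -
  have "f \<in> borel_measurable lebesgue"
    using assms by (simp add: measurable_completion)
  then have "f measurable_on UNIV" by (intro lebesgue_measurable_imp_measurable_on) auto
  then obtain N g where N: "negligible N" and g: "\<And>n. continuous_on UNIV (g n)"
    and lim: "\<And>x. x \<notin> N \<Longrightarrow> (\<lambda>n. g n x) \<longlonglongrightarrow> f x"
    unfolding measurable_on_def by auto
  have "N \<in> null_sets lebesgue" using N by (simp add: negligible_iff_null_sets)
  then have "AE x in lebesgue. x \<notin> N" by (rule AE_not_in)
  then have "AE x in lborel. x \<notin> N" by (simp add: AE_completion_iff)
  then have "AE x in lborel. (\<lambda>n. g n x) \<longlonglongrightarrow> f x" by eventually_elim (use lim in auto)
  with g show thesis by (rule that)
qed

text \<open>Approximate $\bar k$ almost everywhere by continuous functions and clip them, so that dominated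
  convergence applies. In the limit $\int |k|^2 / \max(1, |k|) = 0$.\<close>

lemma AE_zero_if_orthogonal_continuous:
  fixes k :: "real \<Rightarrow> complex"
  assumes k: "integrable lborel k"
    and orth: "\<And>g. continuous_on UNIV g \<Longrightarrow> (\<And>x. cmod (g x) \<le> 1) \<Longrightarrow> (\<integral>x. k x * g x \<partial>lborel) = 0"
  shows "AE x in lborel. k x = 0"
proof -
  have [measurable]: "k \<in> borel_measurable borel" using borel_measurable_integrable[OF k] by simp
  have cm [measurable]: "(\<lambda>x. cnj (k x)) \<in> borel_measurable borel"
    by (rule borel_measurable_continuous_on[of cnj]) (auto intro: continuous_intros)
  obtain g where g: "\<And>n::nat. continuous_on UNIV (g n)" and lim: "AE x in lborel. (\<lambda>n. g n x) \<longlonglongrightarrow> cnj (k x)"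
    using continuous_AE_approx[OF cm] by blast
  have cc: "continuous_on UNIV (\<lambda>x. clip 1 (g n x))" for n
    using continuous_on_compose2[OF clip_continuous[of 1 UNIV] g[of n]] by simp
  have ccl: "clip 1 \<in> borel_measurable borel"
    by (rule borel_measurable_continuous_onI) (rule clip_continuous, simp)
  have "(\<lambda>n. \<integral>x. k x * clip 1 (g n x) \<partial>lborel) \<longlonglongrightarrow> (\<integral>x. k x * clip 1 (cnj (k x)) \<partial>lborel)"
  proof (rule integral_dominated_convergence[where w = "\<lambda>x. cmod (k x)"])
    show "integrable lborel (\<lambda>x. cmod (k x))" using k by simp
    show "AE x in lborel. norm (k x * clip 1 (g n x)) \<le> cmod (k x)" for n
      using clip_bound[of 1] by (auto simp: norm_mult intro!: mult_left_le AE_I2)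
    show "AE x in lborel. (\<lambda>n. k x * clip 1 (g n x)) \<longlonglongrightarrow> k x * clip 1 (cnj (k x))"
      using lim
    proof eventually_elim
      case (elim x)
      then show ?case
        by (intro tendsto_mult tendsto_const continuous_on_tendsto_compose[OF clip_continuous[of 1 UNIV]]) auto
    qed
    show "(\<lambda>x. k x * clip 1 (g n x)) \<in> borel_measurable lborel" for n
      using borel_measurable_continuous[OF cc[of n]] by measurable
    show "(\<lambda>x. k x * clip 1 (cnj (k x))) \<in> borel_measurable lborel"
      using measurable_compose[OF cm ccl] by measurable
  qed
  moreover have "(\<integral>x. k x * clip 1 (g n x) \<partial>lborel) = 0" for n
    by (rule orth[OF cc clip_bound]) simp
  ultimately have "(\<lambda>n. 0) \<longlonglongrightarrow> (\<integral>x. k x * clip 1 (cnj (k x)) \<partial>lborel)" by simp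
  then have "(\<integral>x. k x * clip 1 (cnj (k x)) \<partial>lborel) = 0"
    by (simp add: LIMSEQ_const_iff)
  moreover have "k x * clip 1 (cnj (k x)) = of_real ((cmod (k x))\<^sup>2 / max 1 (cmod (k x)))" for x
    unfolding clip_def using complex_norm_square[of "k x"] by (simp add: mult_ac)
  ultimately have "(\<integral>x. complex_of_real ((cmod (k x))\<^sup>2 / max 1 (cmod (k x))) \<partial>lborel) = 0" by simp
  then have z: "(\<integral>x. (cmod (k x))\<^sup>2 / max 1 (cmod (k x)) \<partial>lborel) = 0"
    by (simp only: integral_complex_of_real of_real_eq_0_iff)
  have "integrable lborel (\<lambda>x. (cmod (k x))\<^sup>2 / max 1 (cmod (k x)))"
  proof (rule Bochner_Integration.integrable_bound[OF k])
    show "AE x in lborel. norm ((cmod (k x))\<^sup>2 / max 1 (cmod (k x))) \<le> norm (k x)"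
      by (rule AE_I2) (auto simp: max_def power2_eq_square mult_left_le)
  qed measurable
  then have "AE x in lborel. (cmod (k x))\<^sup>2 / max 1 (cmod (k x)) = 0"
    using integral_nonneg_eq_0_iff_AE[of lborel "\<lambda>x. (cmod (k x))\<^sup>2 / max 1 (cmod (k x))"] z
    by (simp add: less_max_iff_disj le_max_iff_disj)
  then show ?thesis
    by eventually_elim (auto simp: max_def split: if_splits)
qed

text \<open>To pass from continuous to $C^1$ test functions with support in $[c,d]$, the function is
  multiplied by a fixed polynomial bump that is positive on $(c,d)$; the product of a bump and a
  polynomial is a test function, and polynomials are uniformly dense.\<close>

lemma AE_zero_if_orthogonal_C1c:
  fixes k :: "real \<Rightarrow> complex"
  assumes k: "integrable lborel (\<lambda>x. indicator {c..d} x * k x)"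
    and orth: "\<And>\<phi>. \<phi> \<in> C1c {c..d} \<Longrightarrow> (\<integral>x. k x * \<phi> x \<partial>lborel) = 0"
  shows "AE x in lborel. x \<in> {c..d} \<longrightarrow> k x = 0"
proof -
  let ?b = "\<lambda>x. complex_of_real (bump c d x)"
  obtain C where C: "\<And>x. cmod (?b x) \<le> C"
  proof (rule continuous_compact_support_bounded[OF bump_cont_cplx compact_Icc[of c d]])
    show "?b x = 0" if "x \<notin> {c..d}" for x using bump_zero[of x c d] that by auto
  qed blast
  have [measurable]: "?b \<in> borel_measurable borel" by (rule borel_measurable_continuous[OF bump_cont_cplx])
  have eq: "?b x * (indicator {c..d} x * k x) = ?b x * k x" for x
    using bump_zero[of x c d] by (auto split: split_indicator)
  have ib: "integrable lborel (\<lambda>x. ?b x * k x)"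
  proof -
    have "integrable lborel (\<lambda>x. ?b x * (indicator {c..d} x * k x))"
    proof (rule Bochner_Integration.integrable_bound)
      show "integrable lborel (\<lambda>x. C * norm (indicator {c..d} x * k x))" using k by simp
      show "AE x in lborel. norm (?b x * (indicator {c..d} x * k x))
          \<le> norm (C * norm (indicator {c..d} x * k x))"
        using C order_trans[OF norm_ge_zero C] by (auto simp: norm_mult abs_mult intro!: mult_right_mono)
      show "(\<lambda>x. ?b x * (indicator {c..d} x * k x)) \<in> borel_measurable lborel"
        using borel_measurable_integrable[OF k] by measurable
    qed
    then show ?thesis unfolding eq .
  qed
  have "AE x in lborel. ?b x * k x = 0"
  proof (rule AE_zero_if_orthogonal_continuous[OF ib])
    fix g :: "real \<Rightarrow> complex" assume g: "continuous_on UNIV g" "\<And>x. cmod (g x) \<le> 1"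
    let ?k = "\<lambda>x. ?b x * k x"
    have "cmod (\<integral>x. ?k x * g x \<partial>lborel) \<le> 0"
    proof (rule field_le_epsilon)
      fix e :: real assume e: "e > 0"
      define I where "I = (\<integral>x. cmod (?k x) \<partial>lborel)"
      have I: "I \<ge> 0" unfolding I_def by simp
      define e' where "e' = e / (I + 1)"
      have e': "e' > 0" using e I unfolding e'_def by auto
      obtain p where p: "polynomial_function p" "\<And>x. x \<in> {c..d} \<Longrightarrow> norm (g x - p x) < e'"
        using Stone_Weierstrass_polynomial_function[of "{c..d}" g e'] continuous_on_subset[OF g(1)] e' by blast
      obtain p' where p': "polynomial_function p'" "\<And>x. (p has_vector_derivative p' x) (at x)"
        using has_vector_derivative_polynomial_function[OF p(1)] by blast
      have "(\<lambda>x. ?b x * p x) \<in> C1c {c..d}"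
        by (rule bump_mult_C1c[OF p'(2)]) (use p'(1) continuous_on_polymonial_function in blast)
      from orth[OF this] have 0: "(\<integral>x. ?k x * p x \<partial>lborel) = 0" by (simp add: mult_ac)
      have [measurable]: "g \<in> borel_measurable borel" "p \<in> borel_measurable borel"
        using borel_measurable_continuous g(1) continuous_on_polymonial_function p(1) by blast+
      note [measurable] = borel_measurable_integrable[OF ib]
      have b: "cmod (?k x * (g x - p x)) \<le> e' * cmod (?k x)" for x
      proof (cases "x \<in> {c..d}")
        case True
        have "cmod (?k x) * cmod (g x - p x) \<le> cmod (?k x) * e'"
          using p(2)[OF True] by (intro mult_left_mono) auto
        then show ?thesis by (simp add: norm_mult mult_ac)
      qed (use bump_zero[of x c d] in auto)
      have i1: "integrable lborel (\<lambda>x. ?k x * g x)"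
        by (rule Bochner_Integration.integrable_bound[OF ib])
          (use g(2) in \<open>auto simp: norm_mult intro!: mult_left_le\<close>)
      have i2: "integrable lborel (\<lambda>x. ?k x * (g x - p x))"
        by (rule Bochner_Integration.integrable_bound[of _ "\<lambda>x. e' * cmod (?k x)"])
          (use ib b e' in auto)
      have "integrable lborel (\<lambda>x. ?k x * g x - ?k x * (g x - p x))" using i1 i2 by (rule Bochner_Integration.integrable_diff)
      then have i3: "integrable lborel (\<lambda>x. ?k x * p x)" by (simp add: algebra_simps)
      have "(\<integral>x. ?k x * g x \<partial>lborel) = (\<integral>x. ?k x * (g x - p x) + ?k x * p x \<partial>lborel)"
        by (simp add: algebra_simps)
      also have "\<dots> = (\<integral>x. ?k x * (g x - p x) \<partial>lborel)"
        using i2 i3 0 by simp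
      also have "cmod \<dots> \<le> (\<integral>x. e' * cmod (?k x) \<partial>lborel)"
        by (rule Bochner_Integration.integral_norm_bound_integral[OF i2]) (use ib b in auto)
      also have "\<dots> = e' * I" unfolding I_def by simp
      also have "\<dots> \<le> e" using e I unfolding e'_def by (simp add: field_simps)
      finally show "cmod (\<integral>x. ?k x * g x \<partial>lborel) \<le> 0 + e" by simp
    qed
    then show "(\<integral>x. ?k x * g x \<partial>lborel) = 0" by simp
  qed
  then show ?thesis
    using AE_lborel_singleton[of c] AE_lborel_singleton[of d]
  proof eventually_elim
    case (elim x)
    then show ?case using bump_pos[of x c d] by auto
  qed
qed

text \<open>An open set is the union of the countably many compact intervals with rational end points inside it.\<close>

lemma AE_on_open:
  fixes U :: "real set"
  assumes "open U" "\<And>c d. c < d \<Longrightarrow> {c..d} \<subseteq> U \<Longrightarrow> AE x in lborel. x \<in> {c..d} \<longrightarrow> P x"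
  shows "AE x in lborel. x \<in> U \<longrightarrow> P x"
proof -
  have "AE x in lborel. \<forall>c\<in>\<rat>. \<forall>d\<in>\<rat>. c < d \<longrightarrow> {c..d} \<subseteq> U \<longrightarrow> x \<in> {c..d} \<longrightarrow> P x"
    using assms(2) by (intro AE_ball_countable' countable_rat) auto
  then show ?thesis
  proof eventually_elim
    case (elim x)
    show ?case
    proof
      assume "x \<in> U"
      then obtain e where e: "e > 0" "cball x e \<subseteq> U" using assms(1) open_contains_cball by blast
      obtain c d where cd: "c \<in> \<rat>" "x - e < c" "c < x" "d \<in> \<rat>" "x < d" "d < x + e"
        using Rats_dense_in_real[of "x - e" x] Rats_dense_in_real[of x "x + e"] e(1) by auto
      have "{c..d} \<subseteq> cball x e" using cd by (auto simp: dist_real_def)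
      then show "P x" using elim cd e by force
    qed
  qed
qed


section \<open>Weak derivatives\<close>

lemma is_weak_deriv_I:
  assumes "\<And>\<phi> \<phi>' K. (\<And>x. (\<phi> has_vector_derivative \<phi>' x) (at x)) \<Longrightarrow> continuous_on UNIV \<phi>' \<Longrightarrow>
      continuous_on UNIV \<phi> \<Longrightarrow> compact K \<Longrightarrow> K \<subseteq> interior S \<Longrightarrow> (\<And>x. x \<notin> K \<Longrightarrow> \<phi> x = 0) \<Longrightarrow>
      (\<And>x. x \<notin> K \<Longrightarrow> \<phi>' x = 0) \<Longrightarrow> (\<integral>x. u x * \<phi>' x \<partial>lborel) = - (\<integral>x. v x * \<phi> x \<partial>lborel)"
  shows "is_weak_deriv S u v"
  unfolding is_weak_deriv_def
proof
  fix \<phi> assume "\<phi> \<in> C1c (interior S)"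
  then obtain \<phi>' K where *: "\<And>x. (\<phi> has_vector_derivative \<phi>' x) (at x)" "continuous_on UNIV \<phi>'"
    "continuous_on UNIV \<phi>" "compact K" "K \<subseteq> interior S" "\<And>x. x \<notin> K \<Longrightarrow> \<phi> x = 0" "\<And>x. x \<notin> K \<Longrightarrow> \<phi>' x = 0"
    "(\<lambda>x. vector_derivative \<phi> (at x)) = \<phi>'" by (rule C1c_E) (rule that)
  show "(\<integral>x. u x * vector_derivative \<phi> (at x) \<partial>lborel) = - (\<integral>x. v x * \<phi> x \<partial>lborel)"
    using assms[OF *(1-7)] fun_cong[OF *(8)] by simp
qed

lemma is_weak_deriv_D:
  assumes "is_weak_deriv S u v" "\<And>x. (\<phi> has_vector_derivative \<phi>' x) (at x)" "continuous_on UNIV \<phi>'"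
    "compact K" "K \<subseteq> interior S" "\<And>x. x \<notin> K \<Longrightarrow> \<phi> x = 0"
  shows "(\<integral>x. u x * \<phi>' x \<partial>lborel) = - (\<integral>x. v x * \<phi> x \<partial>lborel)"
proof -
  have "\<phi> \<in> C1c (interior S)" by (rule C1c_I[OF assms(2-6)])
  moreover have "vector_derivative \<phi> (at x) = \<phi>' x" for x by (rule vector_derivative_at[OF assms(2)])
  ultimately show ?thesis using assms(1) unfolding is_weak_deriv_def by force
qed

lemma is_weak_deriv_comb:
  assumes "is_weak_deriv S u1 v1" "is_weak_deriv S u2 v2"
    and L: "u1 \<in> L2 S" "v1 \<in> L2 S" "u2 \<in> L2 S" "v2 \<in> L2 S"
  shows "is_weak_deriv S (\<lambda>x. u1 x + c * u2 x) (\<lambda>x. v1 x + c * v2 x)"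
proof (rule is_weak_deriv_I)
  fix \<phi> \<phi>' :: "real \<Rightarrow> complex" and K
  assume \<phi>: "\<And>x. (\<phi> has_vector_derivative \<phi>' x) (at x)" "continuous_on UNIV \<phi>'"
      "continuous_on UNIV \<phi>" "compact K" "K \<subseteq> interior S" "\<And>x. x \<notin> K \<Longrightarrow> \<phi> x = 0" "\<And>x. x \<notin> K \<Longrightarrow> \<phi>' x = 0"
  have 1: "\<phi> \<in> L2 UNIV" "\<phi>' \<in> L2 UNIV"
    using continuous_compact_support_L2[OF \<phi>(3,4) subset_UNIV \<phi>(6)]
      continuous_compact_support_L2[OF \<phi>(2,4) subset_UNIV \<phi>(7)] by auto
  have "(\<integral>x. (u1 x + c * u2 x) * \<phi>' x \<partial>lborel) = (\<integral>x. u1 x * \<phi>' x + c * (u2 x * \<phi>' x) \<partial>lborel)"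
    by (simp add: algebra_simps)
  also have "\<dots> = (\<integral>x. u1 x * \<phi>' x \<partial>lborel) + c * (\<integral>x. u2 x * \<phi>' x \<partial>lborel)"
    using L2_prod_integrable[OF L(1) 1(2)] L2_prod_integrable[OF L(3) 1(2)] by simp
  also have "\<dots> = - ((\<integral>x. v1 x * \<phi> x \<partial>lborel) + c * (\<integral>x. v2 x * \<phi> x \<partial>lborel))"
    using is_weak_deriv_D[OF assms(1) \<phi>(1,2,4,5,6)] is_weak_deriv_D[OF assms(2) \<phi>(1,2,4,5,6)]
    by (simp add: algebra_simps)
  also have "\<dots> = - (\<integral>x. v1 x * \<phi> x + c * (v2 x * \<phi> x) \<partial>lborel)"
    using L2_prod_integrable[OF L(2) 1(1)] L2_prod_integrable[OF L(4) 1(1)] by simp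
  also have "\<dots> = - (\<integral>x. (v1 x + c * v2 x) * \<phi> x \<partial>lborel)"
    by (simp add: algebra_simps)
  finally show "(\<integral>x. (u1 x + c * u2 x) * \<phi>' x \<partial>lborel) = - (\<integral>x. (v1 x + c * v2 x) * \<phi> x \<partial>lborel)" .
qed

lemma tendsto_integral_prod:
  assumes "\<And>n::nat. f n \<in> L2 S" "g \<in> L2 S" "k \<in> L2 T" "(\<lambda>n. l2_norm (\<lambda>x. f n x - g x)) \<longlonglongrightarrow> 0"
  shows "(\<lambda>n. \<integral>x. f n x * k x \<partial>lborel) \<longlonglongrightarrow> (\<integral>x. g x * k x \<partial>lborel)"
proof (rule Lim_transform[OF tendsto_const])
  show "(\<lambda>n. (\<integral>x. f n x * k x \<partial>lborel) - (\<integral>x. g x * k x \<partial>lborel)) \<longlonglongrightarrow> 0"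
  proof (rule Lim_null_comparison)
    have "norm ((\<integral>x. f n x * k x \<partial>lborel) - (\<integral>x. g x * k x \<partial>lborel)) \<le> l2_norm (\<lambda>x. f n x - g x) * l2_norm k" for n
    proof -
      have "(\<integral>x. f n x * k x \<partial>lborel) - (\<integral>x. g x * k x \<partial>lborel) = (\<integral>x. (f n x - g x) * k x \<partial>lborel)"
        using L2_prod_integrable[OF assms(2,3)] L2_prod_integrable[OF assms(1,3)]
        by (simp add: left_diff_distrib)
      then show ?thesis
        using norm_integral_prod_le[OF L2_diff[OF assms(1) assms(2)] assms(3)] by simp
    qed
    then show "\<forall>\<^sub>F n in sequentially. norm ((\<integral>x. f n x * k x \<partial>lborel) - (\<integral>x. g x * k x \<partial>lborel))
        \<le> l2_norm (\<lambda>x. f n x - g x) * l2_norm k" by simp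
    show "(\<lambda>n. l2_norm (\<lambda>x. f n x - g x) * l2_norm k) \<longlonglongrightarrow> 0"
      using tendsto_mult_right[OF assms(4), of "l2_norm k"] by simp
  qed
qed

lemma is_weak_deriv_limit:
  assumes "\<And>n::nat. is_weak_deriv S (u n) (v n)" "\<And>n. u n \<in> L2 S" "\<And>n. v n \<in> L2 S" "u' \<in> L2 S" "v' \<in> L2 S"
    "(\<lambda>n. l2_norm (\<lambda>x. u n x - u' x)) \<longlonglongrightarrow> 0" "(\<lambda>n. l2_norm (\<lambda>x. v n x - v' x)) \<longlonglongrightarrow> 0"
  shows "is_weak_deriv S u' v'"
proof (rule is_weak_deriv_I)
  fix \<phi> \<phi>' :: "real \<Rightarrow> complex" and K
  assume \<phi>: "\<And>x. (\<phi> has_vector_derivative \<phi>' x) (at x)" "continuous_on UNIV \<phi>'"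
      "continuous_on UNIV \<phi>" "compact K" "K \<subseteq> interior S" "\<And>x. x \<notin> K \<Longrightarrow> \<phi> x = 0" "\<And>x. x \<notin> K \<Longrightarrow> \<phi>' x = 0"
  have 1: "\<phi> \<in> L2 UNIV" "\<phi>' \<in> L2 UNIV"
    using continuous_compact_support_L2[OF \<phi>(3,4) subset_UNIV \<phi>(6)]
      continuous_compact_support_L2[OF \<phi>(2,4) subset_UNIV \<phi>(7)] by auto
  have "(\<lambda>n. \<integral>x. u n x * \<phi>' x \<partial>lborel) \<longlonglongrightarrow> (\<integral>x. u' x * \<phi>' x \<partial>lborel)"
    by (rule tendsto_integral_prod[OF assms(2,4) 1(2) assms(6)])
  moreover have "(\<lambda>n. - (\<integral>x. v n x * \<phi> x \<partial>lborel)) \<longlonglongrightarrow> - (\<integral>x. v' x * \<phi> x \<partial>lborel)"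
    by (intro tendsto_minus tendsto_integral_prod[OF assms(3,5) 1(1) assms(7)])
  moreover have "(\<integral>x. u n x * \<phi>' x \<partial>lborel) = - (\<integral>x. v n x * \<phi> x \<partial>lborel)" for n
    by (rule is_weak_deriv_D[OF assms(1) \<phi>(1,2,4,5,6)])
  ultimately show "(\<integral>x. u' x * \<phi>' x \<partial>lborel) = - (\<integral>x. v' x * \<phi> x \<partial>lborel)"
    using LIMSEQ_unique by auto
qed

lemma is_weak_deriv_classical:
  assumes \<phi>: "\<And>x. (\<phi> has_vector_derivative \<phi>' x) (at x)" "continuous_on UNIV \<phi>'"
  shows "is_weak_deriv S \<phi> \<phi>'"
proof (rule is_weak_deriv_I)
  fix \<psi> \<psi>' :: "real \<Rightarrow> complex" and K
  assume \<psi>: "\<And>x. (\<psi> has_vector_derivative \<psi>' x) (at x)" "continuous_on UNIV \<psi>'"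
      "continuous_on UNIV \<psi>" "compact K" "K \<subseteq> interior S" "\<And>x. x \<notin> K \<Longrightarrow> \<psi> x = 0" "\<And>x. x \<notin> K \<Longrightarrow> \<psi>' x = 0"
  have c: "continuous_on UNIV \<phi>"
    using \<phi>(1) by (intro continuous_at_imp_continuous_on ballI) (auto intro: has_vector_derivative_continuous)
  have "(\<integral>x. \<phi> x * \<psi>' x + \<phi>' x * \<psi> x \<partial>lborel) = 0"
    by (rule integral_deriv_compact_support[of "\<lambda>x. \<phi> x * \<psi> x" _ K])
      (use \<psi> in \<open>auto intro!: has_vector_derivative_mult \<phi> continuous_intros c\<close>)
  moreover have "integrable lborel (\<lambda>x. \<phi> x * \<psi>' x)"
    by (rule continuous_compact_support_integrable[of _ K])
      (use \<psi> in \<open>auto intro!: continuous_intros c\<close>)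
  moreover have "integrable lborel (\<lambda>x. \<phi>' x * \<psi> x)"
    by (rule continuous_compact_support_integrable[of _ K])
      (use \<psi> in \<open>auto intro!: continuous_intros \<phi>(2)\<close>)
  ultimately have "(\<integral>x. \<phi> x * \<psi>' x \<partial>lborel) + (\<integral>x. \<phi>' x * \<psi> x \<partial>lborel) = 0" by simp
  then show "(\<integral>x. \<phi> x * \<psi>' x \<partial>lborel) = - (\<integral>x. \<phi>' x * \<psi> x \<partial>lborel)"
    by (simp add: eq_neg_iff_add_eq_0)
qed

text \<open>Multiplication by a cutoff \<open>\<theta>\<close>. The weak derivative on \<open>S\<close> is turned into one on \<open>T\<close>, which is
  possible because \<open>\<theta>\<close> is supported inside both sets, so that \<open>\<theta>\<phi>\<close> is a test function on \<open>S\<close> for every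
  test function \<open>\<phi>\<close> on \<open>T\<close>.\<close>

lemma is_weak_deriv_cutoff:
  assumes wd: "is_weak_deriv S u v" and L: "u \<in> L2 S" "v \<in> L2 S"
    and \<theta>: "\<And>x. (\<theta> has_real_derivative \<theta>' x) (at x)" "continuous_on UNIV \<theta>'" "compact K" "K \<subseteq> interior S"
      "\<And>x. x \<notin> K \<Longrightarrow> \<theta> x = 0"
  shows "is_weak_deriv T (\<lambda>x. of_real (\<theta> x) * u x) (\<lambda>x. of_real (\<theta>' x) * u x + of_real (\<theta> x) * v x)"
proof (rule is_weak_deriv_I)
  fix \<phi> \<phi>' :: "real \<Rightarrow> complex" and J
  assume \<phi>: "\<And>x. (\<phi> has_vector_derivative \<phi>' x) (at x)" "continuous_on UNIV \<phi>'"
      "continuous_on UNIV \<phi>" "compact J" "J \<subseteq> interior T" "\<And>x. x \<notin> J \<Longrightarrow> \<phi> x = 0" "\<And>x. x \<notin> J \<Longrightarrow> \<phi>' x = 0"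
  have c: "continuous_on UNIV \<theta>"
    using \<theta>(1) by (intro continuous_at_imp_continuous_on ballI DERIV_isCont)
  have i: "integrable lborel (\<lambda>x. g x * f x)" if "continuous_on UNIV f" "\<And>x. x \<notin> J \<Longrightarrow> f x = 0" "g \<in> L2 S" for f g
    by (rule L2_prod_integrable[OF that(3) continuous_compact_support_L2[OF that(1) \<phi>(4) subset_UNIV that(2)]])
  have eq: "(\<integral>x. u x * (of_real (\<theta> x) * \<phi>' x + of_real (\<theta>' x) * \<phi> x) \<partial>lborel) = - (\<integral>x. v x * (of_real (\<theta> x) * \<phi> x) \<partial>lborel)"
  proof (rule is_weak_deriv_D[OF wd _ _ \<theta>(3,4)])
    show "((\<lambda>x. of_real (\<theta> x) * \<phi> x) has_vector_derivative of_real (\<theta> x) * \<phi>' x + of_real (\<theta>' x) * \<phi> x) (at x)" for x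
      by (intro has_vector_derivative_mult has_vector_derivative_of_real \<theta> \<phi>)
    show "continuous_on UNIV (\<lambda>x. of_real (\<theta> x) * \<phi>' x + of_real (\<theta>' x) * \<phi> x)"
      by (intro continuous_intros c \<phi> \<theta>)
    show "of_real (\<theta> x) * \<phi> x = 0" if "x \<notin> K" for x using \<theta>(5)[OF that] by simp
  qed
  have i1: "integrable lborel (\<lambda>x. u x * (of_real (\<theta> x) * \<phi>' x))"
    by (rule i) (use \<phi> L in \<open>auto intro!: continuous_intros c\<close>)
  have i2: "integrable lborel (\<lambda>x. u x * (of_real (\<theta>' x) * \<phi> x))"
    by (rule i) (use \<phi> L in \<open>auto intro!: continuous_intros \<theta>\<close>)
  have i3: "integrable lborel (\<lambda>x. v x * (of_real (\<theta> x) * \<phi> x))"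
    by (rule i) (use \<phi> L in \<open>auto intro!: continuous_intros c\<close>)
  have "(\<integral>x. u x * (of_real (\<theta> x) * \<phi>' x) \<partial>lborel) + (\<integral>x. u x * (of_real (\<theta>' x) * \<phi> x) \<partial>lborel)
      = - (\<integral>x. v x * (of_real (\<theta> x) * \<phi> x) \<partial>lborel)"
    using eq i1 i2 by (simp add: distrib_left)
  then have "(\<integral>x. u x * (of_real (\<theta> x) * \<phi>' x) \<partial>lborel)
      = - ((\<integral>x. u x * (of_real (\<theta>' x) * \<phi> x) \<partial>lborel) + (\<integral>x. v x * (of_real (\<theta> x) * \<phi> x) \<partial>lborel))"
    by (simp add: algebra_simps eq_neg_iff_add_eq_0)
  also have "\<dots> = - (\<integral>x. u x * (of_real (\<theta>' x) * \<phi> x) + v x * (of_real (\<theta> x) * \<phi> x) \<partial>lborel)"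
    using i2 i3 by simp
  finally show "(\<integral>x. of_real (\<theta> x) * u x * \<phi>' x \<partial>lborel)
      = - (\<integral>x. (of_real (\<theta>' x) * u x + of_real (\<theta> x) * v x) * \<phi> x \<partial>lborel)"
    by (simp add: algebra_simps)
qed

section \<open>The continuous representative\<close>

text \<open>The intervals on which the Sobolev spaces are considered; the boundary is a null set, so that
  test functions with support in the interior see all of the interval.\<close>

definition interval_domain :: "real set \<Rightarrow> bool" where
  "interval_domain S \<longleftrightarrow> is_interval S \<and> (AE x in lborel. x \<in> S \<longrightarrow> x \<in> interior S)"

lemma interval_domain_UNIV [simp]: "interval_domain UNIV"
  unfolding interval_domain_def by simp

lemma interval_domain_Icc [simp]: "interval_domain {a..b}"
  unfolding interval_domain_def
proof
  show "AE x in lborel. x \<in> {a..b} \<longrightarrow> x \<in> interior {a..b}"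
    using AE_lborel_singleton[of a] AE_lborel_singleton[of b]
    by eventually_elim (auto simp: interior_atLeastAtMost_real)
qed (simp add: is_interval_cc)

lemma indicator_L2:
  assumes "A \<in> sets borel" "bounded A" shows "(\<lambda>x. indicator A x) \<in> L2 UNIV"
proof (rule L2_I)
  have "(\<lambda>x. (cmod (indicator A x))\<^sup>2) = indicator A"
    by (auto simp: fun_eq_iff split: split_indicator)
  then show "integrable lborel (\<lambda>x. (cmod (indicator A x))\<^sup>2)"
    using assms emeasure_bounded_finite[OF assms(2)] by (simp add: less_top)
qed (use assms in auto)

text \<open>Two weak derivatives have the same integral against every test function, so the fundamental lemma
  applies on every compact interval in the interior.\<close>

lemma is_weak_deriv_unique:
  assumes S: "interval_domain S" and wd: "is_weak_deriv S u v1" "is_weak_deriv S u v2"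
    and L: "v1 \<in> L2 S" "v2 \<in> L2 S"
  shows "AE x in lborel. v1 x = v2 x"
proof -
  have "AE x in lborel. x \<in> interior S \<longrightarrow> v1 x - v2 x = 0"
  proof (rule AE_on_open)
    fix c d :: real assume cd: "c < d" "{c..d} \<subseteq> interior S"
    have ind: "(\<lambda>x. indicator {c..d} x) \<in> L2 UNIV" by (rule indicator_L2) auto
    show "AE x in lborel. x \<in> {c..d} \<longrightarrow> v1 x - v2 x = 0"
    proof (rule AE_zero_if_orthogonal_C1c)
      show "integrable lborel (\<lambda>x. indicator {c..d} x * (v1 x - v2 x))"
        by (rule L2_prod_integrable[OF ind L2_diff[OF L]])
      fix \<phi> assume "\<phi> \<in> C1c {c..d}"
      then obtain \<phi>' K where \<phi>: "\<And>x. (\<phi> has_vector_derivative \<phi>' x) (at x)" "continuous_on UNIV \<phi>'"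
    "continuous_on UNIV \<phi>" "compact K" "K \<subseteq> {c..d}" "\<And>x. x \<notin> K \<Longrightarrow> \<phi> x = 0" "\<And>x. x \<notin> K \<Longrightarrow> \<phi>' x = 0"
    "(\<lambda>x. vector_derivative \<phi> (at x)) = \<phi>'" by (rule C1c_E) (rule that)
      have K: "K \<subseteq> interior S" using \<phi>(5) cd by blast
      have \<phi>L: "\<phi> \<in> L2 UNIV" by (rule continuous_compact_support_L2[OF \<phi>(3,4) subset_UNIV \<phi>(6)])
      have "(\<integral>x. v1 x * \<phi> x \<partial>lborel) = (\<integral>x. v2 x * \<phi> x \<partial>lborel)"
        using is_weak_deriv_D[OF wd(1) \<phi>(1,2,4) K \<phi>(6)] is_weak_deriv_D[OF wd(2) \<phi>(1,2,4) K \<phi>(6)] by simp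
      then show "(\<integral>x. (v1 x - v2 x) * \<phi> x \<partial>lborel) = 0"
        using L2_prod_integrable[OF L(1) \<phi>L] L2_prod_integrable[OF L(2) \<phi>L] by (simp add: left_diff_distrib)
    qed
  qed simp
  moreover have "AE x in lborel. x \<in> S \<longrightarrow> x \<in> interior S" using S unfolding interval_domain_def by blast
  ultimately show ?thesis
  proof eventually_elim
    case (elim x)
    then show ?case using L2_zero_off[OF L(1), of x] L2_zero_off[OF L(2), of x] by (cases "x \<in> S") auto
  qed
qed

lemma L2_integrable_Ioc: "v \<in> L2 S \<Longrightarrow> integrable lborel (\<lambda>t. indicator {x<..y::real} t * v t)"
  by (rule L2_prod_integrable[OF indicator_L2]) (auto intro: bounded_subset[of "{x..y}"])

lemma l2_norm_indicator_Ioc: "x \<le> y \<Longrightarrow> l2_norm (\<lambda>t. indicator {x<..y::real} t) = sqrt (y - x)"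
proof -
  assume "x \<le> y"
  have "(\<lambda>t. (cmod (indicator {x<..y} t))\<^sup>2) = indicator {x<..y}"
    by (auto simp: fun_eq_iff split: split_indicator)
  then show ?thesis using \<open>x \<le> y\<close> unfolding l2_norm_def by simp
qed

lemma norm_integral_Ioc_le:
  assumes "v \<in> L2 S" "x \<le> y"
  shows "cmod (\<integral>t. indicator {x<..y::real} t * v t \<partial>lborel) \<le> sqrt (y - x) * l2_norm v"
  using norm_integral_prod_le[OF indicator_L2[of "{x<..y}"] assms(1)] l2_norm_indicator_Ioc[OF assms(2)]
  by (auto intro: bounded_subset[of "{x..y}"])

text \<open>An $L^2$ function need not be integrable on half lines, hence the signed integral from a base point.\<close>

definition primitive :: "(real \<Rightarrow> complex) \<Rightarrow> real \<Rightarrow> complex" where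
  "primitive v x = (\<integral>t. indicator {0<..x} t * v t \<partial>lborel) - (\<integral>t. indicator {x<..0} t * v t \<partial>lborel)"

lemma primitive_diff:
  assumes "v \<in> L2 S" "x \<le> y"
  shows "primitive v y - primitive v x = (\<integral>t. indicator {x<..y} t * v t \<partial>lborel)"
proof -
  note i = L2_integrable_Ioc[OF assms(1)]
  have "primitive v y - primitive v x = (\<integral>t. (indicator {0<..y} t * v t - indicator {y<..0} t * v t)
      - (indicator {0<..x} t * v t - indicator {x<..0} t * v t) \<partial>lborel)"
    unfolding primitive_def using i by simp
  also have "\<dots> = (\<integral>t. indicator {x<..y} t * v t \<partial>lborel)"
    using assms(2) by (intro Bochner_Integration.integral_cong) (auto split: split_indicator)
  finally show ?thesis .
qed

lemma primitive_diff_le: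
  assumes "v \<in> L2 S"
  shows "cmod (primitive v y - primitive v x) \<le> sqrt \<bar>y - x\<bar> * l2_norm v"
proof (cases "x \<le> y")
  case True
  then show ?thesis using primitive_diff[OF assms True] norm_integral_Ioc_le[OF assms True] by simp
next
  case False
  then have "y \<le> x" by simp
  then show ?thesis using primitive_diff[OF assms \<open>y \<le> x\<close>] norm_integral_Ioc_le[OF assms \<open>y \<le> x\<close>]
    by (simp add: norm_minus_commute)
qed

lemma primitive_continuous:
  assumes "v \<in> L2 S" shows "continuous_on UNIV (primitive v)"
proof -
  have "isCont (primitive v) x" for x
    unfolding isCont_def
  proof (rule LIM_zero_cancel, rule Lim_null_comparison)
    show "\<forall>\<^sub>F y in at x. norm (primitive v y - primitive v x) \<le> sqrt \<bar>y - x\<bar> * l2_norm v"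
      using primitive_diff_le[OF assms] by simp
    have "((\<lambda>y. sqrt \<bar>y - x\<bar> * l2_norm v) \<longlongrightarrow> sqrt \<bar>x - x\<bar> * l2_norm v) (at x)"
      by (intro tendsto_intros)
    then show "((\<lambda>y. sqrt \<bar>y - x\<bar> * l2_norm v) \<longlongrightarrow> 0) (at x)" by simp
  qed
  then show ?thesis by (simp add: continuous_on_eq_continuous_at)
qed

lemma integrable_continuous_restrict:
  fixes f g :: "real \<Rightarrow> complex"
  assumes "continuous_on UNIV f" "continuous_on UNIV g" "compact K" "\<And>x. x \<notin> K \<Longrightarrow> g x = 0"
  shows "integrable lborel (\<lambda>x. f x * g x)"
  by (rule continuous_compact_support_integrable[of _ K]) (use assms in \<open>auto intro!: continuous_intros\<close>)

text \<open>Integration by parts for the indefinite integral, by Fubini's theorem.\<close>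

lemma primitive_by_parts:
  assumes v: "v \<in> L2 S" and \<phi>: "\<And>x. (\<phi> has_vector_derivative \<psi> x) (at x)" "continuous_on UNIV \<psi>"
    and "c \<le> d" and off: "\<And>x. x \<notin> {c..d} \<Longrightarrow> \<psi> x = 0" "\<And>x. x \<notin> {c<..<d} \<Longrightarrow> \<phi> x = 0"
  shows "(\<integral>x. primitive v x * \<psi> x \<partial>lborel) = - (\<integral>x. v x * \<phi> x \<partial>lborel)"
proof -
  let ?w = "\<lambda>t. indicator {c<..d} t * v t"
  note [measurable] = L2_measurable[OF v] borel_measurable_continuous[OF \<phi>(2)]
  have FTC: "(\<integral>x. indicator {s..t} x *\<^sub>R \<psi> x \<partial>lborel) = \<phi> t - \<phi> s" if "s \<le> t" for s t
    using \<phi> that by (subst integral_FTC_Icc[of s t \<phi>])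
      (auto intro: has_vector_derivative_at_within continuous_on_subset)
  have mean: "(\<integral>x. \<psi> x \<partial>lborel) = 0"
    by (rule integral_deriv_compact_support[of \<phi> \<psi> "{c..d}"]) (use \<phi> off in auto)
  have i\<psi>: "integrable lborel \<psi>"
    by (rule continuous_compact_support_integrable[OF \<phi>(2) compact_Icc]) (use off in auto)
  have iw: "integrable lborel ?w" by (rule L2_integrable_Ioc[OF v])
  let ?F = "\<lambda>x t. \<psi> x * (indicator {..x} t * ?w t)"
  have iF: "integrable (lborel \<Otimes>\<^sub>M lborel) (case_prod ?F)"
  proof (rule lborel_pair.Fubini_integrable)
    have m: "(\<lambda>(x, t). ?F x t) = (\<lambda>(x, t). \<psi> x * ((if t \<le> x then 1 else 0) * ?w t))"
      by (auto simp: fun_eq_iff split: split_indicator)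
    show "case_prod ?F \<in> borel_measurable (lborel \<Otimes>\<^sub>M lborel)" unfolding m by measurable
    have ia: "integrable lborel (\<lambda>t. indicator {..x} t * ?w t)" for x
      by (rule Bochner_Integration.integrable_bound[OF iw]) (auto split: split_indicator)
    then show "AE x in lborel. integrable lborel (\<lambda>t. case_prod ?F (x, t))" by auto
    show "integrable lborel (\<lambda>x. \<integral>t. norm (case_prod ?F (x, t)) \<partial>lborel)"
    proof (rule Bochner_Integration.integrable_bound)
      show "integrable lborel (\<lambda>x. norm (\<psi> x) * (\<integral>t. norm (?w t) \<partial>lborel))" using i\<psi> by simp
      have "(\<lambda>x. \<integral>t. norm (\<psi> x * ((if t \<le> x then 1 else 0) * ?w t)) \<partial>lborel) \<in> borel_measurable lborel"
        by measurable
      moreover have "(\<lambda>x. \<integral>t. norm (\<psi> x * ((if t \<le> x then 1 else 0) * ?w t)) \<partial>lborel)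
          = (\<lambda>x. \<integral>t. norm (case_prod ?F (x, t)) \<partial>lborel)"
        by (intro ext Bochner_Integration.integral_cong) (auto split: split_indicator)
      ultimately show "(\<lambda>x. \<integral>t. norm (case_prod ?F (x, t)) \<partial>lborel) \<in> borel_measurable lborel" by simp
      have "(\<integral>t. norm (?F x t) \<partial>lborel) \<le> norm (\<psi> x) * (\<integral>t. norm (?w t) \<partial>lborel)" for x
      proof -
        have "(\<integral>t. norm (indicator {..x} t * ?w t) \<partial>lborel) \<le> (\<integral>t. norm (?w t) \<partial>lborel)"
          by (rule integral_mono[OF integrable_norm[OF ia] integrable_norm[OF iw]])
            (auto split: split_indicator)
        then have "norm (\<psi> x) * (\<integral>t. norm (indicator {..x} t * ?w t) \<partial>lborel) \<le> norm (\<psi> x) * (\<integral>t. norm (?w t) \<partial>lborel)"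
          by (rule mult_left_mono) simp
        moreover have "(\<integral>t. norm (?F x t) \<partial>lborel) = norm (\<psi> x) * (\<integral>t. norm (indicator {..x} t * ?w t) \<partial>lborel)"
          by (simp add: norm_mult[of "\<psi> x"] del: norm_mult)
        ultimately show ?thesis by simp
      qed
      then show "AE x in lborel. norm (\<integral>t. norm (case_prod ?F (x, t)) \<partial>lborel)
          \<le> norm (norm (\<psi> x) * (\<integral>t. norm (?w t) \<partial>lborel))" by (auto intro!: AE_I2)
    qed
  qed
  have "(\<integral>x. primitive v x * \<psi> x \<partial>lborel) = (\<integral>x. (primitive v x * \<psi> x - primitive v c * \<psi> x) \<partial>lborel)"
    using i\<psi> mean integrable_continuous_restrict[OF primitive_continuous[OF v] \<phi>(2) compact_Icc[of c d] off(1)]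
    by simp
  also have "\<dots> = (\<integral>x. (\<integral>t. ?F x t \<partial>lborel) \<partial>lborel)"
  proof (rule Bochner_Integration.integral_cong[OF refl])
    fix x
    show "primitive v x * \<psi> x - primitive v c * \<psi> x = (\<integral>t. ?F x t \<partial>lborel)"
    proof (cases "x \<in> {c..d}")
      case True
      have "primitive v x - primitive v c = (\<integral>t. indicator {c<..x} t * v t \<partial>lborel)"
        using primitive_diff[OF v, of c x] True by simp
      also have "\<dots> = (\<integral>t. indicator {..x} t * ?w t \<partial>lborel)"
        using True by (intro Bochner_Integration.integral_cong) (auto split: split_indicator)
      finally have "(primitive v x - primitive v c) * \<psi> x = (\<integral>t. ?F x t \<partial>lborel)" by simp
      then show ?thesis by (simp add: left_diff_distrib)
    qed (simp add: off)
  qed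
  also have "\<dots> = (\<integral>t. (\<integral>x. ?F x t \<partial>lborel) \<partial>lborel)"
    by (rule lborel_pair.Fubini_integral[OF iF, symmetric])
  also have "\<dots> = (\<integral>t. - (v t * \<phi> t) \<partial>lborel)"
  proof (rule Bochner_Integration.integral_cong[OF refl])
    fix t
    show "(\<integral>x. ?F x t \<partial>lborel) = - (v t * \<phi> t)"
    proof (cases "t \<in> {c<..d}")
      case True
      have "(\<integral>x. ?F x t \<partial>lborel) = (\<integral>x. v t * (indicator {t..d} x *\<^sub>R \<psi> x) \<partial>lborel)"
        using True off by (intro Bochner_Integration.integral_cong) (auto split: split_indicator)
      also have "\<dots> = v t * (\<integral>x. indicator {t..d} x *\<^sub>R \<psi> x \<partial>lborel)" by (rule integral_mult_right_zero)
      also have "\<dots> = v t * (\<phi> d - \<phi> t)" using FTC[of t d] True by simp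
      also have "\<phi> d = 0" using off(2)[of d] by simp
      finally show ?thesis by simp
    next
      case False
      then have "\<phi> t = 0" using off(2)[of t] by auto
      then show ?thesis using False by simp
    qed
  qed
  finally show ?thesis by simp
qed

text \<open>Du Bois-Reymond: a function and the indefinite integral of its weak derivative pair equally with
  every continuous function of mean zero, hence differ by a constant.\<close>

lemma weak_deriv_representative:
  assumes S: "interval_domain S" and u: "u \<in> L2 S" and v: "v \<in> L2 S" and wd: "is_weak_deriv S u v"
  obtains k where "AE x in lborel. x \<in> S \<longrightarrow> u x = primitive v x + k"
proof (cases "interior S = {}")
  case True
  then have "AE x in lborel. x \<in> S \<longrightarrow> u x = primitive v x + 0"
    using S unfolding interval_domain_def by auto
  then show thesis by (rule that)
next
  case False
  then obtain c0 d0 where cd0: "c0 < d0" "{c0..d0} \<subseteq> interior S"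
  proof -
    obtain z e where "e > 0" "cball z e \<subseteq> interior S"
      using False open_interior open_contains_cball[of "interior S"] by blast
    then show thesis by (intro that[of z "z + e"]) (auto simp: dist_real_def)
  qed
  have conv: "is_interval (interior S)"
    using S unfolding interval_domain_def by (metis convex_interior is_interval_convex_1)
  define U where "U = primitive v"
  have U: "continuous_on UNIV U" unfolding U_def by (rule primitive_continuous[OF v])
  note Um [measurable] = borel_measurable_continuous[OF U]
  note um [measurable] = L2_measurable[OF u]
  let ?b = "\<lambda>x. complex_of_real (bump c0 d0 x)"
  define \<beta> where "\<beta> = (\<integral>x. bump c0 d0 x \<partial>lborel)"
  have \<beta>: "\<beta> > 0" unfolding \<beta>_def by (rule bump_integral_pos[OF cd0(1)])
  define k where "k = (\<integral>x. (u x - U x) * ?b x \<partial>lborel) / of_real \<beta>"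
  have iu: "integrable lborel (\<lambda>x. (u x - U x) * g x)"
    if "continuous_on UNIV g" "\<And>x. x \<notin> {c..d} \<Longrightarrow> g x = 0" for c d g
  proof -
    have "g \<in> L2 UNIV" by (rule continuous_compact_support_L2[OF that(1) compact_Icc[of c d] subset_UNIV that(2)])
    then have "integrable lborel (\<lambda>x. u x * g x)" by (rule L2_prod_integrable[OF u])
    moreover have "integrable lborel (\<lambda>x. U x * g x)"
      by (rule integrable_continuous_restrict[OF U that(1) compact_Icc[of c d] that(2)])
    ultimately show ?thesis by (simp add: left_diff_distrib)
  qed
  have b0: "?b x = 0" if "x \<notin> {c0..d0}" for x using that bump_zero[of x c0 d0] by auto
  have mean0: "(\<integral>x. (u x - U x) * \<psi> x \<partial>lborel) = 0"
    if \<psi>: "continuous_on UNIV \<psi>" "c \<le> d" "{c..d} \<subseteq> interior S" "\<And>x. x \<notin> {c..d} \<Longrightarrow> \<psi> x = 0"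
      "(\<integral>x. \<psi> x \<partial>lborel) = 0" for \<psi> c d
  proof -
    obtain \<phi> where \<phi>: "\<And>x. (\<phi> has_vector_derivative \<psi> x) (at x)" "\<And>x. x \<notin> {c<..<d} \<Longrightarrow> \<phi> x = 0"
      using continuous_zero_mean_antiderivative[OF \<psi>(1,2,4,5)] by blast
    have "(\<integral>x. u x * \<psi> x \<partial>lborel) = - (\<integral>x. v x * \<phi> x \<partial>lborel)"
      by (rule is_weak_deriv_D[OF wd \<phi>(1) \<psi>(1) compact_Icc \<psi>(3)]) (use \<phi>(2) in auto)
    moreover have "(\<integral>x. U x * \<psi> x \<partial>lborel) = - (\<integral>x. v x * \<phi> x \<partial>lborel)"
      unfolding U_def by (rule primitive_by_parts[OF v \<phi>(1) \<psi>(1,2,4) \<phi>(2)])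
    moreover have "\<psi> \<in> L2 UNIV" by (rule continuous_compact_support_L2[OF \<psi>(1) compact_Icc subset_UNIV \<psi>(4)])
    moreover have "integrable lborel (\<lambda>x. U x * \<psi> x)"
      by (rule integrable_continuous_restrict[OF U \<psi>(1) compact_Icc \<psi>(4)])
    ultimately show ?thesis using L2_prod_integrable[OF u] by (simp add: left_diff_distrib)
  qed
  have "AE x in lborel. x \<in> interior S \<longrightarrow> u x - U x - k = 0"
  proof (rule AE_on_open)
    fix c d :: real assume cd: "c < d" "{c..d} \<subseteq> interior S"
    \<comment> \<open>An interval that contains the supports of the test function and of the fixed bump.\<close>
    define p q where "p = min c c0" and "q = max d d0"
    have pq: "p \<le> q" "{p..q} \<subseteq> interior S"
    proof -
      show "p \<le> q" using cd cd0 unfolding p_def q_def by auto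
      have "c \<in> interior S" "d \<in> interior S" "c0 \<in> interior S" "d0 \<in> interior S"
        using cd cd0 by (auto intro: subsetD[OF cd(2)] subsetD[OF cd0(2)])
      then have "p \<in> interior S" "q \<in> interior S" unfolding p_def q_def by (simp_all add: min_def max_def)
      then show "{p..q} \<subseteq> interior S" using conv unfolding is_interval_1 by (meson atLeastAtMost_iff subsetI)
    qed
    show "AE x in lborel. x \<in> {c..d} \<longrightarrow> u x - U x - k = 0"
    proof (rule AE_zero_if_orthogonal_C1c)
      have "integrable lborel (\<lambda>x. indicator {c..d} x * u x)"
        by (rule L2_prod_integrable[OF indicator_L2 u]) auto
      moreover have "integrable lborel (\<lambda>x. indicator {c..d} x *\<^sub>R (U x + k))"
        by (rule borel_integrable_compact) (auto intro!: continuous_intros continuous_on_subset[OF U])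
      ultimately have "integrable lborel (\<lambda>x. indicator {c..d} x * u x - indicator {c..d} x *\<^sub>R (U x + k))"
        by (rule Bochner_Integration.integrable_diff)
      also have "(\<lambda>x. indicator {c..d} x * u x - indicator {c..d} x *\<^sub>R (U x + k))
          = (\<lambda>x. indicator {c..d} x * (u x - U x - k))"
        by (auto simp: fun_eq_iff algebra_simps split: split_indicator)
      finally show "integrable lborel (\<lambda>x. indicator {c..d} x * (u x - U x - k))" .
      fix \<phi> assume "\<phi> \<in> C1c {c..d}"
      then obtain \<phi>' K where \<phi>': "\<And>x. (\<phi> has_vector_derivative \<phi>' x) (at x)" "continuous_on UNIV \<phi>'"
    "continuous_on UNIV \<phi>" "compact K" "K \<subseteq> {c..d}" "\<And>x. x \<notin> K \<Longrightarrow> \<phi> x = 0" "\<And>x. x \<notin> K \<Longrightarrow> \<phi>' x = 0"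
    "(\<lambda>x. vector_derivative \<phi> (at x)) = \<phi>'" by (rule C1c_E) (rule that)
      note \<phi> = \<phi>'(3,5,6)
      have off: "\<phi> x = 0" if "x \<notin> {c..d}" for x using \<phi> that by blast
      \<comment> \<open>Subtracting a multiple of the fixed bump makes the mean zero; this is where \<open>k\<close> comes from.\<close>
      define \<gamma> where "\<gamma> = (\<integral>x. \<phi> x \<partial>lborel)"
      define \<psi> where "\<psi> x = \<phi> x - \<gamma> / of_real \<beta> * ?b x" for x
      have ib: "integrable lborel ?b"
        by (rule continuous_compact_support_integrable[OF bump_cont_cplx compact_Icc[of c0 d0] b0])
      have i\<phi>: "integrable lborel \<phi>"
        by (rule continuous_compact_support_integrable[OF \<phi>(1) compact_Icc[of c d] off])
      have "(\<integral>x. (u x - U x) * \<psi> x \<partial>lborel) = 0"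
      proof (rule mean0[OF _ pq])
        show "continuous_on UNIV \<psi>" unfolding \<psi>_def by (intro continuous_intros \<phi>(1) bump_cont_cplx bump_continuous)
        show "\<psi> x = 0" if "x \<notin> {p..q}" for x
        proof -
          have "x \<notin> {c..d}" "x \<notin> {c0..d0}" using that unfolding p_def q_def by auto
          then show ?thesis using off b0 unfolding \<psi>_def by simp
        qed
        show "(\<integral>x. \<psi> x \<partial>lborel) = 0"
          unfolding \<psi>_def using ib i\<phi> \<beta> by (simp add: \<gamma>_def[symmetric] \<beta>_def[symmetric])
      qed
      moreover have "(u x - U x) * \<psi> x = (u x - U x) * \<phi> x - \<gamma> / of_real \<beta> * ((u x - U x) * ?b x)" for x
        unfolding \<psi>_def by (simp add: algebra_simps diff_divide_distrib)
      moreover have iub: "integrable lborel (\<lambda>x. (u x - U x) * ?b x)"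
        by (rule iu[OF bump_cont_cplx b0])
      moreover have iup: "integrable lborel (\<lambda>x. (u x - U x) * \<phi> x)"
        by (rule iu[OF \<phi>(1) off])
      ultimately have "(\<integral>x. (u x - U x) * \<phi> x \<partial>lborel) = \<gamma> / of_real \<beta> * (\<integral>x. (u x - U x) * ?b x \<partial>lborel)" by simp
      also have "\<dots> = k * \<gamma>" unfolding k_def by simp
      also have "\<dots> = (\<integral>x. k * \<phi> x \<partial>lborel)" unfolding \<gamma>_def by simp
      finally show "(\<integral>x. (u x - U x - k) * \<phi> x \<partial>lborel) = 0"
        using iup i\<phi> by (simp add: left_diff_distrib[of "_ - _"])
    qed
  qed simp
  moreover have "AE x in lborel. x \<in> S \<longrightarrow> x \<in> interior S" using S unfolding interval_domain_def by blast
  ultimately have "AE x in lborel. x \<in> S \<longrightarrow> u x = primitive v x + k"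
    by eventually_elim (auto simp: U_def algebra_simps)
  then show thesis by (rule that)
qed


section \<open>The space $H^1$\<close>

lemma H1_I: "u \<in> L2 S \<Longrightarrow> v \<in> L2 S \<Longrightarrow> is_weak_deriv S u v \<Longrightarrow> u \<in> H1 S"
  unfolding H1_def by blast

lemma H1_L2: "u \<in> H1 S \<Longrightarrow> u \<in> L2 S"
  unfolding H1_def by blast

lemma weak_deriv_spec:
  assumes "u \<in> H1 S"
  shows weak_deriv_L2: "weak_deriv S u \<in> L2 S" and weak_deriv_is: "is_weak_deriv S u (weak_deriv S u)"
proof -
  have "\<exists>v. v \<in> L2 S \<and> is_weak_deriv S u v" using assms unfolding H1_def by blast
  from someI_ex[OF this] show "weak_deriv S u \<in> L2 S" "is_weak_deriv S u (weak_deriv S u)"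
    unfolding weak_deriv_def by auto
qed

lemma weak_deriv_AE_eq:
  assumes "interval_domain S" "u \<in> L2 S" "v \<in> L2 S" "is_weak_deriv S u v"
  shows "AE x in lborel. weak_deriv S u x = v x"
  by (rule is_weak_deriv_unique[OF assms(1) weak_deriv_is assms(4) weak_deriv_L2 assms(3)])
    (rule H1_I[OF assms(2-4)])+

lemma H1_comb:
  assumes "u \<in> H1 S" "w \<in> H1 S" shows "(\<lambda>x. u x + c * w x) \<in> H1 S"
proof (rule H1_I)
  show "(\<lambda>x. u x + c * w x) \<in> L2 S" "(\<lambda>x. weak_deriv S u x + c * weak_deriv S w x) \<in> L2 S"
    by (rule L2_add[OF H1_L2[OF assms(1)] L2_cmult[OF H1_L2[OF assms(2)]]]
        L2_add[OF weak_deriv_L2[OF assms(1)] L2_cmult[OF weak_deriv_L2[OF assms(2)]]])+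
  show "is_weak_deriv S (\<lambda>x. u x + c * w x) (\<lambda>x. weak_deriv S u x + c * weak_deriv S w x)"
    by (rule is_weak_deriv_comb[OF weak_deriv_is[OF assms(1)] weak_deriv_is[OF assms(2)]
          H1_L2[OF assms(1)] weak_deriv_L2[OF assms(1)] H1_L2[OF assms(2)] weak_deriv_L2[OF assms(2)]])
qed

lemma H1_diff: "u \<in> H1 S \<Longrightarrow> w \<in> H1 S \<Longrightarrow> (\<lambda>x. u x - w x) \<in> H1 S"
  using H1_comb[of u S w "-1"] by simp

lemma weak_deriv_comb_AE:
  assumes "interval_domain S" "u \<in> H1 S" "w \<in> H1 S"
  shows "AE x in lborel. weak_deriv S (\<lambda>x. u x + c * w x) x = weak_deriv S u x + c * weak_deriv S w x"
  by (rule weak_deriv_AE_eq[OF assms(1) H1_L2[OF H1_comb[OF assms(2,3)]]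
        L2_add[OF weak_deriv_L2[OF assms(2)] L2_cmult[OF weak_deriv_L2[OF assms(3)]]]
        is_weak_deriv_comb[OF weak_deriv_is[OF assms(2)] weak_deriv_is[OF assms(3)]
          H1_L2[OF assms(2)] weak_deriv_L2[OF assms(2)] H1_L2[OF assms(3)] weak_deriv_L2[OF assms(3)]]])

lemma weak_deriv_diff_AE:
  assumes "interval_domain S" "u \<in> H1 S" "w \<in> H1 S"
  shows "AE x in lborel. weak_deriv S (\<lambda>x. u x - w x) x = weak_deriv S u x - weak_deriv S w x"
  using weak_deriv_comb_AE[OF assms, of "-1"] by simp

lemma C1c_H1:
  assumes "\<phi> \<in> C1c (interior S)" shows "\<phi> \<in> H1 S"
proof -
  obtain \<phi>' K where \<phi>: "\<And>x. (\<phi> has_vector_derivative \<phi>' x) (at x)" "continuous_on UNIV \<phi>'"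
    "continuous_on UNIV \<phi>" "compact K" "K \<subseteq> interior S" "\<And>x. x \<notin> K \<Longrightarrow> \<phi> x = 0" "\<And>x. x \<notin> K \<Longrightarrow> \<phi>' x = 0"
    "(\<lambda>x. vector_derivative \<phi> (at x)) = \<phi>'" using assms by (rule C1c_E) (rule that)
  have K: "K \<subseteq> S" using \<phi>(5) interior_subset by blast
  show ?thesis
    by (rule H1_I[OF continuous_compact_support_L2[OF \<phi>(3,4) K \<phi>(6)]
          continuous_compact_support_L2[OF \<phi>(2,4) K \<phi>(7)] is_weak_deriv_classical[OF \<phi>(1,2)]])
qed

lemma l2_inner_comb_left:
  assumes "u \<in> L2 S" "w \<in> L2 T" "z \<in> L2 R"
  shows "l2_inner (\<lambda>x. u x + c * w x) z = l2_inner u z + c * l2_inner w z"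
proof -
  have "l2_inner (\<lambda>x. u x + c * w x) z = (\<integral>x. u x * cnj (z x) + c * (w x * cnj (z x)) \<partial>lborel)"
    unfolding l2_inner_def by (simp add: algebra_simps)
  then show ?thesis
    using L2_inner_integrable[OF assms(1,3)] L2_inner_integrable[OF assms(2,3)] by (simp add: l2_inner_def)
qed

lemma l2_inner_commute: "l2_inner g f = cnj (l2_inner f g)"
proof -
  have "cnj (l2_inner f g) = (\<integral>x. cnj (f x * cnj (g x)) \<partial>lborel)"
    unfolding l2_inner_def by (rule Bochner_Integration.integral_cnj[symmetric])
  then show ?thesis unfolding l2_inner_def by (simp add: mult.commute)
qed

lemma l2_inner_self: "l2_inner f f = of_real ((l2_norm f)\<^sup>2)"
  unfolding l2_inner_def l2_norm_sq integral_complex_of_real[symmetric]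
  by (simp only: complex_norm_square)

lemma l2_inner_cong_AE:
  assumes "f \<in> borel_measurable borel" "f' \<in> borel_measurable borel" "g \<in> L2 S"
    "AE x in lborel. f x = f' x"
  shows "l2_inner f g = l2_inner f' g"
  unfolding l2_inner_def
proof (rule integral_cong_AE)
  note [measurable] = assms(1,2) L2_measurable[OF L2_cnj[OF assms(3)]]
  show "(\<lambda>x. f x * cnj (g x)) \<in> borel_measurable lborel" by measurable
  show "(\<lambda>x. f' x * cnj (g x)) \<in> borel_measurable lborel" by measurable
qed (use assms(4) in \<open>auto\<close>)

section \<open>Schroedinger forms and the representation theorem\<close>

locale schroedinger =
  fixes S :: "real set" and V :: "real \<Rightarrow> real"
  assumes dom: "interval_domain S"
    and V_meas [measurable]: "V \<in> borel_measurable borel"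
    and V_nonneg: "\<And>x. 0 \<le> V x"
begin

definition form_dom :: "(real \<Rightarrow> complex) set" where
  "form_dom = {u \<in> H1 S. integrable lborel (\<lambda>x. V x * (cmod (u x))\<^sup>2)}"

text \<open>The potential part of the form is the $L^2$ inner product of the functions \<open>root_mult u\<close> and \<open>root_mult w\<close>,
  so that facts about $L^2$ apply to it.\<close>

definition root_mult :: "(real \<Rightarrow> complex) \<Rightarrow> real \<Rightarrow> complex" where
  "root_mult u x = of_real (sqrt (V x)) * u x"

definition energy :: "(real \<Rightarrow> complex) \<Rightarrow> real" where
  "energy u = (l2_norm (weak_deriv S u))\<^sup>2 + (l2_norm (root_mult u))\<^sup>2"

lemma form_dom_H1: "u \<in> form_dom \<Longrightarrow> u \<in> H1 S"
  unfolding form_dom_def by simp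

lemma form_dom_L2: "u \<in> form_dom \<Longrightarrow> u \<in> L2 S"
  by (rule H1_L2[OF form_dom_H1])

lemma norm_root_mult_sq: "(cmod (root_mult u x))\<^sup>2 = V x * (cmod (u x))\<^sup>2"
  unfolding root_mult_def using V_nonneg by (simp add: norm_mult power_mult_distrib)

lemma form_dom_I: "u \<in> H1 S \<Longrightarrow> root_mult u \<in> L2 S \<Longrightarrow> u \<in> form_dom"
  unfolding form_dom_def using L2_sq_integrable[of "root_mult u" S] by (simp add: norm_root_mult_sq)

lemma root_mult_L2:
  assumes "u \<in> form_dom" shows "root_mult u \<in> L2 S"
proof (rule L2_I)
  note [measurable] = L2_measurable[OF form_dom_L2[OF assms]]
  show "root_mult u \<in> borel_measurable borel" unfolding root_mult_def[abs_def] by measurable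
  show "integrable lborel (\<lambda>x. (cmod (root_mult u x))\<^sup>2)"
    using assms unfolding norm_root_mult_sq form_dom_def by simp
qed (use form_dom_L2[OF assms] in \<open>simp add: root_mult_def L2_zero_off\<close>)

lemma root_mult_comb: "root_mult (\<lambda>x. u x + c * w x) = (\<lambda>x. root_mult u x + c * root_mult w x)"
  unfolding root_mult_def by (simp add: algebra_simps)

lemma root_mult_diff: "root_mult (\<lambda>x. u x - w x) = (\<lambda>x. root_mult u x - root_mult w x)"
  unfolding root_mult_def by (simp add: algebra_simps)

lemma form_dom_comb:
  assumes "u \<in> form_dom" "w \<in> form_dom" shows "(\<lambda>x. u x + c * w x) \<in> form_dom"
proof (rule form_dom_I)
  show "(\<lambda>x. u x + c * w x) \<in> H1 S" by (rule H1_comb[OF form_dom_H1[OF assms(1)] form_dom_H1[OF assms(2)]])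
  show "root_mult (\<lambda>x. u x + c * w x) \<in> L2 S"
    unfolding root_mult_comb by (rule L2_add[OF root_mult_L2[OF assms(1)] L2_cmult[OF root_mult_L2[OF assms(2)]]])
qed

lemma schroed_form_eq:
  assumes "u \<in> form_dom" "w \<in> form_dom"
  shows "schroed_form S V u w
    = l2_inner (weak_deriv S u) (weak_deriv S w) + l2_inner (root_mult u) (root_mult w)"
proof -
  have "complex_of_real (V x) = of_real (sqrt (V x)) * of_real (sqrt (V x))" for x
    using V_nonneg[of x] by (simp flip: of_real_mult)
  then have *: "of_real (V x) * u x * cnj (w x) = root_mult u x * cnj (root_mult w x)" for x
    unfolding root_mult_def by (simp add: mult_ac)
  show ?thesis
    using L2_inner_integrable[OF weak_deriv_L2[OF form_dom_H1[OF assms(1)]] weak_deriv_L2[OF form_dom_H1[OF assms(2)]]]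
      L2_inner_integrable[OF root_mult_L2[OF assms(1)] root_mult_L2[OF assms(2)]]
    unfolding schroed_form_def * l2_inner_def by simp
qed

lemma schroed_form_comb:
  assumes "u \<in> form_dom" "w \<in> form_dom" "z \<in> form_dom"
  shows "schroed_form S V (\<lambda>x. u x + c * w x) z = schroed_form S V u z + c * schroed_form S V w z"
proof -
  note H = assms[THEN form_dom_H1]
  have "l2_inner (weak_deriv S (\<lambda>x. u x + c * w x)) (weak_deriv S z)
      = l2_inner (\<lambda>x. weak_deriv S u x + c * weak_deriv S w x) (weak_deriv S z)"
    by (rule l2_inner_cong_AE[OF _ _ weak_deriv_L2[OF H(3)] weak_deriv_comb_AE[OF dom H(1,2)]])
      (intro L2_measurable[of _ S] weak_deriv_L2 H1_comb H L2_add L2_cmult)+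
  then show ?thesis
    using assms H unfolding schroed_form_eq[OF form_dom_comb[OF assms(1,2)] assms(3)]
      schroed_form_eq[OF assms(1,3)] schroed_form_eq[OF assms(2,3)] root_mult_comb
    by (simp add: l2_inner_comb_left[OF weak_deriv_L2 weak_deriv_L2 weak_deriv_L2]
        l2_inner_comb_left[OF root_mult_L2 root_mult_L2 root_mult_L2] algebra_simps)
qed

lemma schroed_form_commute:
  assumes "u \<in> form_dom" "w \<in> form_dom"
  shows "schroed_form S V w u = cnj (schroed_form S V u w)"
  unfolding schroed_form_eq[OF assms] schroed_form_eq[OF assms(2,1)]
  using l2_inner_commute[of "weak_deriv S w" "weak_deriv S u"]
    l2_inner_commute[of "root_mult w" "root_mult u"] by simp

lemma schroed_form_self:
  assumes "u \<in> form_dom" shows "schroed_form S V u u = of_real (energy u)"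
  unfolding schroed_form_eq[OF assms assms] l2_inner_self energy_def by simp

text \<open>The energy of a difference is a squared distance of weak derivatives and of functions \<open>root_mult u\<close>,
  which turns Cauchy sequences for the energy into Cauchy sequences in $L^2$.\<close>

lemma energy_diff:
  assumes "u \<in> form_dom" "w \<in> form_dom"
  shows "energy (\<lambda>x. u x - w x) = (l2_norm (\<lambda>x. weak_deriv S u x - weak_deriv S w x))\<^sup>2
    + (l2_norm (\<lambda>x. root_mult u x - root_mult w x))\<^sup>2"
proof -
  note H = assms[THEN form_dom_H1]
  have "l2_norm (weak_deriv S (\<lambda>x. u x - w x)) = l2_norm (\<lambda>x. weak_deriv S u x - weak_deriv S w x)"
    by (rule l2_norm_cong_AE[OF _ _ weak_deriv_diff_AE[OF dom H]])
      (intro L2_measurable[of _ S] weak_deriv_L2 H1_diff H L2_diff)+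
  then show ?thesis unfolding energy_def root_mult_diff by simp
qed

text \<open>Completeness of the form domain. A sequence that is Cauchy for the energy is Cauchy in $L^2$ by
  coercivity, and so are its weak derivatives and its products with $\sqrt V$; the three limits fit
  together since weak derivatives are stable under $L^2$ limits, and since $L^2$ convergence yields
  almost everywhere convergence of a subsequence.\<close>

lemma form_dom_complete:
  assumes s: "\<And>n::nat. s n \<in> form_dom"
    and cauchy: "\<And>e. e > 0 \<Longrightarrow> \<exists>N. \<forall>i\<ge>N. \<forall>j\<ge>N. energy (\<lambda>x. s i x - s j x) < e"
    and coercive: "\<And>i j. (l2_norm (\<lambda>x. s i x - s j x))\<^sup>2 \<le> C * energy (\<lambda>x. s i x - s j x)"
  obtains u where "u \<in> form_dom" "(\<lambda>n. energy (\<lambda>x. s n x - u x)) \<longlonglongrightarrow> 0"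
    "(\<lambda>n. h1_norm S (\<lambda>x. u x - s n x)) \<longlonglongrightarrow> 0"
proof -
  have H: "s n \<in> H1 S" for n by (rule form_dom_H1[OF s])
  have sub: "\<exists>N. \<forall>i\<ge>N. \<forall>j\<ge>N. l2_norm (F i j) < e"
    if FK: "\<And>i j. (l2_norm (F i j))\<^sup>2 \<le> K * energy (\<lambda>x. s i x - s j x)" and e: "e > 0" for F K e
  proof -
    define K' where "K' = max K 1"
    have K': "K' > 0" "K \<le> K'" unfolding K'_def by auto
    obtain N where N: "\<And>i j. i \<ge> N \<Longrightarrow> j \<ge> N \<Longrightarrow> energy (\<lambda>x. s i x - s j x) < e\<^sup>2 / K'"
      using cauchy[of "e\<^sup>2 / K'"] e K' by auto
    have "l2_norm (F i j) < e" if "i \<ge> N" "j \<ge> N" for i j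
    proof (rule power_less_imp_less_base[of _ 2])
      have "energy (\<lambda>x. s i x - s j x) \<ge> 0" unfolding energy_def by simp
      then have "(l2_norm (F i j))\<^sup>2 \<le> K' * energy (\<lambda>x. s i x - s j x)"
        using FK[of i j] K'
        by (meson mult_right_mono order_trans)
      also have "\<dots> < K' * (e\<^sup>2 / K')" using N[OF that] K' by (intro mult_strict_left_mono)
      finally show "(l2_norm (F i j))\<^sup>2 < e\<^sup>2" using K' by simp
    qed (use e in simp)
    then show ?thesis by blast
  qed
  obtain u r where u: "u \<in> L2 S" "strict_mono (r::nat\<Rightarrow>nat)" "AE x in lborel. (\<lambda>n. s (r n) x) \<longlonglongrightarrow> u x"
      "(\<lambda>n. l2_norm (\<lambda>x. s n x - u x)) \<longlonglongrightarrow> 0"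
  proof (rule L2_complete[of s S])
    show "s n \<in> L2 S" for n by (rule form_dom_L2[OF s])
    show "\<exists>N. \<forall>i\<ge>N. \<forall>j\<ge>N. l2_norm (\<lambda>x. s i x - s j x) < e" if "e > 0" for e
      by (rule sub[where F = "\<lambda>i j x. s i x - s j x" and K = C, OF coercive that])
  qed (rule that)
  have d1: "(l2_norm (\<lambda>x. weak_deriv S (s i) x - weak_deriv S (s j) x))\<^sup>2 \<le> 1 * energy (\<lambda>x. s i x - s j x)" for i j
    unfolding energy_diff[OF s s] by simp
  obtain v r1 where v: "v \<in> L2 S" "strict_mono (r1::nat\<Rightarrow>nat)"
      "(\<lambda>n. l2_norm (\<lambda>x. weak_deriv S (s n) x - v x)) \<longlonglongrightarrow> 0"
  proof (rule L2_complete[of "\<lambda>n. weak_deriv S (s n)" S])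
    show "weak_deriv S (s n) \<in> L2 S" for n by (rule weak_deriv_L2[OF H])
    show "\<exists>N. \<forall>i\<ge>N. \<forall>j\<ge>N. l2_norm (\<lambda>x. weak_deriv S (s i) x - weak_deriv S (s j) x) < e" if "e > 0" for e
      by (rule sub[where F = "\<lambda>i j x. weak_deriv S (s i) x - weak_deriv S (s j) x" and K = 1, OF d1 that])
  qed (rule that)
  have d2: "(l2_norm (\<lambda>x. root_mult (s i) x - root_mult (s j) x))\<^sup>2 \<le> 1 * energy (\<lambda>x. s i x - s j x)" for i j
    unfolding energy_diff[OF s s] by simp
  have rc: "\<exists>N. \<forall>i\<ge>N. \<forall>j\<ge>N. l2_norm (\<lambda>x. root_mult (s (r i)) x - root_mult (s (r j)) x) < e" if "e > 0" for e
  proof -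
    obtain N where "\<And>i j. i \<ge> N \<Longrightarrow> j \<ge> N \<Longrightarrow> l2_norm (\<lambda>x. root_mult (s i) x - root_mult (s j) x) < e"
      using sub[where F = "\<lambda>i j x. root_mult (s i) x - root_mult (s j) x" and K = 1, OF d2 \<open>e > 0\<close>] by blast
    moreover have "r i \<ge> i" for i using seq_suble[OF u(2)] .
    ultimately show ?thesis by (meson order_trans)
  qed
  obtain z r2 where z: "z \<in> L2 S" "strict_mono (r2::nat\<Rightarrow>nat)"
      "AE x in lborel. (\<lambda>n. root_mult (s (r (r2 n))) x) \<longlonglongrightarrow> z x"
      "(\<lambda>n. l2_norm (\<lambda>x. root_mult (s (r n)) x - z x)) \<longlonglongrightarrow> 0"
  proof (rule L2_complete[of "\<lambda>n. root_mult (s (r n))" S])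
    show "root_mult (s (r n)) \<in> L2 S" for n by (rule root_mult_L2[OF s])
  qed (rule rc, assumption, rule that)
  \<comment> \<open>Along a common subsequence both limits exist pointwise, which identifies \<open>z\<close>.\<close>
  have zu: "AE x in lborel. z x = root_mult u x"
    using z(3) u(3)
  proof eventually_elim
    case (elim x)
    have "(\<lambda>n. s (r (r2 n)) x) \<longlonglongrightarrow> u x"
      using LIMSEQ_subseq_LIMSEQ[OF elim(2) z(2)] by (simp add: o_def)
    then have "(\<lambda>n. root_mult (s (r (r2 n))) x) \<longlonglongrightarrow> root_mult u x"
      unfolding root_mult_def by (intro tendsto_intros)
    then show ?case using elim(1) LIMSEQ_unique by blast
  qed
  note um [measurable] = L2_measurable[OF u(1)]
  have rm [measurable]: "root_mult u \<in> borel_measurable borel" unfolding root_mult_def[abs_def] by measurable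
  have ru: "root_mult u \<in> L2 S"
  proof (rule L2_I)
    show "integrable lborel (\<lambda>x. (cmod (root_mult u x))\<^sup>2)"
      by (rule integrable_cong_AE_imp[OF L2_sq_integrable[OF z(1)]]) (use zu in auto)
  qed (use L2_zero_off[OF u(1)] in \<open>auto simp: root_mult_def\<close>)
  have wd: "is_weak_deriv S u v"
    by (rule is_weak_deriv_limit[OF weak_deriv_is[OF H] form_dom_L2[OF s] weak_deriv_L2[OF H] u(1) v(1) u(4) v(3)])
  have uH: "u \<in> H1 S" by (rule H1_I[OF u(1) v(1) wd])
  have uF: "u \<in> form_dom" by (rule form_dom_I[OF uH ru])
  have vAE: "AE x in lborel. weak_deriv S u x = v x" by (rule weak_deriv_AE_eq[OF dom u(1) v(1) wd])
  have e1: "l2_norm (\<lambda>x. weak_deriv S (s n) x - weak_deriv S u x) = l2_norm (\<lambda>x. weak_deriv S (s n) x - v x)" for n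
  proof (rule l2_norm_cong_AE)
    show "(\<lambda>x. weak_deriv S (s n) x - weak_deriv S u x) \<in> borel_measurable borel"
      by (intro L2_measurable[of _ S] L2_diff weak_deriv_L2 H uH)
    show "(\<lambda>x. weak_deriv S (s n) x - v x) \<in> borel_measurable borel"
      by (intro L2_measurable[of _ S] L2_diff weak_deriv_L2 H v(1))
  qed (use vAE in auto)
  have e2: "l2_norm (\<lambda>x. root_mult (s n) x - root_mult u x) = l2_norm (\<lambda>x. root_mult (s n) x - z x)" for n
  proof (rule l2_norm_cong_AE)
    show "(\<lambda>x. root_mult (s n) x - root_mult u x) \<in> borel_measurable borel"
      by (intro L2_measurable[of _ S] L2_diff root_mult_L2 s ru)
    show "(\<lambda>x. root_mult (s n) x - z x) \<in> borel_measurable borel"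
      by (intro L2_measurable[of _ S] L2_diff root_mult_L2 s z(1))
  qed (use zu in auto)
  have "(\<lambda>n. l2_norm (\<lambda>x. root_mult (s n) x - z x)) \<longlonglongrightarrow> 0"
  proof (rule LIMSEQ_I)
    fix e :: real assume e: "e > 0"
    obtain N where N: "\<And>i j. i \<ge> N \<Longrightarrow> j \<ge> N \<Longrightarrow> l2_norm (\<lambda>x. root_mult (s i) x - root_mult (s j) x) < e / 2"
      using sub[where F = "\<lambda>i j x. root_mult (s i) x - root_mult (s j) x" and K = 1, OF d2, of "e / 2"] e
      by auto
    obtain M where M: "\<And>n. n \<ge> M \<Longrightarrow> l2_norm (\<lambda>x. root_mult (s (r n)) x - z x) < e / 2"
      using LIMSEQ_D[OF z(4), of "e / 2"] e by auto
    have "l2_norm (\<lambda>x. root_mult (s n) x - z x) < e" if "n \<ge> N" for n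
    proof -
      define m where "m = max N M"
      have m: "r m \<ge> N" "m \<ge> M" using seq_suble[OF u(2), of m] unfolding m_def by auto
      have "l2_norm (\<lambda>x. root_mult (s n) x - z x) \<le> l2_norm (\<lambda>x. root_mult (s n) x - root_mult (s (r m)) x)
          + l2_norm (\<lambda>x. root_mult (s (r m)) x - z x)"
        by (rule l2_norm_triangle_diff[OF root_mult_L2[OF s] root_mult_L2[OF s] z(1)])
      then show ?thesis using N[OF that m(1)] M[OF m(2)] by linarith
    qed
    then show "\<exists>N. \<forall>n\<ge>N. norm (l2_norm (\<lambda>x. root_mult (s n) x - z x) - 0) < e" by auto
  qed
  then have "(\<lambda>n. (l2_norm (\<lambda>x. weak_deriv S (s n) x - v x))\<^sup>2 + (l2_norm (\<lambda>x. root_mult (s n) x - z x))\<^sup>2) \<longlonglongrightarrow> 0\<^sup>2 + 0\<^sup>2"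
    by (intro tendsto_add tendsto_power v(3))
  then have en: "(\<lambda>n. energy (\<lambda>x. s n x - u x)) \<longlonglongrightarrow> 0"
    unfolding energy_diff[OF s uF] e1 e2 by simp
  have h: "h1_norm S (\<lambda>x. u x - s n x) = sqrt ((l2_norm (\<lambda>x. s n x - u x))\<^sup>2 + (l2_norm (\<lambda>x. weak_deriv S (s n) x - v x))\<^sup>2)" for n
  proof -
    have "l2_norm (weak_deriv S (\<lambda>x. u x - s n x)) = l2_norm (\<lambda>x. weak_deriv S u x - weak_deriv S (s n) x)"
      by (rule l2_norm_cong_AE[OF _ _ weak_deriv_diff_AE[OF dom uH H]])
        (intro L2_measurable[of _ S] weak_deriv_L2 H1_diff H uH L2_diff)+
    also have "\<dots> = l2_norm (\<lambda>x. weak_deriv S (s n) x - v x)" using e1[of n] l2_norm_minus by metis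
    finally show ?thesis unfolding h1_norm_def using l2_norm_minus[of u "s n"] by simp
  qed
  have "(\<lambda>n. sqrt ((l2_norm (\<lambda>x. s n x - u x))\<^sup>2 + (l2_norm (\<lambda>x. weak_deriv S (s n) x - v x))\<^sup>2)) \<longlonglongrightarrow> sqrt (0\<^sup>2 + 0\<^sup>2)"
    by (intro tendsto_intros u(4) v(3))
  then have "(\<lambda>n. h1_norm S (\<lambda>x. u x - s n x)) \<longlonglongrightarrow> 0" unfolding h by simp
  with uF en show thesis by (rule that)
qed

text \<open>The representation theorem for the form on a domain \<open>D\<close> that is closed in the $H^1$ norm, such as
  $H^1$ or $H^1_0$: the equation is solvable for every right hand side.\<close>

lemma form_op_surjective:
  assumes D: "D \<subseteq> form_dom" "(\<lambda>x. 0) \<in> D" "\<And>u w c. u \<in> D \<Longrightarrow> w \<in> D \<Longrightarrow> (\<lambda>x. u x + c * w x) \<in> D"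
    and closed: "\<And>s u. (\<And>n::nat. s n \<in> D) \<Longrightarrow> u \<in> form_dom \<Longrightarrow>
        (\<lambda>n. h1_norm S (\<lambda>x. u x - s n x)) \<longlonglongrightarrow> 0 \<Longrightarrow> u \<in> D"
    and coercive: "\<And>u. u \<in> D \<Longrightarrow> (l2_norm u)\<^sup>2 \<le> C * energy u"
    and f: "f \<in> L2 S"
  obtains u where "(u, f) \<in> form_op S V D"
proof -
  have F: "u \<in> form_dom" if "u \<in> D" for u using D(1) that by blast
  have L: "u \<in> L2 S" if "u \<in> D" for u by (rule form_dom_L2[OF F[OF that]])
  have diff: "(\<lambda>x. u x - w x) \<in> D" if "u \<in> D" "w \<in> D" for u w using D(3)[OF that, of "-1"] by simp
  obtain u where u: "u \<in> D" and eq: "\<And>w. w \<in> D \<Longrightarrow> Re (schroed_form S V u w) = Re (l2_inner w f)"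
  proof (rule riesz_representation[where D = D and B = "\<lambda>u w. Re (schroed_form S V u w)"
        and l = "\<lambda>w. Re (l2_inner w f)" and K = "(l2_norm f)\<^sup>2 * C"])
    show "Re (schroed_form S V (\<lambda>x. u x + complex_of_real t * w x) z)
        = Re (schroed_form S V u z) + t * Re (schroed_form S V w z)"
      if "u \<in> D" "w \<in> D" "z \<in> D" for u w z t
      using schroed_form_comb[OF F[OF that(1)] F[OF that(2)] F[OF that(3)]] by simp
    show "Re (schroed_form S V u w) = Re (schroed_form S V w u)" if "u \<in> D" "w \<in> D" for u w
      using schroed_form_commute[OF F[OF that(1)] F[OF that(2)]] by simp
    show "0 \<le> Re (schroed_form S V u u)" if "u \<in> D" for u
      unfolding schroed_form_self[OF F[OF that]] energy_def by simp
    show "Re (l2_inner (\<lambda>x. u x + complex_of_real t * w x) f) = Re (l2_inner u f) + t * Re (l2_inner w f)"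
      if "u \<in> D" "w \<in> D" for u w t
      unfolding l2_inner_comb_left[OF L[OF that(1)] L[OF that(2)] f] by simp
    show "(Re (l2_inner u f))\<^sup>2 \<le> (l2_norm f)\<^sup>2 * C * Re (schroed_form S V u u)" if "u \<in> D" for u
    proof -
      have "\<bar>Re (l2_inner u f)\<bar> \<le> l2_norm u * l2_norm f"
        using abs_Re_le_cmod norm_l2_inner_le[OF L[OF that] f] by (rule order_trans)
      then have "(Re (l2_inner u f))\<^sup>2 \<le> (l2_norm u * l2_norm f)\<^sup>2"
        by (metis abs_ge_zero power2_abs power_mono)
      also have "\<dots> = (l2_norm f)\<^sup>2 * (l2_norm u)\<^sup>2" by (simp add: power_mult_distrib)
      also have "\<dots> \<le> (l2_norm f)\<^sup>2 * (C * energy u)"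
        by (intro mult_left_mono coercive[OF that]) simp
      finally show ?thesis unfolding schroed_form_self[OF F[OF that]] by (simp add: mult.assoc)
    qed
    fix s :: "nat \<Rightarrow> real \<Rightarrow> complex"
    assume s: "\<And>n. s n \<in> D" and c: "\<And>e. e > 0 \<Longrightarrow> \<exists>N. \<forall>i\<ge>N. \<forall>j\<ge>N.
        Re (schroed_form S V (\<lambda>x. s i x - s j x) (\<lambda>x. s i x - s j x)) < e"
    have *: "Re (schroed_form S V (\<lambda>x. s i x - s j x) (\<lambda>x. s i x - s j x)) = energy (\<lambda>x. s i x - s j x)" for i j
      unfolding schroed_form_self[OF F[OF diff[OF s s]]] by simp
    obtain u where u: "u \<in> form_dom" "(\<lambda>n. energy (\<lambda>x. s n x - u x)) \<longlonglongrightarrow> 0"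
      "(\<lambda>n. h1_norm S (\<lambda>x. u x - s n x)) \<longlonglongrightarrow> 0"
      using form_dom_complete[OF F[OF s] c[unfolded *] coercive[OF diff[OF s s]]] by blast
    have uD: "u \<in> D" by (rule closed[OF s u(1,3)])
    have **: "Re (schroed_form S V (\<lambda>x. s n x - u x) (\<lambda>x. s n x - u x)) = energy (\<lambda>x. s n x - u x)" for n
      unfolding schroed_form_self[OF F[OF diff[OF s uD]]] by simp
    show "\<exists>u\<in>D. (\<lambda>n. Re (schroed_form S V (\<lambda>x. s n x - u x) (\<lambda>x. s n x - u x))) \<longlonglongrightarrow> 0"
      by (rule bexI[OF _ uD]) (unfold **, rule u(2))
  qed (use D in auto)
  have "schroed_form S V u w = l2_inner f w" if w: "w \<in> D" for w
  proof (rule complex_eqI)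
    show "Re (schroed_form S V u w) = Re (l2_inner f w)"
      using eq[OF w] l2_inner_commute[of f w] by simp
    \<comment> \<open>The imaginary part is the real part for the test function \<open>\<i> w\<close>.\<close>
    have iw: "(\<lambda>x. 0 + \<i> * w x) \<in> D" by (rule D(3)[OF D(2) w])
    have z: "schroed_form S V (\<lambda>x. 0) u = 0"
      using schroed_form_comb[OF F[OF D(2)] F[OF D(2)] F[OF u], of 1] by simp
    have "schroed_form S V (\<lambda>x. 0 + \<i> * w x) u = \<i> * schroed_form S V w u"
      using schroed_form_comb[OF F[OF D(2)] F[OF w] F[OF u], of \<i>] z by simp
    then have "schroed_form S V u (\<lambda>x. 0 + \<i> * w x) = cnj (\<i> * schroed_form S V w u)"
      using schroed_form_commute[OF F[OF iw] F[OF u]] by simp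
    also have "\<dots> = - \<i> * schroed_form S V u w"
      using schroed_form_commute[OF F[OF u] F[OF w]] by simp
    finally have "Re (schroed_form S V u (\<lambda>x. 0 + \<i> * w x)) = Im (schroed_form S V u w)" by simp
    moreover have "Re (l2_inner (\<lambda>x. 0 + \<i> * w x) f) = - Im (l2_inner w f)"
      using l2_inner_comb_left[OF L2_0 L[OF w] f, of \<i>] by (simp add: l2_inner_def)
    ultimately show "Im (schroed_form S V u w) = Im (l2_inner f w)"
      using eq[OF iw] l2_inner_commute[of f w] by simp
  qed
  then have "(u, f) \<in> form_op S V D" unfolding form_op_def using u f by blast
  then show thesis by (rule that)
qed

end


section \<open>Cutoff functions and $H^1_0$\<close>

text \<open>The cutoff is $p/(p+q)$ with $p = \max(0, \rho^2 - x^2)^2$ and $q = \max(0, x^2 - \rho^2/4)^2$, which do not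
  vanish simultaneously.\<close>

lemma C1_cutoff:
  fixes \<rho> :: real
  assumes "\<rho> > 0"
  obtains \<theta> \<theta>' :: "real \<Rightarrow> real" and B :: real
  where "\<And>x. (\<theta> has_real_derivative \<theta>' x) (at x)" "continuous_on UNIV \<theta>'" "\<And>x. 0 \<le> \<theta> x" "\<And>x. \<theta> x \<le> 1"
    "\<And>x. \<bar>x\<bar> \<le> \<rho> / 2 \<Longrightarrow> \<theta> x = 1" "\<And>x. x \<notin> {-\<rho>..\<rho>} \<Longrightarrow> \<theta> x = 0"
    "\<And>x. x \<notin> {-\<rho>..\<rho>} \<Longrightarrow> \<theta>' x = 0" "\<And>x. \<bar>x\<bar> < \<rho> / 2 \<Longrightarrow> \<theta>' x = 0" "\<And>x. \<bar>\<theta>' x\<bar> \<le> B" "B \<ge> 0"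
proof -
  define p where "p x = (max 0 (\<rho>\<^sup>2 - x\<^sup>2))\<^sup>2" for x
  define q where "q x = (max 0 (x\<^sup>2 - (\<rho> / 2)\<^sup>2))\<^sup>2" for x
  define p' where "p' x = 2 * max 0 (\<rho>\<^sup>2 - x\<^sup>2) * (- (2 * x))" for x
  define q' where "q' x = 2 * max 0 (x\<^sup>2 - (\<rho> / 2)\<^sup>2) * (2 * x)" for x
  have dp: "(p has_real_derivative p' x) (at x)" for x
    unfolding p_def p'_def by (rule DERIV_chain2[OF pos_part_sq_deriv]) (auto intro!: derivative_eq_intros)
  have dq: "(q has_real_derivative q' x) (at x)" for x
    unfolding q_def q'_def by (rule DERIV_chain2[OF pos_part_sq_deriv]) (auto intro!: derivative_eq_intros)
  have pq: "p x + q x > 0" for x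
  proof (cases "x\<^sup>2 < \<rho>\<^sup>2")
    case True
    then have "p x > 0" unfolding p_def by (simp add: max_def)
    moreover have "q x \<ge> 0" unfolding q_def by simp
    ultimately show ?thesis by simp
  next
    case False
    have "(\<rho> / 2)\<^sup>2 < \<rho>\<^sup>2" using assms by (simp add: power_divide)
    then have "q x > 0" using False unfolding q_def by (simp add: max_def)
    moreover have "p x \<ge> 0" unfolding p_def by simp
    ultimately show ?thesis by simp
  qed
  define \<theta> where "\<theta> x = p x / (p x + q x)" for x
  define \<theta>' where "\<theta>' x = (p' x * (p x + q x) - p x * (p' x + q' x)) / ((p x + q x) * (p x + q x))" for x
  have cp: "continuous_on UNIV p" "continuous_on UNIV q" "continuous_on UNIV p'" "continuous_on UNIV q'"
    unfolding p_def q_def p'_def q'_def by (intro continuous_intros)+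
  have d: "(\<theta> has_real_derivative \<theta>' x) (at x)" for x
    unfolding \<theta>_def \<theta>'_def using pq[of x] by (intro DERIV_divide DERIV_add dp dq) simp
  have c': "continuous_on UNIV \<theta>'"
    unfolding \<theta>'_def using pq by (intro continuous_intros cp) (auto simp: less_le)
  have nn: "p x \<ge> 0" "q x \<ge> 0" for x unfolding p_def q_def by auto
  have p0: "p x = 0" "p' x = 0" if "x \<notin> {-\<rho>..\<rho>}" for x
  proof -
    have "\<rho> < \<bar>x\<bar>" using that by auto
    then have "\<rho>\<^sup>2 < x\<^sup>2" using assms by (metis abs_less_iff abs_of_pos less_eq_real_def power2_abs power_strict_mono zero_less_numeral)
    then show "p x = 0" "p' x = 0" unfolding p_def p'_def by auto
  qed
  have q0: "q x = 0" "q' x = 0" if "\<bar>x\<bar> \<le> \<rho> / 2" for x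
  proof -
    have "x\<^sup>2 \<le> (\<rho> / 2)\<^sup>2" using that by (metis abs_ge_zero power2_abs power_mono)
    then show "q x = 0" "q' x = 0" unfolding q_def q'_def by auto
  qed
  have "\<theta>' x = 0" if "x \<notin> {-\<rho>..\<rho>}" for x unfolding \<theta>'_def using p0[OF that] by simp
  moreover have "\<theta> x = 0" if "x \<notin> {-\<rho>..\<rho>}" for x unfolding \<theta>_def using p0[OF that] by simp
  moreover have "\<theta> x = 1" if "\<bar>x\<bar> \<le> \<rho> / 2" for x unfolding \<theta>_def using q0[OF that] pq[of x] by simp
  moreover have "\<theta>' x = 0" if "\<bar>x\<bar> < \<rho> / 2" for x unfolding \<theta>'_def using q0[of x] that by (simp add: mult.commute)
  moreover have "0 \<le> \<theta> x" "\<theta> x \<le> 1" for x unfolding \<theta>_def using nn[of x] pq[of x] by auto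
  moreover obtain B where "\<And>x. \<bar>\<theta>' x\<bar> \<le> B" "B \<ge> 0"
  proof -
    have "bounded (\<theta>' ` {-\<rho>..\<rho>})"
      by (rule compact_imp_bounded[OF compact_continuous_image[OF continuous_on_subset[OF c'] compact_Icc]]) simp
    then obtain C where C: "\<And>y. y \<in> \<theta>' ` {-\<rho>..\<rho>} \<Longrightarrow> norm y \<le> C" unfolding bounded_iff by blast
    have "\<bar>\<theta>' x\<bar> \<le> max C 0" for x
    proof (cases "x \<in> {-\<rho>..\<rho>}")
      case True
      then have "\<bar>\<theta>' x\<bar> \<le> C" using C[of "\<theta>' x"] by simp
      then show ?thesis by simp
    next
      case False
      then show ?thesis using \<open>\<And>x. x \<notin> {-\<rho>..\<rho>} \<Longrightarrow> \<theta>' x = 0\<close> by simp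
    qed
    then show thesis using that[of "max C 0"] by auto
  qed
  ultimately show thesis using d c' that[of \<theta> \<theta>' B] by blast
qed

lemma l2_norm_tendsto_0_dominated:
  assumes f: "\<And>n::nat. f n \<in> borel_measurable borel" and g: "g \<in> L2 T"
    and le: "\<And>n x. cmod (f n x) \<le> cmod (g x)" and lim: "AE x in lborel. (\<lambda>n. f n x) \<longlonglongrightarrow> 0"
  shows "(\<lambda>n. l2_norm (f n)) \<longlonglongrightarrow> 0"
proof -
  note [measurable] = f L2_measurable[OF g]
  have "(\<lambda>n. \<integral>x. (cmod (f n x))\<^sup>2 \<partial>lborel) \<longlonglongrightarrow> (\<integral>x. 0 \<partial>(lborel::real measure))"
  proof (rule integral_dominated_convergence[where w = "\<lambda>x. (cmod (g x))\<^sup>2"])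
    show "integrable lborel (\<lambda>x. (cmod (g x))\<^sup>2)" by (rule L2_sq_integrable[OF g])
    show "AE x in lborel. norm ((cmod (f n x))\<^sup>2) \<le> (cmod (g x))\<^sup>2" for n
      using le by (auto intro!: AE_I2 power_mono)
    show "AE x in lborel. (\<lambda>n. (cmod (f n x))\<^sup>2) \<longlonglongrightarrow> 0"
      using lim
    proof eventually_elim
      case (elim x)
      then have "(\<lambda>n. (cmod (f n x))\<^sup>2) \<longlonglongrightarrow> (cmod 0)\<^sup>2" by (intro tendsto_power tendsto_norm)
      then show ?case by simp
    qed
  qed measurable
  then have "(\<lambda>n. sqrt (\<integral>x. (cmod (f n x))\<^sup>2 \<partial>lborel)) \<longlonglongrightarrow> sqrt 0"
    by (intro tendsto_real_sqrt) simp
  then show ?thesis unfolding l2_norm_def by simp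
qed

text \<open>Continuous functions are dense in $L^2$: truncate, approximate almost everywhere by continuous
  functions, truncate these as well, and multiply by a plateau function.\<close>

lemma L2_continuous_approx:
  assumes v: "v \<in> L2 {c..d}" and c': "c' < c" "c \<le> d" "d < d'" and e: "e > 0"
  obtains \<psi> where "continuous_on UNIV \<psi>" "\<And>x. x \<notin> {c'..d'} \<Longrightarrow> \<psi> x = 0" "l2_norm (\<lambda>x. v x - \<psi> x) < e"
proof -
  note [measurable] = L2_measurable[OF v]
  have clm: "(\<lambda>x. clip K (f x)) \<in> borel_measurable borel" if "f \<in> borel_measurable borel" "K > 0" for K and f :: "real \<Rightarrow> complex"
    by (rule measurable_compose[OF that(1)], rule borel_measurable_continuous_onI, rule clip_continuous[OF that(2)])
  have "(\<lambda>n. l2_norm (\<lambda>x. v x - clip (real (Suc n)) (v x))) \<longlonglongrightarrow> 0"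
  proof (rule l2_norm_tendsto_0_dominated[OF _ v])
    show "(\<lambda>x. v x - clip (real (Suc n)) (v x)) \<in> borel_measurable borel" for n
      using clm[of v "real (Suc n)"] by simp
    show "cmod (v x - clip (real (Suc n)) (v x)) \<le> cmod (v x)" for n x
    proof -
      let ?t = "real (Suc n) / max (real (Suc n)) (cmod (v x))"
      have t: "0 \<le> ?t" "?t \<le> 1" by (auto simp: divide_le_eq_1)
      have "v x - clip (real (Suc n)) (v x) = of_real (1 - ?t) * v x"
        unfolding clip_def by (simp add: algebra_simps)
      then have "cmod (v x - clip (real (Suc n)) (v x)) = (1 - ?t) * cmod (v x)"
        using t by (simp add: norm_mult del: of_real_diff)
      also have "\<dots> \<le> 1 * cmod (v x)" using t by (intro mult_right_mono) auto
      finally show ?thesis by simp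
    qed
    show "AE x in lborel. (\<lambda>n. v x - clip (real (Suc n)) (v x)) \<longlonglongrightarrow> 0"
    proof (rule AE_I2)
      fix x
      obtain N where N: "cmod (v x) \<le> real N" using real_arch_simple by blast
      have "v x - clip (real (Suc n)) (v x) = 0" if "n \<ge> N" for n
        using clip_id[of "v x" "real (Suc n)"] N that by simp
      then show "(\<lambda>n. v x - clip (real (Suc n)) (v x)) \<longlonglongrightarrow> 0"
        by (intro tendsto_eventually) (auto simp: eventually_sequentially)
    qed
  qed
  from LIMSEQ_D[OF this, of "e / 2"] e obtain n0 where
    n0: "l2_norm (\<lambda>x. v x - clip (real (Suc n0)) (v x)) < e / 2" by auto
  define K where "K = real (Suc n0)"
  have K: "K > 0" unfolding K_def by simp
  obtain g where g: "\<And>n::nat. continuous_on UNIV (g n)" "AE x in lborel. (\<lambda>n. g n x) \<longlonglongrightarrow> v x"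
    using continuous_AE_approx[OF L2_measurable[OF v]] by blast
  define \<delta> where "\<delta> = min (c - c') (d' - d)"
  have \<delta>: "\<delta> > 0" using c' unfolding \<delta>_def by auto
  define \<theta> where "\<theta> x = max 0 (1 - max 0 (max (c - x) (x - d)) / \<delta>)" for x
  have \<theta>c: "continuous_on UNIV \<theta>" unfolding \<theta>_def using \<delta> by (intro continuous_intros) auto
  have \<theta>1: "\<theta> x = 1" if "x \<in> {c..d}" for x using that unfolding \<theta>_def by (auto simp: max_def)
  have \<theta>0: "\<theta> x = 0" if "x \<notin> {c'..d'}" for x
  proof -
    have "max 0 (max (c - x) (x - d)) \<ge> \<delta>" using that unfolding \<delta>_def by (auto simp: min_def max_def)
    then have "max 0 (max (c - x) (x - d)) / \<delta> \<ge> 1" using \<delta> by (simp add: le_divide_eq_1)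
    then show ?thesis unfolding \<theta>_def by simp
  qed
  have \<theta>b: "0 \<le> \<theta> x" "\<theta> x \<le> 1" for x unfolding \<theta>_def using \<delta> by (auto simp: max_def)
  define h where "h n x = of_real (\<theta> x) * clip K (g n x)" for n x
  have hc: "continuous_on UNIV (h n)" for n
    unfolding h_def using continuous_on_compose2[OF clip_continuous[OF K, of UNIV] g(1)[of n]]
    by (intro continuous_intros \<theta>c) simp
  have h0: "h n x = 0" if "x \<notin> {c'..d'}" for n x using \<theta>0[OF that] unfolding h_def by simp
  have vo: "clip K (v x) = of_real (\<theta> x) * clip K (v x)" for x
    using L2_zero_off[OF v, of x] \<theta>1[of x] by (cases "x \<in> {c..d}") (auto simp: clip_def)
  have "(\<lambda>n. l2_norm (\<lambda>x. clip K (v x) - h n x)) \<longlonglongrightarrow> 0"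
  proof (rule l2_norm_tendsto_0_dominated[where g = "\<lambda>x. of_real (2 * K) * indicator {c'..d'} x"])
    show "(\<lambda>x. clip K (v x) - h n x) \<in> borel_measurable borel" for n
      using borel_measurable_continuous[OF hc[of n]] clm[OF L2_measurable[OF v] K] by simp
    show "(\<lambda>x. of_real (2 * K) * indicator {c'..d'} x) \<in> L2 UNIV"
      by (intro L2_cmult indicator_L2) auto
    show "cmod (clip K (v x) - h n x) \<le> cmod (of_real (2 * K) * indicator {c'..d'} x)" for n x
    proof (cases "x \<in> {c'..d'}")
      case True
      have "cmod (h n x) \<le> 1 * K"
        unfolding h_def norm_mult using \<theta>b[of x] clip_bound[OF K, of "g n x"] by (intro mult_mono) auto
      then have "cmod (clip K (v x) - h n x) \<le> K + K"
        using norm_triangle_ineq4[of "clip K (v x)" "h n x"] clip_bound[OF K, of "v x"] by linarith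
      then show ?thesis using True K by (simp add: norm_mult)
    next
      case False
      then have "x \<notin> {c..d}" using c' by auto
      then show ?thesis using False h0[OF False] L2_zero_off[OF v, of x] by (simp add: clip_def)
    qed
    show "AE x in lborel. (\<lambda>n. clip K (v x) - h n x) \<longlonglongrightarrow> 0"
      using g(2)
    proof eventually_elim
      case (elim x)
      have "(\<lambda>n. clip K (g n x)) \<longlonglongrightarrow> clip K (v x)"
        by (rule continuous_on_tendsto_compose[OF clip_continuous[OF K, of UNIV] elim]) auto
      then have "(\<lambda>n. clip K (v x) - h n x) \<longlonglongrightarrow> clip K (v x) - of_real (\<theta> x) * clip K (v x)"
        unfolding h_def by (intro tendsto_intros)
      then show ?case using vo[of x] by simp
    qed
  qed
  from LIMSEQ_D[OF this, of "e / 2"] e obtain n1 where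
    n1: "l2_norm (\<lambda>x. clip K (v x) - h n1 x) < e / 2" by auto
  have hL: "h n1 \<in> L2 UNIV" by (rule continuous_compact_support_L2[OF hc compact_Icc subset_UNIV h0])
  have cL: "(\<lambda>x. clip K (v x)) \<in> L2 UNIV"
    by (rule L2_dominated[OF clm[OF L2_measurable[OF v] K] v, where C = 1]) (use clip_le[OF K] in auto)
  have "l2_norm (\<lambda>x. v x - h n1 x) \<le> l2_norm (\<lambda>x. v x - clip K (v x)) + l2_norm (\<lambda>x. clip K (v x) - h n1 x)"
    by (rule l2_norm_triangle_diff[OF v cL hL])
  then have "l2_norm (\<lambda>x. v x - h n1 x) < e" using n0 n1 unfolding K_def by linarith
  with hc h0 show thesis by (rule that)
qed

lemma is_weak_deriv_mono: "is_weak_deriv T u v \<Longrightarrow> S \<subseteq> T \<Longrightarrow> is_weak_deriv S u v"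
  unfolding is_weak_deriv_def using C1c_mono[of _ "interior S" "interior T"] interior_mono[of S T] by blast

text \<open>The $H^1$ norm may be computed with any weak derivative instead of the one selected by choice.\<close>

lemma h1_norm_eq:
  assumes "interval_domain S" "u \<in> L2 S" "v \<in> L2 S" "is_weak_deriv S u v"
  shows "h1_norm S u = sqrt ((l2_norm u)\<^sup>2 + (l2_norm v)\<^sup>2)"
proof -
  have "l2_norm (weak_deriv S u) = l2_norm v"
    by (rule l2_norm_cong_AE[OF _ _ weak_deriv_AE_eq[OF assms]])
      (use assms H1_I weak_deriv_L2 in \<open>blast intro: L2_measurable\<close>)+
  then show ?thesis unfolding h1_norm_def by simp
qed

lemma h1_norm_comb_le:
  assumes "interval_domain S" "u \<in> H1 S" "w \<in> H1 S"
  shows "h1_norm S (\<lambda>x. u x + c * w x) \<le> h1_norm S u + cmod c * h1_norm S w"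
proof -
  note d = weak_deriv_L2[OF assms(2)] weak_deriv_L2[OF assms(3)] and L = H1_L2[OF assms(2)] H1_L2[OF assms(3)]
  have "h1_norm S (\<lambda>x. u x + c * w x)
    = sqrt ((l2_norm (\<lambda>x. u x + c * w x))\<^sup>2 + (l2_norm (\<lambda>x. weak_deriv S u x + c * weak_deriv S w x))\<^sup>2)"
    by (rule h1_norm_eq[OF assms(1) L2_add[OF L(1) L2_cmult[OF L(2)]] L2_add[OF d(1) L2_cmult[OF d(2)]]
          is_weak_deriv_comb[OF weak_deriv_is[OF assms(2)] weak_deriv_is[OF assms(3)] L(1) d(1) L(2) d(2)]])
  also have "\<dots> \<le> sqrt ((l2_norm u + cmod c * l2_norm w)\<^sup>2
      + (l2_norm (weak_deriv S u) + cmod c * l2_norm (weak_deriv S w))\<^sup>2)"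
    using l2_norm_triangle[OF L(1) L2_cmult[OF L(2), of c]] l2_norm_triangle[OF d(1) L2_cmult[OF d(2), of c]]
    by (intro real_sqrt_le_mono add_mono power_mono) (auto simp: l2_norm_cmult)
  also have "\<dots> \<le> sqrt ((l2_norm u)\<^sup>2 + (l2_norm (weak_deriv S u))\<^sup>2)
      + sqrt ((cmod c * l2_norm w)\<^sup>2 + (cmod c * l2_norm (weak_deriv S w))\<^sup>2)"
    by (rule real_sqrt_sum_squares_triangle_ineq)
  also have "(cmod c * l2_norm w)\<^sup>2 + (cmod c * l2_norm (weak_deriv S w))\<^sup>2
      = (cmod c)\<^sup>2 * ((l2_norm w)\<^sup>2 + (l2_norm (weak_deriv S w))\<^sup>2)"
    by (simp add: power_mult_distrib algebra_simps)
  also have "sqrt \<dots> = cmod c * h1_norm S w" unfolding h1_norm_def by (simp add: real_sqrt_mult)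
  finally show ?thesis unfolding h1_norm_def .
qed

lemma h1_norm_nonneg: "h1_norm S u \<ge> 0"
  unfolding h1_norm_def by simp

lemma C1c_comb:
  assumes "\<phi> \<in> C1c U" "\<psi> \<in> C1c U" shows "(\<lambda>x. \<phi> x + c * \<psi> x) \<in> C1c U"
proof -
  obtain \<phi>' K where \<phi>: "\<And>x. (\<phi> has_vector_derivative \<phi>' x) (at x)" "continuous_on UNIV \<phi>'"
    "continuous_on UNIV \<phi>" "compact K" "K \<subseteq> U" "\<And>x. x \<notin> K \<Longrightarrow> \<phi> x = 0" "\<And>x. x \<notin> K \<Longrightarrow> \<phi>' x = 0"
    "(\<lambda>x. vector_derivative \<phi> (at x)) = \<phi>'" using assms(1) by (rule C1c_E) (rule that)
  obtain \<psi>' J where \<psi>: "\<And>x. (\<psi> has_vector_derivative \<psi>' x) (at x)" "continuous_on UNIV \<psi>'"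
    "continuous_on UNIV \<psi>" "compact J" "J \<subseteq> U" "\<And>x. x \<notin> J \<Longrightarrow> \<psi> x = 0" "\<And>x. x \<notin> J \<Longrightarrow> \<psi>' x = 0"
    "(\<lambda>x. vector_derivative \<psi> (at x)) = \<psi>'" using assms(2) by (rule C1c_E) (rule that)
  show ?thesis
  proof (rule C1c_I[where K = "K \<union> J"])
    show "((\<lambda>x. \<phi> x + c * \<psi> x) has_vector_derivative \<phi>' x + c * \<psi>' x) (at x)" for x
      by (intro has_vector_derivative_add has_vector_derivative_mult_right \<phi> \<psi>)
    show "continuous_on UNIV (\<lambda>x. \<phi>' x + c * \<psi>' x)" by (intro continuous_intros \<phi> \<psi>)
    show "compact (K \<union> J)" by (rule compact_Un[OF \<phi>(4) \<psi>(4)])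
  qed (use \<phi> \<psi> in auto)
qed

lemma C1c_zero: "(\<lambda>x. 0) \<in> C1c U"
  by (rule C1c_I[of _ "\<lambda>_. 0" "{}"]) auto

lemma H10_H1: "u \<in> H10 S \<Longrightarrow> u \<in> H1 S"
  unfolding H10_def by simp

lemma H10_approx:
  assumes "u \<in> H10 S" "e > 0"
  obtains \<phi> where "\<phi> \<in> C1c (interior S)" "h1_norm S (\<lambda>x. u x - \<phi> x) < e"
proof -
  obtain \<phi> where \<phi>: "\<And>n. \<phi> n \<in> C1c (interior S)" "(\<lambda>n::nat. h1_norm S (\<lambda>x. u x - \<phi> n x)) \<longlonglongrightarrow> 0"
    using assms(1) unfolding H10_def by auto
  from LIMSEQ_D[OF \<phi>(2) assms(2)] obtain n where "norm (h1_norm S (\<lambda>x. u x - \<phi> n x) - 0) < e" by auto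
  then show thesis using \<phi>(1)[of n] that by simp
qed

lemma H10_I:
  assumes "u \<in> H1 S" "\<And>e. e > 0 \<Longrightarrow> \<exists>\<phi>. \<phi> \<in> C1c (interior S) \<and> h1_norm S (\<lambda>x. u x - \<phi> x) < e"
  shows "u \<in> H10 S"
proof -
  have "\<exists>\<phi>. \<phi> \<in> C1c (interior S) \<and> h1_norm S (\<lambda>x. u x - \<phi> x) < 1 / real (Suc n)" for n
    by (rule assms(2)) simp
  then obtain \<phi> where \<phi>: "\<And>n. \<phi> n \<in> C1c (interior S)" "\<And>n. h1_norm S (\<lambda>x. u x - \<phi> n x) < 1 / real (Suc n)"
    by metis
  have "(\<lambda>n. h1_norm S (\<lambda>x. u x - \<phi> n x)) \<longlonglongrightarrow> 0"
    by (rule tendsto_sandwich[OF _ _ tendsto_const LIMSEQ_Suc[OF lim_1_over_n]])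
      (use \<phi>(2) in \<open>auto simp: h1_norm_nonneg less_imp_le\<close>)
  then show ?thesis unfolding H10_def using assms(1) \<phi>(1) by blast
qed

lemma C1c_H10:
  assumes "interval_domain S" "\<phi> \<in> C1c (interior S)" shows "\<phi> \<in> H10 S"
proof (rule H10_I[OF C1c_H1[OF assms(2)]])
  fix e :: real assume "e > 0"
  have "h1_norm S (\<lambda>x. 0) = 0"
    using h1_norm_eq[OF assms(1) L2_0 L2_0] by (simp add: is_weak_deriv_def l2_norm_def)
  then show "\<exists>\<psi>. \<psi> \<in> C1c (interior S) \<and> h1_norm S (\<lambda>x. \<phi> x - \<psi> x) < e"
    using assms(2) \<open>e > 0\<close> by (intro exI[of _ \<phi>]) simp
qed

lemma H10_zero: "interval_domain S \<Longrightarrow> (\<lambda>x. 0) \<in> H10 S"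
  by (rule C1c_H10[OF _ C1c_zero])

lemma H10_comb:
  assumes S: "interval_domain S" and "u \<in> H10 S" "w \<in> H10 S" shows "(\<lambda>x. u x + c * w x) \<in> H10 S"
proof (rule H10_I[OF H1_comb[OF H10_H1[OF assms(2)] H10_H1[OF assms(3)]]])
  fix e :: real assume e: "e > 0"
  define e' where "e' = e / (1 + cmod c)"
  have c: "1 + cmod c > 0" using norm_ge_zero[of c] by linarith
  have e': "e' > 0" unfolding e'_def using e c by simp
  obtain \<phi> where \<phi>: "\<phi> \<in> C1c (interior S)" "h1_norm S (\<lambda>x. u x - \<phi> x) < e'"
    using H10_approx[OF assms(2) e'] by blast
  obtain \<psi> where \<psi>: "\<psi> \<in> C1c (interior S)" "h1_norm S (\<lambda>x. w x - \<psi> x) < e'"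
    using H10_approx[OF assms(3) e'] by blast
  have "h1_norm S (\<lambda>x. (u x - \<phi> x) + c * (w x - \<psi> x))
      \<le> h1_norm S (\<lambda>x. u x - \<phi> x) + cmod c * h1_norm S (\<lambda>x. w x - \<psi> x)"
    by (rule h1_norm_comb_le[OF S H1_diff[OF H10_H1[OF assms(2)] C1c_H1[OF \<phi>(1)]] H1_diff[OF H10_H1[OF assms(3)] C1c_H1[OF \<psi>(1)]]])
  also have "\<dots> < e' + cmod c * e'"
    by (rule add_less_le_mono[OF \<phi>(2) mult_left_mono]) (use \<psi>(2) in auto)
  also have "\<dots> = e' * (1 + cmod c)" by (simp add: algebra_simps)
  also have "\<dots> = e" unfolding e'_def using c by simp
  finally have "h1_norm S (\<lambda>x. (u x + c * w x) - (\<phi> x + c * \<psi> x)) < e" by (simp add: algebra_simps)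
  then show "\<exists>\<phi>. \<phi> \<in> C1c (interior S) \<and> h1_norm S (\<lambda>x. u x + c * w x - \<phi> x) < e"
    using C1c_comb[OF \<phi>(1) \<psi>(1)] by (intro exI[of _ "\<lambda>x. \<phi> x + c * \<psi> x"]) simp
qed

text \<open>A closure is closed: approximate an approximating element by a test function.\<close>

lemma H10_closed:
  assumes S: "interval_domain S" and s: "\<And>n::nat. s n \<in> H10 S" and u: "u \<in> H1 S"
    and lim: "(\<lambda>n. h1_norm S (\<lambda>x. u x - s n x)) \<longlonglongrightarrow> 0"
  shows "u \<in> H10 S"
proof (rule H10_I[OF u])
  fix e :: real assume e: "e > 0"
  obtain n where "\<forall>i\<ge>n. norm (h1_norm S (\<lambda>x. u x - s i x) - 0) < e / 2"
    using LIMSEQ_D[OF lim, of "e / 2"] e by auto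
  then have n: "h1_norm S (\<lambda>x. u x - s n x) < e / 2" by (auto dest: spec[of _ n])
  obtain \<phi> where \<phi>: "\<phi> \<in> C1c (interior S)" "h1_norm S (\<lambda>x. s n x - \<phi> x) < e / 2"
    using H10_approx[OF s, of "e / 2"] e by auto
  have "h1_norm S (\<lambda>x. (u x - s n x) + 1 * (s n x - \<phi> x))
      \<le> h1_norm S (\<lambda>x. u x - s n x) + cmod 1 * h1_norm S (\<lambda>x. s n x - \<phi> x)"
    by (rule h1_norm_comb_le[OF S H1_diff[OF u H10_H1[OF s]] H1_diff[OF H10_H1[OF s] C1c_H1[OF \<phi>(1)]]])
  then have "h1_norm S (\<lambda>x. u x - \<phi> x) < e" using n \<phi>(2) by simp
  then show "\<exists>\<phi>. \<phi> \<in> C1c (interior S) \<and> h1_norm S (\<lambda>x. u x - \<phi> x) < e" using \<phi>(1) by blast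
qed

text \<open>A function with compact support vanishes somewhere to the left of its support, so it is
  controlled by its derivative.\<close>

lemma poincare_compact_support:
  assumes y: "y \<in> L2 {c..d}" and v: "v \<in> L2 UNIV" and wd: "is_weak_deriv UNIV y v" and cd: "c \<le> d"
  shows "l2_norm y \<le> (d - c + 1) * l2_norm v"
proof -
  obtain k where k: "AE x in lborel. x \<in> UNIV \<longrightarrow> y x = primitive v x + k"
    using weak_deriv_representative[OF interval_domain_UNIV L2_UNIV[OF y] v wd] by blast
  have "\<exists>x0. c - 1 < x0 \<and> x0 < c \<and> y x0 = primitive v x0 + k"
  proof (rule ccontr)
    assume none: "\<nexists>x0. c - 1 < x0 \<and> x0 < c \<and> y x0 = primitive v x0 + k"
    have "AE x in lborel. x \<notin> {c - 1<..<c}" using k by eventually_elim (use none in auto)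
    then have "emeasure lborel {c - 1<..<c} = 0"
      by (subst (asm) AE_iff_measurable[of "{c - 1<..<c}"]) auto
    then show False by simp
  qed
  then obtain x0 where x0: "c - 1 < x0" "x0 < c" "y x0 = primitive v x0 + k" by blast
  have "y x0 = 0" using L2_zero_off[OF y, of x0] x0 by simp
  then have k': "k = - primitive v x0" using x0(3) by (simp add: add_eq_0_iff)
  let ?L = "d - c + 1"
  have L: "?L > 0" using cd by simp
  define b :: "real \<Rightarrow> complex" where "b x = of_real (sqrt ?L * l2_norm v) * indicator {c<..d} x" for x
  have "l2_norm y \<le> l2_norm b"
  proof (rule l2_norm_mono)
    show "b \<in> L2 UNIV" unfolding b_def
      by (intro L2_cmult indicator_L2) (auto intro: bounded_subset[of "{c..d}"])
    show "AE x in lborel. cmod (y x) \<le> cmod (b x)"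
      using k AE_lborel_singleton[of c]
    proof eventually_elim
      case (elim x)
      show ?case
      proof (cases "x \<in> {c<..d}")
        case True
        have "cmod (y x) \<le> sqrt \<bar>x - x0\<bar> * l2_norm v"
          using primitive_diff_le[OF v, of x x0] elim k' by simp
        also have "\<dots> \<le> sqrt ?L * l2_norm v"
          using True x0 by (intro mult_right_mono real_sqrt_le_mono) auto
        finally show ?thesis using True L unfolding b_def by (simp add: norm_mult)
      next
        case False
        then have "x \<notin> {c..d}" using elim(2) by auto
        then show ?thesis using L2_zero_off[OF y] by simp
      qed
    qed
  qed (rule L2_measurable[OF y])
  also have "l2_norm b = sqrt ?L * l2_norm v * sqrt (d - c)"
    unfolding b_def l2_norm_cmult l2_norm_indicator_Ioc[OF cd] using L by (simp add: norm_mult)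
  also have "\<dots> \<le> sqrt ?L * l2_norm v * sqrt ?L"
    by (intro mult_left_mono real_sqrt_le_mono mult_nonneg_nonneg) (use L in auto)
  also have "\<dots> = ?L * l2_norm v" using L by (simp add: mult_ac flip: real_sqrt_mult power2_eq_square)
  finally show ?thesis .
qed

lemma compact_support_mult_L2:
  fixes g :: "real \<Rightarrow> real"
  assumes g: "continuous_on UNIV g" "\<And>x. x \<notin> {c..d} \<Longrightarrow> g x = 0" and f: "f \<in> L2 T"
  shows "(\<lambda>x. of_real (g x) * f x) \<in> L2 {c..d}"
proof -
  have gc: "continuous_on UNIV (\<lambda>x. complex_of_real (g x))" by (intro continuous_intros g)
  have g0: "complex_of_real (g x) = 0" if "x \<notin> {c..d}" for x using g(2)[OF that] by simp
  obtain C where C: "\<And>x. cmod (of_real (g x)) \<le> C"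
    using continuous_compact_support_bounded[OF gc compact_Icc[of c d] g0] by blast
  show ?thesis
  proof (rule L2_dominated[OF _ f])
    show "(\<lambda>x. of_real (g x) * f x) \<in> borel_measurable borel"
      using borel_measurable_continuous[OF gc] L2_measurable[OF f] by measurable
    show "cmod (of_real (g x) * f x) \<le> C * cmod (f x)" for x
      unfolding norm_mult by (intro mult_right_mono C) simp
  qed (use g0 in auto)
qed

text \<open>Functions with compact support inside \<open>S\<close> lie in $H^1_0(S)$: approximate the derivative in $L^2$ by
  continuous functions of mean zero with slightly larger support and integrate.\<close>

lemma cutoff_H10:
  assumes w: "w \<in> H1 T" and \<theta>: "\<And>x. (\<theta> has_real_derivative \<theta>' x) (at x)" "continuous_on UNIV \<theta>'"
      "\<And>x. x \<notin> {c..d} \<Longrightarrow> \<theta> x = 0" "\<And>x. x \<notin> {c..d} \<Longrightarrow> \<theta>' x = 0"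
    and cd: "c \<le> d" "{c..d} \<subseteq> interior T" "{c..d} \<subseteq> interior S" and S: "interval_domain S"
  shows "(\<lambda>x. of_real (\<theta> x) * w x) \<in> H10 S"
proof -
  define z where "z x = of_real (\<theta> x) * w x" for x
  define v where "v x = of_real (\<theta>' x) * w x + of_real (\<theta> x) * weak_deriv T w x" for x
  have c\<theta>: "continuous_on UNIV \<theta>"
    using \<theta>(1) by (intro continuous_at_imp_continuous_on ballI DERIV_isCont)
  note wL = H1_L2[OF w] and dL = weak_deriv_L2[OF w]
  note mult = compact_support_mult_L2
  have zL: "z \<in> L2 {c..d}" unfolding z_def by (rule mult[OF c\<theta> \<theta>(3) wL])
  have vL: "v \<in> L2 {c..d}" unfolding v_def by (rule L2_add[OF mult[OF \<theta>(2,4) wL] mult[OF c\<theta> \<theta>(3) dL]])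
  have wdU: "is_weak_deriv UNIV z v" unfolding z_def v_def
    by (rule is_weak_deriv_cutoff[OF weak_deriv_is[OF w] wL dL \<theta>(1,2) compact_Icc cd(2) \<theta>(3)])
  have cS: "{c..d} \<subseteq> S" using cd(3) interior_subset by blast
  have zH: "z \<in> H1 S"
    by (rule H1_I[OF L2_mono[OF cS zL] L2_mono[OF cS vL] is_weak_deriv_mono[OF wdU subset_UNIV]])
  \<comment> \<open>Test the weak derivative with a plateau function that is constant on the support of \<open>z\<close>.\<close>
  have mean: "(\<integral>x. v x \<partial>lborel) = 0"
  proof -
    define \<rho> where "\<rho> = 2 * (max \<bar>c\<bar> \<bar>d\<bar> + 1)"
    have \<rho>: "\<rho> > 0" unfolding \<rho>_def by (simp add: add_nonneg_pos)
    have in\<rho>: "\<bar>x\<bar> < \<rho> / 2" if "x \<in> {c..d}" for x using that unfolding \<rho>_def by auto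
    obtain \<eta> \<eta>' :: "real \<Rightarrow> real" and B where \<eta>: "\<And>x. (\<eta> has_real_derivative \<eta>' x) (at x)" "continuous_on UNIV \<eta>'"
      "\<And>x. 0 \<le> \<eta> x" "\<And>x. \<eta> x \<le> 1"
      "\<And>x. \<bar>x\<bar> \<le> \<rho> / 2 \<Longrightarrow> \<eta> x = 1" "\<And>x. x \<notin> {-\<rho>..\<rho>} \<Longrightarrow> \<eta> x = 0"
      "\<And>x. x \<notin> {-\<rho>..\<rho>} \<Longrightarrow> \<eta>' x = 0" "\<And>x. \<bar>x\<bar> < \<rho> / 2 \<Longrightarrow> \<eta>' x = 0" "\<And>x. \<bar>\<eta>' x\<bar> \<le> B" "B \<ge> 0"
      using \<rho> by (rule C1_cutoff) (rule that)
    have "(\<integral>x. z x * of_real (\<eta>' x) \<partial>lborel) = - (\<integral>x. v x * of_real (\<eta> x) \<partial>lborel)"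
      by (rule is_weak_deriv_D[OF wdU _ _ compact_Icc[of "-\<rho>" \<rho>]])
        (use \<eta>(1,2,6) in \<open>auto intro!: has_vector_derivative_of_real continuous_intros\<close>)
    moreover have "z x * of_real (\<eta>' x) = 0" for x
      using L2_zero_off[OF zL, of x] \<eta>(8)[OF in\<rho>, of x] by (cases "x \<in> {c..d}") auto
    moreover have "v x * of_real (\<eta> x) = v x" for x
      using L2_zero_off[OF vL, of x] \<eta>(5)[of x] in\<rho>[of x] by (cases "x \<in> {c..d}") auto
    ultimately show ?thesis by simp
  qed
  obtain c' d' where c': "c' < c" "d < d'" "{c'..d'} \<subseteq> interior S"
  proof -
    have "c \<in> interior S" "d \<in> interior S" using cd by auto
    then obtain e1 e2 where e: "e1 > 0" "cball c e1 \<subseteq> interior S" "e2 > 0" "cball d e2 \<subseteq> interior S"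
      using open_interior open_contains_cball by metis
    have "x \<in> interior S" if "x \<in> {c - e1..d + e2}" for x
    proof -
      consider "x < c" | "x \<in> {c..d}" | "x > d" using that by fastforce
      then show ?thesis
      proof cases
        case 1 then have "x \<in> cball c e1" using that by (auto simp: dist_real_def)
        then show ?thesis using e by blast
      next
        case 3 then have "x \<in> cball d e2" using that by (auto simp: dist_real_def)
        then show ?thesis using e by blast
      qed (use cd in auto)
    qed
    then have "{c - e1..d + e2} \<subseteq> interior S" by blast
    then show thesis using that[of "c - e1" "d + e2"] e by simp
  qed
  have c'd': "c' < d'" using c' cd by simp
  let ?b = "\<lambda>x. complex_of_real (bump c' d' x)"
  define \<beta> where "\<beta> = (\<integral>x. bump c' d' x \<partial>lborel)"
  have \<beta>: "\<beta> > 0" unfolding \<beta>_def by (rule bump_integral_pos[OF c'd'])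
  have b0: "?b x = 0" if "x \<notin> {c'..d'}" for x using that bump_zero[of x c' d'] by auto
  have bL: "?b \<in> L2 UNIV" by (rule continuous_compact_support_L2[OF bump_cont_cplx compact_Icc subset_UNIV b0])
  have bi: "integrable lborel ?b" by (rule continuous_compact_support_integrable[OF bump_cont_cplx compact_Icc[of c' d'] b0])
  define M where "M = 1 + sqrt (d' - c') / \<beta> * l2_norm ?b"
  have M: "M > 0" unfolding M_def using \<beta> c'd' by (intro add_pos_nonneg mult_nonneg_nonneg) auto
  define A where "A = sqrt ((d' - c' + 1)\<^sup>2 + 1)"
  have A: "A > 0" unfolding A_def by (simp add: add_nonneg_pos)
  have "z \<in> H10 S"
  proof (rule H10_I[OF zH])
    fix e :: real assume e: "e > 0"
    define e' where "e' = e / (A * M)"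
    have e': "e' > 0" unfolding e'_def using e A M by simp
    obtain \<psi> where \<psi>: "continuous_on UNIV \<psi>" "\<And>x. x \<notin> {c'..d'} \<Longrightarrow> \<psi> x = 0" "l2_norm (\<lambda>x. v x - \<psi> x) < e'"
      using L2_continuous_approx[OF vL c'(1) cd(1) c'(2) e'] by blast
    have \<psi>L: "\<psi> \<in> L2 UNIV" by (rule continuous_compact_support_L2[OF \<psi>(1) compact_Icc subset_UNIV \<psi>(2)])
    have \<psi>i: "integrable lborel \<psi>" by (rule continuous_compact_support_integrable[OF \<psi>(1) compact_Icc \<psi>(2)])
    define \<gamma> where "\<gamma> = (\<integral>x. \<psi> x \<partial>lborel)"
    have dL': "(\<lambda>x. v x - \<psi> x) \<in> L2 UNIV" by (rule L2_diff[OF L2_UNIV[OF vL] \<psi>L])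
    have \<gamma>: "cmod \<gamma> \<le> sqrt (d' - c') * l2_norm (\<lambda>x. v x - \<psi> x)"
    proof -
      have vi: "integrable lborel v"
      proof -
        have "integrable lborel (\<lambda>x. indicator {c..d} x * v x)"
          by (rule L2_prod_integrable[OF indicator_L2 vL]) auto
        also have "(\<lambda>x. indicator {c..d} x * v x) = v"
          using L2_zero_off[OF vL] by (auto simp: fun_eq_iff split: split_indicator)
        finally show ?thesis .
      qed
      have "(\<integral>t. indicator {c'<..d'} t * (v t - \<psi> t) \<partial>lborel) = (\<integral>t. v t - \<psi> t \<partial>lborel)"
      proof (rule integral_cong_AE)
        show "AE t in lborel. indicator {c'<..d'} t * (v t - \<psi> t) = v t - \<psi> t"
          using AE_lborel_singleton[of c']
        proof eventually_elim
          case (elim t)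
          show ?case
          proof (cases "t \<in> {c'<..d'}")
            case False
            then have "t \<notin> {c'..d'}" "t \<notin> {c..d}" using elim c' by auto
            then show ?thesis using \<psi>(2) L2_zero_off[OF vL] by simp
          qed simp
        qed
      qed (use L2_measurable[OF dL'] in measurable)
      also have "\<dots> = - \<gamma>" using vi \<psi>i mean by (simp add: \<gamma>_def)
      finally show ?thesis using norm_integral_Ioc_le[OF dL', of c' d'] c'd' by simp
    qed
    \<comment> \<open>The approximation has mean close to zero; a multiple of a fixed bump makes it exactly zero.\<close>
    define \<psi>' where "\<psi>' x = \<psi> x - \<gamma> / of_real \<beta> * ?b x" for x
    have \<psi>'c: "continuous_on UNIV \<psi>'" unfolding \<psi>'_def by (intro continuous_intros \<psi>(1) bump_continuous)
    have \<psi>'0: "\<psi>' x = 0" if "x \<notin> {c'..d'}" for x unfolding \<psi>'_def using \<psi>(2)[OF that] b0[OF that] by simp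
    have \<psi>'m: "(\<integral>x. \<psi>' x \<partial>lborel) = 0"
      unfolding \<psi>'_def using \<psi>i bi \<beta> by (simp add: \<gamma>_def[symmetric] \<beta>_def[symmetric])
    have \<psi>'L: "\<psi>' \<in> L2 UNIV" by (rule continuous_compact_support_L2[OF \<psi>'c compact_Icc subset_UNIV \<psi>'0])
    obtain \<phi> where \<phi>: "\<And>x. (\<phi> has_vector_derivative \<psi>' x) (at x)" "\<And>x. x \<notin> {c'<..<d'} \<Longrightarrow> \<phi> x = 0"
      using continuous_zero_mean_antiderivative[OF \<psi>'c less_imp_le[OF c'd'] \<psi>'0 \<psi>'m] by blast
    have \<phi>c: "continuous_on UNIV \<phi>"
      using \<phi>(1) by (intro continuous_at_imp_continuous_on ballI) (auto intro: has_vector_derivative_continuous)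
    have \<phi>C: "\<phi> \<in> C1c (interior S)" by (rule C1c_I[OF \<phi>(1) \<psi>'c compact_Icc c'(3)]) (use \<phi>(2) in auto)
    have \<phi>L: "\<phi> \<in> L2 {c'..d'}" by (rule continuous_compact_support_L2[OF \<phi>c compact_Icc order_refl]) (use \<phi>(2) in auto)
    have zL': "z \<in> L2 {c'..d'}" by (rule L2_mono[OF _ zL]) (use c' in auto)
    have vL': "v \<in> L2 {c'..d'}" by (rule L2_mono[OF _ vL]) (use c' in auto)
    have \<psi>'L': "\<psi>' \<in> L2 {c'..d'}" by (rule continuous_compact_support_L2[OF \<psi>'c compact_Icc order_refl \<psi>'0])
    have wd: "is_weak_deriv UNIV (\<lambda>x. z x - \<phi> x) (\<lambda>x. v x - \<psi>' x)"
      using is_weak_deriv_comb[OF wdU is_weak_deriv_classical[OF \<phi>(1) \<psi>'c] L2_UNIV[OF zL] L2_UNIV[OF vL] L2_UNIV[OF \<phi>L] \<psi>'L, of "-1"]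
      by simp
    have vd: "l2_norm (\<lambda>x. v x - \<psi>' x) \<le> M * l2_norm (\<lambda>x. v x - \<psi> x)"
    proof -
      have "l2_norm (\<lambda>x. v x - \<psi>' x) = l2_norm (\<lambda>x. (v x - \<psi> x) + \<gamma> / of_real \<beta> * ?b x)"
        unfolding \<psi>'_def by (simp add: algebra_simps)
      also have "\<dots> \<le> l2_norm (\<lambda>x. v x - \<psi> x) + cmod \<gamma> / \<beta> * l2_norm ?b"
      proof -
        have "l2_norm (\<lambda>x. \<gamma> / of_real \<beta> * ?b x) = cmod \<gamma> / \<beta> * l2_norm ?b"
          unfolding l2_norm_cmult using \<beta> by (simp add: norm_divide)
        then show ?thesis using l2_norm_triangle[OF dL' L2_cmult[OF bL, of "\<gamma> / of_real \<beta>"]] by simp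
      qed
      also have "\<dots> \<le> l2_norm (\<lambda>x. v x - \<psi> x) + sqrt (d' - c') * l2_norm (\<lambda>x. v x - \<psi> x) / \<beta> * l2_norm ?b"
        by (intro add_left_mono mult_right_mono divide_right_mono \<gamma>) (use \<beta> in auto)
      finally show ?thesis unfolding M_def by (simp add: algebra_simps)
    qed
    have y: "l2_norm (\<lambda>x. z x - \<phi> x) \<le> (d' - c' + 1) * l2_norm (\<lambda>x. v x - \<psi>' x)"
      by (rule poincare_compact_support[OF L2_diff[OF zL' \<phi>L] L2_diff[OF L2_UNIV[OF vL] \<psi>'L] wd less_imp_le[OF c'd']])
    have c'S: "{c'..d'} \<subseteq> S" using c'(3) interior_subset by blast
    have "h1_norm S (\<lambda>x. z x - \<phi> x) = sqrt ((l2_norm (\<lambda>x. z x - \<phi> x))\<^sup>2 + (l2_norm (\<lambda>x. v x - \<psi>' x))\<^sup>2)"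
      by (rule h1_norm_eq[OF S L2_mono[OF c'S L2_diff[OF zL' \<phi>L]] L2_mono[OF c'S L2_diff[OF vL' \<psi>'L']]
            is_weak_deriv_mono[OF wd subset_UNIV]])
    also have "\<dots> \<le> sqrt (((d' - c' + 1) * l2_norm (\<lambda>x. v x - \<psi>' x))\<^sup>2 + (l2_norm (\<lambda>x. v x - \<psi>' x))\<^sup>2)"
      by (intro real_sqrt_le_mono add_right_mono power_mono y) simp
    also have "\<dots> = sqrt (((d' - c' + 1)\<^sup>2 + 1) * (l2_norm (\<lambda>x. v x - \<psi>' x))\<^sup>2)"
      by (subst power_mult_distrib) (simp only: distrib_right mult_1)
    also have "\<dots> = A * l2_norm (\<lambda>x. v x - \<psi>' x)" unfolding A_def by (simp add: real_sqrt_mult)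
    also have "\<dots> \<le> A * (M * l2_norm (\<lambda>x. v x - \<psi> x))" by (intro mult_left_mono vd) (use A in simp)
    also have "\<dots> < A * (M * e')" using \<psi>(3) A M by (intro mult_strict_left_mono) auto
    also have "\<dots> = e" unfolding e'_def using A M by simp
    finally show "\<exists>\<phi>. \<phi> \<in> C1c (interior S) \<and> h1_norm S (\<lambda>x. z x - \<phi> x) < e" using \<phi>C by blast
  qed
  then show ?thesis unfolding z_def .
qed


section \<open>A priori estimates\<close>

text \<open>An $H^1$ function changes by at most $\sqrt{r}\,\|u'\|$ over a distance \<open>r\<close>. Averaging this inequality over
  suitable points gives all estimates below.\<close>

lemma sq_norm_le_shift:
  assumes "v \<in> L2 S" "\<bar>x - y\<bar> \<le> r"
  shows "(cmod (primitive v x + k))\<^sup>2 \<le> 2 * (cmod (primitive v y + k))\<^sup>2 + 2 * r * (l2_norm v)\<^sup>2"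
proof -
  have r: "r \<ge> 0" using assms(2) by simp
  have "(cmod (primitive v x + k))\<^sup>2 = (cmod ((primitive v y + k) + (primitive v x - primitive v y)))\<^sup>2"
    by (simp add: algebra_simps)
  also have "\<dots> \<le> 2 * (cmod (primitive v y + k))\<^sup>2 + 2 * (cmod (primitive v x - primitive v y))\<^sup>2"
    by (rule sq_norm_add_le)
  also have "(cmod (primitive v x - primitive v y))\<^sup>2 \<le> (sqrt r * l2_norm v)\<^sup>2"
  proof (rule power_mono)
    have "cmod (primitive v x - primitive v y) \<le> sqrt \<bar>x - y\<bar> * l2_norm v" by (rule primitive_diff_le[OF assms(1)])
    also have "\<dots> \<le> sqrt r * l2_norm v" using assms(2) by (intro mult_right_mono real_sqrt_le_mono) auto
    finally show "cmod (primitive v x - primitive v y) \<le> sqrt r * l2_norm v" .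
  qed simp
  also have "(sqrt r * l2_norm v)\<^sup>2 = r * (l2_norm v)\<^sup>2" using r by (simp add: power_mult_distrib)
  finally show ?thesis by simp
qed

lemma integrable_indicator_Icc [simp]: "integrable lborel (indicator {p..q::real} :: real \<Rightarrow> real)"
  by (cases "p \<le> q") (auto intro!: integrable_real_indicator)

lemma integrable_indicator_sq:
  assumes "u \<in> L2 S" "A \<in> sets borel"
  shows "integrable lborel (\<lambda>x. indicator A x * (cmod (u x))\<^sup>2)"
  by (rule Bochner_Integration.integrable_bound[OF L2_sq_integrable[OF assms(1)]])
    (use assms L2_measurable[OF assms(1)] in \<open>auto split: split_indicator\<close>)

lemma integral_indicator_sq_le:
  assumes "u \<in> L2 S" "A \<in> sets borel"
  shows "(\<integral>x. indicator A x * (cmod (u x))\<^sup>2 \<partial>lborel) \<le> (l2_norm u)\<^sup>2"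
  unfolding l2_norm_sq
  by (rule integral_mono[OF integrable_indicator_sq[OF assms] L2_sq_integrable[OF assms(1)]])
    (auto split: split_indicator)

text \<open>The Sobolev inequality on an interval of length \<open>r\<close>, with the dependence on \<open>r\<close>: average the
  bound of \<open>sq_norm_le_shift\<close> over the interval.\<close>

lemma sobolev_sup_bound:
  assumes S: "interval_domain S" and u: "u \<in> H1 S" and r: "r > 0"
    and J: "\<And>x. x \<in> S \<Longrightarrow> \<exists>s. s \<le> x \<and> x \<le> s + r \<and> {s..s+r} \<subseteq> S"
  shows "AE x in lborel. (cmod (u x))\<^sup>2 \<le> 2 / r * (l2_norm u)\<^sup>2 + 2 * r * (l2_norm (weak_deriv S u))\<^sup>2"
proof -
  let ?v = "weak_deriv S u"
  note uL = H1_L2[OF u] and vL = weak_deriv_L2[OF u]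
  obtain k where k: "AE x in lborel. x \<in> S \<longrightarrow> u x = primitive ?v x + k"
    using weak_deriv_representative[OF S uL vL weak_deriv_is[OF u]] by blast
  show ?thesis using k
  proof eventually_elim
    case (elim x)
    show ?case
    proof (cases "x \<in> S")
      case False
      then show ?thesis using L2_zero_off[OF uL False] r by simp
    next
      case True
      from J[OF True] obtain s where s: "s \<le> x" "x \<le> s + r" "{s..s+r} \<subseteq> S" by blast
      have "r * (cmod (u x))\<^sup>2 = (\<integral>y. indicator {s..s+r} y * (cmod (u x))\<^sup>2 \<partial>lborel)"
        using r by simp
      also have "\<dots> \<le> (\<integral>y. 2 * (indicator {s..s+r} y * (cmod (u y))\<^sup>2) + indicator {s..s+r} y * (2 * r * (l2_norm ?v)\<^sup>2) \<partial>lborel)"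
      proof (rule integral_mono_AE)
        show "integrable lborel (\<lambda>y. indicator {s..s+r} y * (cmod (u x))\<^sup>2)"
          by simp
        show "integrable lborel (\<lambda>y. 2 * (indicator {s..s+r} y * (cmod (u y))\<^sup>2) + indicator {s..s+r} y * (2 * r * (l2_norm ?v)\<^sup>2))"
          using integrable_indicator_sq[OF uL, of "{s..s+r}"] by (intro Bochner_Integration.integrable_add integrable_mult_right) auto
        show "AE y in lborel. indicator {s..s+r} y * (cmod (u x))\<^sup>2
            \<le> 2 * (indicator {s..s+r} y * (cmod (u y))\<^sup>2) + indicator {s..s+r} y * (2 * r * (l2_norm ?v)\<^sup>2)"
          using k
        proof eventually_elim
          fix y assume y: "y \<in> S \<longrightarrow> u y = primitive ?v y + k"
          show "indicator {s..s+r} y * (cmod (u x))\<^sup>2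
            \<le> 2 * (indicator {s..s+r} y * (cmod (u y))\<^sup>2) + indicator {s..s+r} y * (2 * r * (l2_norm ?v)\<^sup>2)"
          proof (cases "y \<in> {s..s+r}")
            case yes: True
            then have "u y = primitive ?v y + k" using y s by blast
            moreover have "u x = primitive ?v x + k" using elim True by blast
            moreover have "\<bar>x - y\<bar> \<le> r" using s yes by auto
            ultimately show ?thesis using sq_norm_le_shift[OF vL, of x y r k] yes by simp
          qed simp
        qed
      qed
      also have "\<dots> = 2 * (\<integral>y. indicator {s..s+r} y * (cmod (u y))\<^sup>2 \<partial>lborel) + r * (2 * r * (l2_norm ?v)\<^sup>2)"
        using integrable_indicator_sq[OF uL, of "{s..s+r}"] r by simp
      also have "\<dots> \<le> 2 * (l2_norm u)\<^sup>2 + r * (2 * r * (l2_norm ?v)\<^sup>2)"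
        using integral_indicator_sq_le[OF uL, of "{s..s+r}"] by simp
      finally have "r * (cmod (u x))\<^sup>2 \<le> r * (2 / r * (l2_norm u)\<^sup>2 + 2 * r * (l2_norm ?v)\<^sup>2)"
        using r by (simp add: algebra_simps)
      then show ?thesis using r by simp
    qed
  qed
qed

text \<open>The mass of \<open>u\<close> in $[-r,r]$ is controlled by its mass in the translated interval $[r,3r]$ and by
  the derivative.\<close>

lemma poincare_shift:
  assumes S: "interval_domain S" and u: "u \<in> H1 S" and r: "r > 0" and sub: "{-r..3*r} \<subseteq> S"
  shows "(\<integral>x. indicator {-r..r} x * (cmod (u x))\<^sup>2 \<partial>lborel)
    \<le> 2 * (\<integral>x. indicator {r..3*r} x * (cmod (u x))\<^sup>2 \<partial>lborel) + 8 * r\<^sup>2 * (l2_norm (weak_deriv S u))\<^sup>2"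
proof -
  let ?v = "weak_deriv S u"
  note uL = H1_L2[OF u] and vL = weak_deriv_L2[OF u]
  obtain k where k: "AE x in lborel. x \<in> S \<longrightarrow> u x = primitive ?v x + k"
    using weak_deriv_representative[OF S uL vL weak_deriv_is[OF u]] by blast
  define U where "U x = primitive ?v x + k" for x
  have Uc: "continuous_on UNIV U" unfolding U_def by (intro continuous_intros primitive_continuous[OF vL])
  note [measurable] = borel_measurable_continuous[OF Uc] L2_measurable[OF uL]
  have eq: "(\<integral>x. indicator {p..q} x * (cmod (u x))\<^sup>2 \<partial>lborel) = (\<integral>x. indicator {p..q} x * (cmod (U x))\<^sup>2 \<partial>lborel)"
    if "{p..q} \<subseteq> S" for p q
  proof (rule integral_cong_AE)
    show "AE x in lborel. indicator {p..q} x * (cmod (u x))\<^sup>2 = indicator {p..q} x * (cmod (U x))\<^sup>2"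
      using k by eventually_elim (use that in \<open>auto simp: U_def split: split_indicator\<close>)
  qed measurable
  have i: "integrable lborel (\<lambda>x. indicator {p..q} x * (cmod (U x))\<^sup>2)" for p q
  proof -
    have "continuous_on {p..q} (\<lambda>x. (cmod (U x))\<^sup>2)"
      by (intro continuous_intros continuous_on_subset[OF Uc]) simp
    then show ?thesis using borel_integrable_compact[of "{p..q}" "\<lambda>x. (cmod (U x))\<^sup>2"] by simp
  qed
  have tr: "(\<integral>x. indicator {r..3*r} x * (cmod (U x))\<^sup>2 \<partial>lborel) = (\<integral>x. indicator {-r..r} x * (cmod (U (2 * r + x)))\<^sup>2 \<partial>lborel)"
  proof -
    have "(\<integral>x. indicator {r..3*r} x * (cmod (U x))\<^sup>2 \<partial>lborel)
        = \<bar>1\<bar> *\<^sub>R (\<integral>x. indicator {r..3*r} (2 * r + 1 * x) * (cmod (U (2 * r + 1 * x)))\<^sup>2 \<partial>lborel)"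
      by (rule lborel_integral_real_affine) simp
    also have "(\<lambda>x. indicator {r..3*r} (2 * r + 1 * x) :: real) = indicator {-r..r}"
      by (auto simp: fun_eq_iff split: split_indicator)
    finally show ?thesis by simp
  qed
  have i2: "integrable lborel (\<lambda>x. indicator {-r..r} x * (cmod (U (2 * r + x)))\<^sup>2)"
  proof -
    have "integrable lborel (\<lambda>x. indicator {r..3*r} (2 * r + 1 * x) * (cmod (U (2 * r + 1 * x)))\<^sup>2)"
      by (rule lborel_integrable_real_affine[OF i]) simp
    also have "(\<lambda>x. indicator {r..3*r} (2 * r + 1 * x) * (cmod (U (2 * r + 1 * x)))\<^sup>2)
        = (\<lambda>x. indicator {-r..r} x * (cmod (U (2 * r + x)))\<^sup>2)"
      by (auto simp: fun_eq_iff split: split_indicator)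
    finally show ?thesis .
  qed
  have "(\<integral>x. indicator {-r..r} x * (cmod (U x))\<^sup>2 \<partial>lborel)
      \<le> (\<integral>x. 2 * (indicator {-r..r} x * (cmod (U (2 * r + x)))\<^sup>2) + indicator {-r..r} x * (2 * (2 * r) * (l2_norm ?v)\<^sup>2) \<partial>lborel)"
  proof (rule integral_mono[OF i])
    show "integrable lborel (\<lambda>x. 2 * (indicator {-r..r} x * (cmod (U (2 * r + x)))\<^sup>2) + indicator {-r..r} x * (2 * (2 * r) * (l2_norm ?v)\<^sup>2))"
      using i2 by (intro Bochner_Integration.integrable_add integrable_mult_right) auto
    show "indicator {-r..r} x * (cmod (U x))\<^sup>2
        \<le> 2 * (indicator {-r..r} x * (cmod (U (2 * r + x)))\<^sup>2) + indicator {-r..r} x * (2 * (2 * r) * (l2_norm ?v)\<^sup>2)" for x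
      using sq_norm_le_shift[OF vL, of x "2 * r + x" "2 * r" k] r unfolding U_def by (auto split: split_indicator)
  qed
  also have "\<dots> = 2 * (\<integral>x. indicator {-r..r} x * (cmod (U (2 * r + x)))\<^sup>2 \<partial>lborel) + 2 * r * (2 * (2 * r) * (l2_norm ?v)\<^sup>2)"
    using i2 r by simp
  finally show ?thesis
    using sub r unfolding eq[of "-r" r, OF order_trans[OF _ sub], simplified] tr[symmetric]
    by (subst eq) (auto simp: power2_eq_square eq)
qed

context schroedinger begin

lemma potential_mass_bound:
  assumes u: "u \<in> form_dom" and A: "A \<in> sets borel" and k: "k > 0" "\<And>x. x \<in> S \<Longrightarrow> x \<in> A \<Longrightarrow> V x \<ge> k"
  shows "(\<integral>x. indicator A x * (cmod (u x))\<^sup>2 \<partial>lborel) \<le> 1 / k * (l2_norm (root_mult u))\<^sup>2"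
proof -
  have "(\<integral>x. indicator A x * (cmod (u x))\<^sup>2 \<partial>lborel) \<le> (\<integral>x. 1 / k * (cmod (root_mult u x))\<^sup>2 \<partial>lborel)"
  proof (rule integral_mono[OF integrable_indicator_sq[OF form_dom_L2[OF u] A]])
    show "integrable lborel (\<lambda>x. 1 / k * (cmod (root_mult u x))\<^sup>2)"
      using L2_sq_integrable[OF root_mult_L2[OF u]] by simp
    show "indicator A x * (cmod (u x))\<^sup>2 \<le> 1 / k * (cmod (root_mult u x))\<^sup>2" for x
    proof (cases "x \<in> S \<and> x \<in> A")
      case True
      then have "k * (cmod (u x))\<^sup>2 \<le> V x * (cmod (u x))\<^sup>2" using k by (intro mult_right_mono) auto
      then show ?thesis using True k unfolding norm_root_mult_sq by (simp add: field_simps)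
    next
      case False
      then show ?thesis using L2_zero_off[OF form_dom_L2[OF u], of x] k
        by (auto split: split_indicator)
    qed
  qed
  then show ?thesis by (simp add: l2_norm_sq)
qed

text \<open>The lowest eigenvalue is at least of order $r^{-2}$ if the potential is at least of order $r^{-2}$
  at distance \<open>r\<close> and more from the origin.\<close>

lemma energy_coercive:
  assumes u: "u \<in> form_dom" and r: "r > 0" "{-r..3*r} \<subseteq> S" and \<kappa>: "\<kappa> > 0"
    and V: "\<And>x. x \<in> S \<Longrightarrow> \<bar>x\<bar> \<ge> r \<Longrightarrow> V x \<ge> \<kappa> / r\<^sup>2"
  shows "(l2_norm u)\<^sup>2 \<le> (8 + 3 / \<kappa>) * r\<^sup>2 * energy u"
proof -
  note uL = form_dom_L2[OF u]
  let ?q = "(l2_norm (root_mult u))\<^sup>2" and ?p = "(l2_norm (weak_deriv S u))\<^sup>2"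
  have kr: "\<kappa> / r\<^sup>2 > 0" using \<kappa> r by simp
  have a: "(\<integral>x. indicator {r..3*r} x * (cmod (u x))\<^sup>2 \<partial>lborel) \<le> r\<^sup>2 / \<kappa> * ?q"
    using potential_mass_bound[OF u _ kr, of "{r..3*r}"] V r by simp
  have b: "(\<integral>x. indicator (- {-r..r}) x * (cmod (u x))\<^sup>2 \<partial>lborel) \<le> r\<^sup>2 / \<kappa> * ?q"
    using potential_mass_bound[OF u _ kr, of "- {-r..r}"] V r by force
  have "(l2_norm u)\<^sup>2 = (\<integral>x. indicator {-r..r} x * (cmod (u x))\<^sup>2 + indicator (- {-r..r}) x * (cmod (u x))\<^sup>2 \<partial>lborel)"
    unfolding l2_norm_sq by (intro Bochner_Integration.integral_cong) (auto split: split_indicator)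
  also have "\<dots> = (\<integral>x. indicator {-r..r} x * (cmod (u x))\<^sup>2 \<partial>lborel) + (\<integral>x. indicator (- {-r..r}) x * (cmod (u x))\<^sup>2 \<partial>lborel)"
    by (rule Bochner_Integration.integral_add[OF integrable_indicator_sq[OF uL] integrable_indicator_sq[OF uL]]) auto
  also have "\<dots> \<le> (2 * (r\<^sup>2 / \<kappa> * ?q) + 8 * r\<^sup>2 * ?p) + r\<^sup>2 / \<kappa> * ?q"
    using poincare_shift[OF dom form_dom_H1[OF u] r] a b by linarith
  also have "\<dots> \<le> (8 + 3 / \<kappa>) * r\<^sup>2 * energy u"
    unfolding energy_def using \<kappa> by (simp add: algebra_simps)
  finally show ?thesis .
qed

text \<open>Testing the equation with its solution gives \<open>energy u = Re \<langle>f, u\<rangle>\<close>, which coercivity turns into bounds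
  by the right hand side.\<close>

lemma form_op_bounds:
  assumes uf: "(u, f) \<in> form_op S V D" and D: "D \<subseteq> form_dom" and C: "C > 0"
    and coercive: "(l2_norm u)\<^sup>2 \<le> C * energy u"
  shows "l2_norm u \<le> C * l2_norm f" and "energy u \<le> C * (l2_norm f)\<^sup>2"
proof -
  have u: "u \<in> D" "u \<in> form_dom" and f: "f \<in> L2 S" and eq: "schroed_form S V u u = l2_inner f u"
    using uf D unfolding form_op_def by auto
  have "energy u = Re (l2_inner f u)" using eq schroed_form_self[OF u(2)] by (metis Re_complex_of_real)
  also have "\<dots> \<le> l2_norm f * l2_norm u"
    using complex_Re_le_cmod norm_l2_inner_le[OF f form_dom_L2[OF u(2)]] by (rule order_trans)
  finally have e: "energy u \<le> l2_norm f * l2_norm u" .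
  show b: "l2_norm u \<le> C * l2_norm f"
  proof (cases "l2_norm u = 0")
    case True
    then show ?thesis using C by simp
  next
    case False
    then have p: "l2_norm u > 0" using L2_norm_nonneg[of u] by linarith
    have "l2_norm u * l2_norm u \<le> C * energy u" using coercive by (simp add: power2_eq_square)
    also have "\<dots> \<le> C * (l2_norm f * l2_norm u)" using e C by (intro mult_left_mono) auto
    finally have "l2_norm u * l2_norm u \<le> (C * l2_norm f) * l2_norm u" by (simp add: mult_ac)
    then show ?thesis using p by simp
  qed
  have "energy u \<le> l2_norm f * (C * l2_norm f)" using e b
    by (meson L2_norm_nonneg mult_left_mono order_trans)
  then show "energy u \<le> C * (l2_norm f)\<^sup>2" by (simp add: power2_eq_square mult_ac)
qed

end


section \<open>Comparison of two Schroedinger operators\<close>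

text \<open>The operator on \<open>S\<close> with potential \<open>V\<close> and domain \<open>D\<close> is compared with the operator on the line
  with potential \<open>W\<close>. Inside $[-\rho,\rho]$ the potentials agree up to the relative error \<open>\<eta>\<close> and the
  integrable error \<open>G\<close>; the cutoff \<open>\<theta>\<close> moves functions between the two form domains, whatever the
  boundary conditions in \<open>D\<close> are.\<close>

locale schroedinger_comparison =
  Q: schroedinger S V + H: schroedinger UNIV W for S V W +
  fixes D :: "(real \<Rightarrow> complex) set" and \<theta> \<theta>' G :: "real \<Rightarrow> real" and \<rho> B \<eta> :: real
  assumes D: "D \<subseteq> Q.form_dom" "H10 S \<subseteq> D"
    and S_sets: "S \<in> sets borel"
    and \<rho>: "\<rho> > 0" "{-\<rho>..\<rho>} \<subseteq> interior S"
    and \<theta>_deriv: "\<And>x. (\<theta> has_real_derivative \<theta>' x) (at x)" and \<theta>'_cont: "continuous_on UNIV \<theta>'"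
    and \<theta>_bounds: "\<And>x. 0 \<le> \<theta> x" "\<And>x. \<theta> x \<le> 1"
    and \<theta>_one: "\<And>x. \<bar>x\<bar> \<le> \<rho> / 2 \<Longrightarrow> \<theta> x = 1"
    and \<theta>_off: "\<And>x. x \<notin> {-\<rho>..\<rho>} \<Longrightarrow> \<theta> x = 0" and \<theta>'_off: "\<And>x. x \<notin> {-\<rho>..\<rho>} \<Longrightarrow> \<theta>' x = 0"
    and \<theta>'_in: "\<And>x. \<bar>x\<bar> < \<rho> / 2 \<Longrightarrow> \<theta>' x = 0" and \<theta>'_bound: "\<And>x. \<bar>\<theta>' x\<bar> \<le> B"
    and \<eta>: "\<eta> \<ge> 0"
    and VW: "\<And>x. x \<in> {-\<rho>..\<rho>} \<Longrightarrow> \<bar>W x - V x\<bar> \<le> \<eta> * W x + G x"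
      "\<And>x. x \<in> {-\<rho>..\<rho>} \<Longrightarrow> W x \<le> 2 * V x"
    and G: "integrable lborel G" "\<And>x. G x \<ge> 0"
begin

text \<open>The part of a function where the cutoff may differ from \<open>1\<close>, and which contains the support of \<open>\<theta>'\<close>.\<close>

definition outside :: "(real \<Rightarrow> complex) \<Rightarrow> real \<Rightarrow> complex" where
  "outside u x = indicator {x. \<bar>x\<bar> \<ge> \<rho> / 2} x * u x"

lemma outside_sets [measurable, simp]: "{x::real. \<bar>x\<bar> \<ge> \<rho> / 2} \<in> sets borel"
  by measurable

lemma outside_L2: "u \<in> L2 T \<Longrightarrow> outside u \<in> L2 UNIV"
  unfolding outside_def[abs_def]
  by (rule L2_dominated[where C = 1]) (auto simp: L2_measurable norm_mult split: split_indicator)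

lemma outside_norm: "(l2_norm (outside u))\<^sup>2 = (\<integral>x. indicator {x. \<bar>x\<bar> \<ge> \<rho> / 2} x * (cmod (u x))\<^sup>2 \<partial>lborel)"
  unfolding l2_norm_sq outside_def
  by (intro Bochner_Integration.integral_cong) (auto split: split_indicator)

lemma cut_cont: "continuous_on UNIV \<theta>"
  using \<theta>_deriv by (intro continuous_at_imp_continuous_on ballI DERIV_isCont)

lemma rho_S: "{-\<rho>..\<rho>} \<subseteq> S"
  using \<rho>(2) interior_subset by blast

lemma cut_weak_deriv:
  assumes u: "u \<in> H1 T" and T: "{-\<rho>..\<rho>} \<subseteq> interior T"
  shows "(\<lambda>x. of_real (\<theta> x) * u x) \<in> L2 {-\<rho>..\<rho>}"
    and "(\<lambda>x. of_real (\<theta>' x) * u x + of_real (\<theta> x) * weak_deriv T u x) \<in> L2 {-\<rho>..\<rho>}"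
    and "is_weak_deriv R (\<lambda>x. of_real (\<theta> x) * u x) (\<lambda>x. of_real (\<theta>' x) * u x + of_real (\<theta> x) * weak_deriv T u x)"
proof -
  show "(\<lambda>x. of_real (\<theta> x) * u x) \<in> L2 {-\<rho>..\<rho>}"
    by (rule compact_support_mult_L2[OF cut_cont \<theta>_off H1_L2[OF u]])
  show "(\<lambda>x. of_real (\<theta>' x) * u x + of_real (\<theta> x) * weak_deriv T u x) \<in> L2 {-\<rho>..\<rho>}"
    by (rule L2_add[OF compact_support_mult_L2[OF \<theta>'_cont \<theta>'_off H1_L2[OF u]]
          compact_support_mult_L2[OF cut_cont \<theta>_off weak_deriv_L2[OF u]]])
  show "is_weak_deriv R (\<lambda>x. of_real (\<theta> x) * u x) (\<lambda>x. of_real (\<theta>' x) * u x + of_real (\<theta> x) * weak_deriv T u x)"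
    by (rule is_weak_deriv_cutoff[OF weak_deriv_is[OF u] H1_L2[OF u] weak_deriv_L2[OF u] \<theta>_deriv \<theta>'_cont compact_Icc T \<theta>_off])
qed

text \<open>On the support of the cutoff \<open>W\<close> is at most \<open>2 V\<close>, so finite energy carries over.\<close>

lemma cut_in_H:
  assumes u: "u \<in> Q.form_dom" shows "(\<lambda>x. of_real (\<theta> x) * u x) \<in> H.form_dom"
proof (rule H.form_dom_I)
  note c = cut_weak_deriv[OF Q.form_dom_H1[OF u] \<rho>(2)]
  show "(\<lambda>x. of_real (\<theta> x) * u x) \<in> H1 UNIV" by (rule H1_I[OF L2_UNIV[OF c(1)] L2_UNIV[OF c(2)] c(3)])
  show "H.root_mult (\<lambda>x. of_real (\<theta> x) * u x) \<in> L2 UNIV"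
  proof (rule L2_dominated[OF _ Q.root_mult_L2[OF u]])
    show "H.root_mult (\<lambda>x. of_real (\<theta> x) * u x) \<in> borel_measurable borel"
      unfolding H.root_mult_def[abs_def] using L2_measurable[OF c(1)] by measurable
    show "cmod (H.root_mult (\<lambda>x. of_real (\<theta> x) * u x) x) \<le> sqrt 2 * cmod (Q.root_mult u x)" for x
    proof (cases "x \<in> {-\<rho>..\<rho>}")
      case True
      have "sqrt (W x) \<le> sqrt 2 * sqrt (V x)"
        using VW(2)[OF True] by (metis real_sqrt_le_mono real_sqrt_mult)
      then have "sqrt (W x) * (\<theta> x * cmod (u x)) \<le> sqrt 2 * sqrt (V x) * (1 * cmod (u x))"
        using \<theta>_bounds[of x] H.V_nonneg[of x] Q.V_nonneg[of x] by (intro mult_mono mult_right_mono) auto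
      then show ?thesis unfolding H.root_mult_def Q.root_mult_def
        using \<theta>_bounds[of x] H.V_nonneg[of x] Q.V_nonneg[of x] by (simp add: norm_mult mult_ac)
    qed (simp add: \<theta>_off H.root_mult_def)
  qed auto
qed

text \<open>The cut off function vanishes near the boundary of \<open>S\<close>, so it satisfies the Dirichlet condition, and
  therefore lies in \<open>D\<close>.\<close>

lemma cut_in_D:
  assumes w: "w \<in> H.form_dom" shows "(\<lambda>x. of_real (\<theta> x) * w x) \<in> D"
proof -
  have T: "{-\<rho>..\<rho>} \<subseteq> interior UNIV" by simp
  have "(\<lambda>x. of_real (\<theta> x) * w x) \<in> H10 S"
    by (rule cutoff_H10[OF H.form_dom_H1[OF w] \<theta>_deriv \<theta>'_cont \<theta>_off \<theta>'_off _ T \<rho>(2) Q.dom])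
      (use \<rho>(1) in auto)
  then show ?thesis using D(2) by blast
qed

text \<open>The core identity: testing each equation with the cut off solution of the other one, all terms
  cancel but those with derivatives of the cutoff and the difference of the potentials.\<close>

lemma form_difference_bound:
  assumes u: "u \<in> Q.form_dom" and w: "w \<in> H.form_dom"
    and su: "AE x in lborel. cmod (u x) \<le> su" and sw: "AE x in lborel. cmod (w x) \<le> sw" and s: "su \<ge> 0" "sw \<ge> 0"
  shows "cmod (schroed_form UNIV W (\<lambda>x. of_real (\<theta> x) * u x) w - schroed_form S V u (\<lambda>x. of_real (\<theta> x) * w x))
    \<le> B * (l2_norm (outside u) * l2_norm (weak_deriv UNIV w)) + B * (l2_norm (weak_deriv S u) * l2_norm (outside w))
      + 2 * \<eta> * (l2_norm (Q.root_mult u) * l2_norm (H.root_mult w)) + su * sw * (\<integral>x. G x \<partial>lborel)"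
proof -
  let ?u0 = "\<lambda>x. of_real (\<theta> x) * u x" and ?w0 = "\<lambda>x. of_real (\<theta> x) * w x"
  let ?du = "weak_deriv S u" and ?dw = "weak_deriv UNIV w"
  let ?eu = "weak_deriv UNIV ?u0" and ?ew = "weak_deriv S ?w0"
  have u0: "?u0 \<in> H.form_dom" by (rule cut_in_H[OF u])
  have w0: "?w0 \<in> Q.form_dom" using cut_in_D[OF w] D(1) by blast
  note uH = Q.form_dom_H1[OF u] and wH = H.form_dom_H1[OF w]
  note uL = H1_L2[OF uH] and wL = H1_L2[OF wH] and duL = weak_deriv_L2[OF uH] and dwL = weak_deriv_L2[OF wH]
  note cu = cut_weak_deriv[OF uH \<rho>(2)]
  have T: "{-\<rho>..\<rho>} \<subseteq> interior UNIV" by simp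
  note cw = cut_weak_deriv[OF wH T]
  have du0: "AE x in lborel. ?eu x = of_real (\<theta>' x) * u x + of_real (\<theta> x) * ?du x"
    by (rule weak_deriv_AE_eq[OF interval_domain_UNIV L2_UNIV[OF cu(1)] L2_UNIV[OF cu(2)] cu(3)])
  have dw0: "AE x in lborel. ?ew x = of_real (\<theta>' x) * w x + of_real (\<theta> x) * ?dw x"
    by (rule weak_deriv_AE_eq[OF Q.dom L2_mono[OF rho_S cw(1)] L2_mono[OF rho_S cw(2)] cw(3)])
  let ?a = "\<lambda>x. ?eu x * cnj (?dw x) + of_real (W x) * ?u0 x * cnj (w x)"
  let ?b = "\<lambda>x. ?du x * cnj (?ew x) + of_real (V x) * u x * cnj (?w0 x)"
  have ia: "integrable lborel ?a"
  proof -
    have "complex_of_real (W x) = of_real (sqrt (W x)) * of_real (sqrt (W x))" for x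
      using H.V_nonneg[of x] by (simp flip: of_real_mult)
    then have *: "of_real (W x) * ?u0 x * cnj (w x) = H.root_mult ?u0 x * cnj (H.root_mult w x)" for x
      unfolding H.root_mult_def by (simp add: mult_ac)
    show ?thesis unfolding *
      by (intro Bochner_Integration.integrable_add L2_inner_integrable[OF weak_deriv_L2[OF H.form_dom_H1[OF u0]] dwL]
          L2_inner_integrable[OF H.root_mult_L2[OF u0] H.root_mult_L2[OF w]])
  qed
  have ib: "integrable lborel ?b"
  proof -
    have "complex_of_real (V x) = of_real (sqrt (V x)) * of_real (sqrt (V x))" for x
      using Q.V_nonneg[of x] by (simp flip: of_real_mult)
    then have *: "of_real (V x) * u x * cnj (?w0 x) = Q.root_mult u x * cnj (Q.root_mult ?w0 x)" for x
      unfolding Q.root_mult_def by (simp add: mult_ac)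
    show ?thesis unfolding *
      by (intro Bochner_Integration.integrable_add L2_inner_integrable[OF duL weak_deriv_L2[OF Q.form_dom_H1[OF w0]]]
          L2_inner_integrable[OF Q.root_mult_L2[OF u] Q.root_mult_L2[OF w0]])
  qed
  let ?g = "\<lambda>x. B * (cmod (outside u x) * cmod (?dw x)) + B * (cmod (?du x) * cmod (outside w x))
      + 2 * \<eta> * (cmod (Q.root_mult u x) * cmod (H.root_mult w x)) + su * sw * G x"
  have B: "B \<ge> 0" using \<theta>'_bound[of 0] by linarith
  have i1: "integrable lborel (\<lambda>x. cmod (outside u x) * cmod (?dw x))" by (rule L2_norm_prod_integrable[OF outside_L2[OF uL] dwL])
  have i2: "integrable lborel (\<lambda>x. cmod (?du x) * cmod (outside w x))" by (rule L2_norm_prod_integrable[OF duL outside_L2[OF wL]])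
  have i3: "integrable lborel (\<lambda>x. cmod (Q.root_mult u x) * cmod (H.root_mult w x))"
    by (rule L2_norm_prod_integrable[OF Q.root_mult_L2[OF u] H.root_mult_L2[OF w]])
  have pointwise: "AE x in lborel. norm (?a x - ?b x) \<le> ?g x"
    using du0 dw0 su sw
  proof eventually_elim
    fix x
    assume du0: "?eu x = of_real (\<theta>' x) * u x + of_real (\<theta> x) * ?du x"
      and dw0: "?ew x = of_real (\<theta>' x) * w x + of_real (\<theta> x) * ?dw x"
      and su: "cmod (u x) \<le> su" and sw: "cmod (w x) \<le> sw"
    have split: "?a x - ?b x = of_real (\<theta>' x) * (u x * cnj (?dw x)) - of_real (\<theta>' x) * (?du x * cnj (w x))
        + of_real ((W x - V x) * \<theta> x) * (u x * cnj (w x))"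
      unfolding du0 dw0 by (simp add: algebra_simps)
    have "norm (?a x - ?b x) \<le> \<bar>\<theta>' x\<bar> * (cmod (u x) * cmod (?dw x)) + \<bar>\<theta>' x\<bar> * (cmod (?du x) * cmod (w x))
        + \<bar>(W x - V x) * \<theta> x\<bar> * (cmod (u x) * cmod (w x))"
    proof -
      have tri: "norm (p - q + r) \<le> norm p + norm q + norm r" for p q r :: complex
        using norm_triangle_ineq[of "p - q" r] norm_triangle_ineq4[of p q] by linarith
      have n: "norm (of_real t * (p * q)) = \<bar>t\<bar> * (cmod p * cmod q)" for t p q by (simp add: norm_mult)
      show ?thesis
        using tri[of "of_real (\<theta>' x) * (u x * cnj (?dw x))" "of_real (\<theta>' x) * (?du x * cnj (w x))" "of_real ((W x - V x) * \<theta> x) * (u x * cnj (w x))"]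
        unfolding split n complex_mod_cnj .
    qed
    also have "\<dots> \<le> ?g x"
    proof -
      have o: "\<bar>\<theta>' x\<bar> * cmod (v x) \<le> B * cmod (outside v x)" for v
      proof (cases "\<bar>x\<bar> < \<rho> / 2")
        case True
        then show ?thesis using \<theta>'_in[OF True] B by simp
      next
        case False
        then have "outside v x = v x" unfolding outside_def by simp
        then show ?thesis using \<theta>'_bound[of x] by (simp add: mult_right_mono)
      qed
      have t1: "\<bar>\<theta>' x\<bar> * (cmod (u x) * cmod (?dw x)) \<le> B * (cmod (outside u x) * cmod (?dw x))"
        using mult_right_mono[OF o[of u] norm_ge_zero[of "?dw x"]] by (simp only: mult.assoc)
      have t2: "\<bar>\<theta>' x\<bar> * (cmod (?du x) * cmod (w x)) \<le> B * (cmod (?du x) * cmod (outside w x))"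
        using mult_right_mono[OF o[of w] norm_ge_zero[of "?du x"]] by (simp only: mult.assoc mult.commute[of "cmod (?du x)"])
      have t3: "\<bar>(W x - V x) * \<theta> x\<bar> * (cmod (u x) * cmod (w x))
          \<le> 2 * \<eta> * (cmod (Q.root_mult u x) * cmod (H.root_mult w x)) + su * sw * G x"
      proof (cases "x \<in> {-\<rho>..\<rho>}")
        case False
        then show ?thesis using \<theta>_off[OF False] \<eta> s G(2)[of x] by simp
      next
        case True
        have "\<bar>(W x - V x) * \<theta> x\<bar> \<le> \<bar>W x - V x\<bar> * 1"
          unfolding abs_mult using \<theta>_bounds[of x] by (intro mult_left_mono) auto
        also have "\<dots> \<le> \<eta> * W x + G x" using VW(1)[OF True] by simp
        finally have 1: "\<bar>(W x - V x) * \<theta> x\<bar> * (cmod (u x) * cmod (w x)) \<le> (\<eta> * W x + G x) * (cmod (u x) * cmod (w x))"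
          by (intro mult_right_mono) auto
        \<comment> \<open>The error relative to \<open>W\<close> is split evenly between the energies of \<open>u\<close> and of \<open>w\<close>.\<close>
        have W2: "W x \<le> 2 * (sqrt (V x) * sqrt (W x))"
        proof -
          have "sqrt (W x) \<le> sqrt (4 * V x)"
            using VW(2)[OF True] Q.V_nonneg[of x] by (intro real_sqrt_le_mono) linarith
          then have "sqrt (W x) \<le> 2 * sqrt (V x)" by (simp add: real_sqrt_mult)
          then have "sqrt (W x) * sqrt (W x) \<le> 2 * sqrt (V x) * sqrt (W x)"
            using H.V_nonneg[of x] by (intro mult_right_mono) auto
          then show ?thesis using H.V_nonneg[of x] by simp
        qed
        have "\<eta> * W x * (cmod (u x) * cmod (w x)) \<le> \<eta> * (2 * (sqrt (V x) * sqrt (W x))) * (cmod (u x) * cmod (w x))"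
          using \<eta> by (intro mult_right_mono mult_left_mono W2) auto
        also have "\<dots> = 2 * \<eta> * (cmod (Q.root_mult u x) * cmod (H.root_mult w x))"
          unfolding Q.root_mult_def H.root_mult_def using Q.V_nonneg[of x] H.V_nonneg[of x] by (simp add: norm_mult)
        finally have 2: "\<eta> * W x * (cmod (u x) * cmod (w x)) \<le> 2 * \<eta> * (cmod (Q.root_mult u x) * cmod (H.root_mult w x))" .
        have "G x * (cmod (u x) * cmod (w x)) \<le> G x * (su * sw)"
          using G(2)[of x] s su sw by (intro mult_left_mono mult_mono) auto
        then have 3: "G x * (cmod (u x) * cmod (w x)) \<le> su * sw * G x" by (simp add: mult_ac)
        show ?thesis using 1 2 3 by (simp add: distrib_right)
      qed
      show ?thesis using t1 t2 t3 by linarith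
    qed
    finally show "norm (?a x - ?b x) \<le> ?g x" .
  qed
  have eq: "schroed_form UNIV W ?u0 w - schroed_form S V u ?w0 = (\<integral>x. ?a x - ?b x \<partial>lborel)"
    unfolding schroed_form_def by (rule Bochner_Integration.integral_diff[OF ia ib, symmetric])
  have "cmod (schroed_form UNIV W ?u0 w - schroed_form S V u ?w0) \<le> (\<integral>x. norm (?a x - ?b x) \<partial>lborel)"
    unfolding eq by (rule integral_norm_bound)
  also have "\<dots> \<le> (\<integral>x. ?g x \<partial>lborel)"
    by (rule integral_mono_AE[OF integrable_norm[OF Bochner_Integration.integrable_diff[OF ia ib]] _ pointwise])
      (intro Bochner_Integration.integrable_add integrable_mult_right i1 i2 i3 G(1))
  also have "\<dots> = B * (\<integral>x. cmod (outside u x) * cmod (?dw x) \<partial>lborel) + B * (\<integral>x. cmod (?du x) * cmod (outside w x) \<partial>lborel)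
      + 2 * \<eta> * (\<integral>x. cmod (Q.root_mult u x) * cmod (H.root_mult w x) \<partial>lborel) + su * sw * (\<integral>x. G x \<partial>lborel)"
    using i1 i2 i3 G(1) by simp
  also have "\<dots> \<le> B * (l2_norm (outside u) * l2_norm ?dw) + B * (l2_norm ?du * l2_norm (outside w))
      + 2 * \<eta> * (l2_norm (Q.root_mult u) * l2_norm (H.root_mult w)) + su * sw * (\<integral>x. G x \<partial>lborel)"
    using mult_left_mono[OF integral_norm_prod_le[OF outside_L2[OF uL] dwL] B]
      mult_left_mono[OF integral_norm_prod_le[OF duL outside_L2[OF wL]] B]
      mult_left_mono[OF integral_norm_prod_le[OF Q.root_mult_L2[OF u] H.root_mult_L2[OF w]], of "2 * \<eta>"] \<eta>
    by linarith
  finally show ?thesis .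
qed

lemma norm_cut_rest:
  assumes "u \<in> L2 T"
  shows "(\<lambda>x. u x - of_real (\<theta> x) * u x) \<in> L2 UNIV" and "l2_norm (\<lambda>x. u x - of_real (\<theta> x) * u x) \<le> l2_norm (outside u)"
proof -
  have le: "cmod (u x - of_real (\<theta> x) * u x) \<le> cmod (outside u x)" for x
  proof (cases "\<bar>x\<bar> \<le> \<rho> / 2")
    case True
    then show ?thesis using \<theta>_one by simp
  next
    case False
    have "u x - of_real (\<theta> x) * u x = of_real (1 - \<theta> x) * u x" by (simp add: algebra_simps)
    then have "cmod (u x - of_real (\<theta> x) * u x) = (1 - \<theta> x) * cmod (u x)"
      using \<theta>_bounds[of x] by (simp add: norm_mult del: of_real_diff)
    also have "\<dots> \<le> 1 * cmod (u x)" using \<theta>_bounds[of x] by (intro mult_right_mono) auto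
    finally show ?thesis using False unfolding outside_def by simp
  qed
  show L: "(\<lambda>x. u x - of_real (\<theta> x) * u x) \<in> L2 UNIV"
    by (rule L2_diff[OF L2_UNIV[OF assms] L2_UNIV[OF compact_support_mult_L2[OF cut_cont \<theta>_off assms]]])
  show "l2_norm (\<lambda>x. u x - of_real (\<theta> x) * u x) \<le> l2_norm (outside u)"
    by (rule l2_norm_mono[OF L2_measurable[OF L] outside_L2[OF assms]]) (use le in auto)
qed

text \<open>Let $u = Q^{-1} (f|_S)$, $y = H^{-1} f$, $g = u - y$ and $w = H^{-1} g$. Then
  $\|g\|^2 = \langle u, g\rangle - \langle f, w\rangle$ since \<open>H\<close> is symmetric, and this difference is
  small by the core identity and because \<open>u\<close> and \<open>w\<close> are small away from the origin. The four terms of the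
  bound come from \<open>\<theta>'\<close>, from the relative error of the potentials, from the integrable error, and from the
  pairings with $(1-\theta)u$ and $(1-\theta)w$. The constant \<open>k\<close> is a lower bound of the potentials outside the
  region where \<open>\<theta> = 1\<close>.\<close>

lemma resolvent_difference_bound:
  assumes u: "(u, \<lambda>x. indicator S x * f x) \<in> form_op S V D" and f: "f \<in> L2 UNIV"
    and y: "(y, f) \<in> form_op UNIV W H.form_dom" and w: "(w, \<lambda>x. u x - y x) \<in> form_op UNIV W H.form_dom"
    and C: "C > 0" and r: "r > 0"
    and cQ: "(l2_norm u)\<^sup>2 \<le> (C * r\<^sup>2) * Q.energy u" and cH: "(l2_norm w)\<^sup>2 \<le> (C * r\<^sup>2) * H.energy w"
    and J: "\<And>x. x \<in> S \<Longrightarrow> \<exists>s. s \<le> x \<and> x \<le> s + r \<and> {s..s+r} \<subseteq> S"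
    and k: "k > 0" "\<And>x. x \<in> S \<Longrightarrow> \<bar>x\<bar> \<ge> \<rho> / 2 \<Longrightarrow> V x \<ge> k" "\<And>x. \<bar>x\<bar> \<ge> \<rho> / 2 \<Longrightarrow> W x \<ge> k"
  shows "l2_norm (\<lambda>x. u x - y x) \<le> (2 * B * C * r\<^sup>2 / sqrt k + 2 * \<eta> * C * r\<^sup>2
      + (2 * C\<^sup>2 + 2 * C) * r^3 * (\<integral>x. G x \<partial>lborel) + 2 * sqrt C * r / sqrt k) * l2_norm f"
proof -
  define g where "g x = u x - y x" for x
  let ?F = "\<lambda>x. indicator S x * f x"
  note w' = w[folded g_def]
  have uD: "u \<in> D" and uQ: "u \<in> Q.form_dom" and uf: "\<And>z. z \<in> D \<Longrightarrow> schroed_form S V u z = l2_inner ?F z"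
    using u D(1) unfolding form_op_def by auto
  have yH: "y \<in> H.form_dom" and yf: "\<And>z. z \<in> H.form_dom \<Longrightarrow> schroed_form UNIV W y z = l2_inner f z"
    using y unfolding form_op_def by auto
  have wH: "w \<in> H.form_dom" and wf: "\<And>z. z \<in> H.form_dom \<Longrightarrow> schroed_form UNIV W w z = l2_inner g z"
    using w' unfolding form_op_def by auto
  note uL = Q.form_dom_L2[OF uQ] and yL = H.form_dom_L2[OF yH] and wL = H.form_dom_L2[OF wH]
  have gL: "g \<in> L2 UNIV" unfolding g_def by (rule L2_diff[OF L2_UNIV[OF uL] yL])
  let ?u0 = "\<lambda>x. of_real (\<theta> x) * u x" and ?w0 = "\<lambda>x. of_real (\<theta> x) * w x"
  note ur = norm_cut_rest[OF uL] and wr = norm_cut_rest[OF wL]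
  note c1 = cut_weak_deriv(1)[OF Q.form_dom_H1[OF uQ] \<rho>(2)]
  have T: "{-\<rho>..\<rho>} \<subseteq> interior UNIV" by simp
  note c2 = cut_weak_deriv(1)[OF H.form_dom_H1[OF wH] T]
  have C': "C * r\<^sup>2 > 0" using C r by simp
  have FL: "?F \<in> L2 UNIV" using L2_restrict[OF f S_sets] by (rule L2_UNIV)
  \<comment> \<open>\<open>p\<close> is the bound for the operator that maps a right hand side to the square root of the energy.\<close>
  define nf ng p where "nf = l2_norm f" and "ng = l2_norm g" and "p = sqrt C * r"
  have p: "p > 0" "p\<^sup>2 = C * r\<^sup>2" unfolding p_def using C r by (auto simp: power_mult_distrib)
  have nn: "nf \<ge> 0" "ng \<ge> 0" unfolding nf_def ng_def by auto
  have Ff: "l2_norm ?F \<le> nf" unfolding nf_def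
    by (rule l2_norm_mono[OF L2_measurable[OF FL] f]) (auto simp: norm_mult split: split_indicator)
  have bu: "l2_norm u \<le> p\<^sup>2 * nf" "Q.energy u \<le> (p * nf)\<^sup>2"
  proof -
    have "l2_norm u \<le> p\<^sup>2 * l2_norm ?F" "Q.energy u \<le> p\<^sup>2 * (l2_norm ?F)\<^sup>2"
      using Q.form_op_bounds[OF u D(1) C' cQ] p(2) by auto
    moreover have "p\<^sup>2 * l2_norm ?F \<le> p\<^sup>2 * nf" using Ff by (intro mult_left_mono) auto
    moreover have "p\<^sup>2 * (l2_norm ?F)\<^sup>2 \<le> p\<^sup>2 * nf\<^sup>2" using Ff by (intro mult_left_mono power_mono) auto
    ultimately show "l2_norm u \<le> p\<^sup>2 * nf" "Q.energy u \<le> (p * nf)\<^sup>2" by (auto simp: power_mult_distrib)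
  qed
  have bw: "l2_norm w \<le> p\<^sup>2 * ng" "H.energy w \<le> (p * ng)\<^sup>2"
    using H.form_op_bounds[OF w' order_refl C' cH] unfolding ng_def p(2)[symmetric] by (auto simp: power_mult_distrib)
  have root: "x \<le> z" if sq: "x\<^sup>2 + t\<^sup>2 \<le> z\<^sup>2" and z: "z \<ge> 0" for x t z :: real
    by (rule power2_le_imp_le[OF _ z]) (use sq zero_le_power2[of t] in linarith)
  have root': "t \<le> z" if "x\<^sup>2 + t\<^sup>2 \<le> z\<^sup>2" "z \<ge> 0" for x t z :: real
    by (rule root[of t x]) (use that in \<open>simp_all add: add.commute\<close>)
  have pn: "p * nf \<ge> 0" "p * ng \<ge> 0" using p nn by auto
  note du = root[OF bu(2)[unfolded Q.energy_def] pn(1)] root'[OF bu(2)[unfolded Q.energy_def] pn(1)]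
  note dw = root[OF bw(2)[unfolded H.energy_def] pn(2)] root'[OF bw(2)[unfolded H.energy_def] pn(2)]
  have ou: "l2_norm (outside u) \<le> p * nf / sqrt k"
  proof (rule power2_le_imp_le)
    have "(l2_norm (outside u))\<^sup>2 \<le> 1 / k * (l2_norm (Q.root_mult u))\<^sup>2"
      unfolding outside_norm by (rule Q.potential_mass_bound[OF uQ outside_sets k(1)]) (use k(2) in auto)
    also have "\<dots> \<le> 1 / k * (p * nf)\<^sup>2" using du(2) k(1) by (intro mult_left_mono power_mono) auto
    also have "\<dots> = (p * nf / sqrt k)\<^sup>2" using k(1) by (simp add: power_divide)
    finally show "(l2_norm (outside u))\<^sup>2 \<le> (p * nf / sqrt k)\<^sup>2" .
  qed (use p nn k in auto)
  have ow: "l2_norm (outside w) \<le> p * ng / sqrt k"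
  proof (rule power2_le_imp_le)
    have "(l2_norm (outside w))\<^sup>2 \<le> 1 / k * (l2_norm (H.root_mult w))\<^sup>2"
      unfolding outside_norm by (rule H.potential_mass_bound[OF wH outside_sets k(1)]) (use k(3) in auto)
    also have "\<dots> \<le> 1 / k * (p * ng)\<^sup>2" using dw(2) k(1) by (intro mult_left_mono power_mono) auto
    also have "\<dots> = (p * ng / sqrt k)\<^sup>2" using k(1) by (simp add: power_divide)
    finally show "(l2_norm (outside w))\<^sup>2 \<le> (p * ng / sqrt k)\<^sup>2" .
  qed (use p nn k in auto)
  define s where "s = sqrt ((2 * C\<^sup>2 + 2 * C) * r^3)"
  have s: "s \<ge> 0" "s\<^sup>2 = (2 * C\<^sup>2 + 2 * C) * r^3" unfolding s_def using C r by auto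
  have sup: "AE x in lborel. cmod (v x) \<le> s * n"
    if ae: "AE x in lborel. (cmod (v x))\<^sup>2 \<le> 2 / r * A\<^sup>2 + 2 * r * A'\<^sup>2"
      and A: "A \<le> p\<^sup>2 * n" "A' \<le> p * n" "A \<ge> 0" "A' \<ge> 0" "n \<ge> 0" for v :: "real \<Rightarrow> complex" and A A' n
    using ae
  proof eventually_elim
    case (elim x)
    have "2 / r * A\<^sup>2 + 2 * r * A'\<^sup>2 \<le> 2 / r * (p\<^sup>2 * n)\<^sup>2 + 2 * r * (p * n)\<^sup>2"
      using A r by (intro add_mono mult_left_mono power_mono) auto
    also have "\<dots> = 2 / r * (p\<^sup>2)\<^sup>2 * n\<^sup>2 + 2 * r * p\<^sup>2 * n\<^sup>2" by (simp add: power_mult_distrib)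
    also have "\<dots> = (s * n)\<^sup>2"
      unfolding p(2) power_mult_distrib[of s n] s(2) using r
      by (simp add: field_simps power_mult_distrib power2_eq_square power3_eq_cube)
    finally have "(cmod (v x))\<^sup>2 \<le> (s * n)\<^sup>2" using elim by linarith
    then show ?case by (rule power2_le_imp_le) (use s A in simp)
  qed
  have su: "AE x in lborel. cmod (u x) \<le> s * nf"
    by (rule sup[OF sobolev_sup_bound[OF Q.dom Q.form_dom_H1[OF uQ] r J] bu(1) du(1)]) (use nn in auto)
  have JU: "\<exists>s. s \<le> x \<and> x \<le> s + r \<and> {s..s+r} \<subseteq> UNIV" for x :: real
    using r by (intro exI[of _ x]) auto
  have sw: "AE x in lborel. cmod (w x) \<le> s * ng"
    by (rule sup[OF sobolev_sup_bound[OF H.dom H.form_dom_H1[OF wH] r JU] bw(1) dw(1)]) (use nn in auto)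
  have B: "B \<ge> 0" using \<theta>'_bound[of 0] by linarith
  have split_u: "l2_inner u g = l2_inner ?u0 g + l2_inner (\<lambda>x. u x - ?u0 x) g"
    using l2_inner_comb_left[OF c1 ur(1) gL, of 1] by simp
  have split_w: "l2_inner f w = l2_inner f ?w0 + l2_inner f (\<lambda>x. w x - ?w0 x)"
    using l2_inner_comb_left[OF c2 wr(1) f, of 1] l2_inner_commute[of f] by simp
  have eH: "l2_inner ?u0 g = schroed_form UNIV W ?u0 w"
    using wf[OF cut_in_H[OF uQ]] H.schroed_form_commute[OF wH cut_in_H[OF uQ]] l2_inner_commute[of ?u0 g] by simp
  have eQ: "l2_inner f ?w0 = schroed_form S V u ?w0"
  proof -
    have "l2_inner ?F ?w0 = l2_inner f ?w0"
      unfolding l2_inner_def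
    proof (rule Bochner_Integration.integral_cong[OF refl])
      fix x
      show "indicator S x * f x * cnj (?w0 x) = f x * cnj (?w0 x)"
      proof (cases "x \<in> S")
        case False
        then have "\<theta> x = 0" using rho_S by (intro \<theta>_off) blast
        then show ?thesis by simp
      qed simp
    qed
    then show ?thesis using uf[OF cut_in_D[OF wH]] by simp
  qed
  have "l2_inner y g = cnj (schroed_form UNIV W w y)" using wf[OF yH] l2_inner_commute[of y g] by simp
  also have "\<dots> = schroed_form UNIV W y w" using H.schroed_form_commute[OF yH wH] by simp
  also have "\<dots> = l2_inner f w" by (rule yf[OF wH])
  finally have yg: "l2_inner y g = l2_inner f w" .
  have "of_real (ng\<^sup>2) = l2_inner g g" unfolding ng_def by (rule l2_inner_self[symmetric])
  also have "\<dots> = l2_inner (\<lambda>x. u x + (-1) * y x) g" unfolding g_def by simp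
  also have "\<dots> = l2_inner u g - l2_inner y g" using l2_inner_comb_left[OF uL yL gL, of "-1"] by simp
  also have "\<dots> = (schroed_form UNIV W ?u0 w - schroed_form S V u ?w0) + l2_inner (\<lambda>x. u x - ?u0 x) g - l2_inner f (\<lambda>x. w x - ?w0 x)"
    unfolding yg split_u split_w eH eQ by simp
  finally have "ng\<^sup>2 = cmod ((schroed_form UNIV W ?u0 w - schroed_form S V u ?w0) + l2_inner (\<lambda>x. u x - ?u0 x) g - l2_inner f (\<lambda>x. w x - ?w0 x))"
    by (metis abs_of_nonneg norm_of_real zero_le_power2)
  also have "\<dots> \<le> cmod (schroed_form UNIV W ?u0 w - schroed_form S V u ?w0) + cmod (l2_inner (\<lambda>x. u x - ?u0 x) g) + cmod (l2_inner f (\<lambda>x. w x - ?w0 x))"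
    by (metis (no_types, lifting) add_right_mono norm_triangle_ineq norm_triangle_ineq4 order_trans)
  also have "\<dots> \<le> (B * (p * nf / sqrt k * (p * ng)) + B * (p * nf * (p * ng / sqrt k))
      + 2 * \<eta> * (p * nf * (p * ng)) + s * nf * (s * ng) * (\<integral>x. G x \<partial>lborel)) + p * nf / sqrt k * ng + nf * (p * ng / sqrt k)"
  proof (intro add_mono)
    have "cmod (schroed_form UNIV W ?u0 w - schroed_form S V u ?w0)
      \<le> B * (l2_norm (outside u) * l2_norm (weak_deriv UNIV w)) + B * (l2_norm (weak_deriv S u) * l2_norm (outside w))
      + 2 * \<eta> * (l2_norm (Q.root_mult u) * l2_norm (H.root_mult w)) + s * nf * (s * ng) * (\<integral>x. G x \<partial>lborel)"
      by (rule form_difference_bound[OF uQ wH su sw]) (use s nn in auto)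
    also have "\<dots> \<le> B * (p * nf / sqrt k * (p * ng)) + B * (p * nf * (p * ng / sqrt k))
      + 2 * \<eta> * (p * nf * (p * ng)) + s * nf * (s * ng) * (\<integral>x. G x \<partial>lborel)"
    proof -
      have k0: "0 \<le> p * nf / sqrt k" using p nn k by simp
      have b: "l2_norm (outside u) * l2_norm (weak_deriv UNIV w) \<le> p * nf / sqrt k * (p * ng)"
        "l2_norm (weak_deriv S u) * l2_norm (outside w) \<le> p * nf * (p * ng / sqrt k)"
        "l2_norm (Q.root_mult u) * l2_norm (H.root_mult w) \<le> p * nf * (p * ng)"
        by (rule mult_mono[OF ou dw(1) k0 L2_norm_nonneg] mult_mono[OF du(1) ow pn(1) L2_norm_nonneg]
            mult_mono[OF du(2) dw(2) pn(1) L2_norm_nonneg])+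
      show ?thesis
        using mult_left_mono[OF b(1) B] mult_left_mono[OF b(2) B] mult_left_mono[OF b(3), of "2 * \<eta>"] \<eta>
        by linarith
    qed
    finally show "cmod (schroed_form UNIV W ?u0 w - schroed_form S V u ?w0) \<le> B * (p * nf / sqrt k * (p * ng)) + B * (p * nf * (p * ng / sqrt k))
      + 2 * \<eta> * (p * nf * (p * ng)) + s * nf * (s * ng) * (\<integral>x. G x \<partial>lborel)" .
    have "cmod (l2_inner (\<lambda>x. u x - ?u0 x) g) \<le> l2_norm (\<lambda>x. u x - ?u0 x) * ng"
      unfolding ng_def by (rule norm_l2_inner_le[OF ur(1) gL])
    also have "\<dots> \<le> p * nf / sqrt k * ng" using ur(2) ou nn by (intro mult_right_mono) auto
    finally show "cmod (l2_inner (\<lambda>x. u x - ?u0 x) g) \<le> p * nf / sqrt k * ng" .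
    have "cmod (l2_inner f (\<lambda>x. w x - ?w0 x)) \<le> nf * l2_norm (\<lambda>x. w x - ?w0 x)"
      unfolding nf_def by (rule norm_l2_inner_le[OF f wr(1)])
    also have "\<dots> \<le> nf * (p * ng / sqrt k)" using wr(2) ow nn by (intro mult_left_mono) auto
    finally show "cmod (l2_inner f (\<lambda>x. w x - ?w0 x)) \<le> nf * (p * ng / sqrt k)" .
  qed
  also have "\<dots> = ((2 * B * p\<^sup>2 / sqrt k + 2 * \<eta> * p\<^sup>2 + s\<^sup>2 * (\<integral>x. G x \<partial>lborel) + 2 * p / sqrt k) * nf) * ng"
    by (simp add: power2_eq_square algebra_simps)
  finally have main: "ng * ng \<le> ((2 * B * p\<^sup>2 / sqrt k + 2 * \<eta> * p\<^sup>2 + s\<^sup>2 * (\<integral>x. G x \<partial>lborel) + 2 * p / sqrt k) * nf) * ng"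
    by (simp add: power2_eq_square)
  have Gn: "(\<integral>x. G x \<partial>lborel) \<ge> 0" using G(2) by simp
  have "ng \<le> (2 * B * p\<^sup>2 / sqrt k + 2 * \<eta> * p\<^sup>2 + s\<^sup>2 * (\<integral>x. G x \<partial>lborel) + 2 * p / sqrt k) * nf"
  proof (cases "ng = 0")
    case True
    have "0 \<le> 2 * B * p\<^sup>2 / sqrt k + 2 * \<eta> * p\<^sup>2 + s\<^sup>2 * (\<integral>x. G x \<partial>lborel) + 2 * p / sqrt k"
      using B p(1) \<eta> Gn k(1) by (intro add_nonneg_nonneg divide_nonneg_nonneg mult_nonneg_nonneg) auto
    then show ?thesis using True nn by simp
  next
    case False
    then show ?thesis using main nn by simp
  qed
  then show ?thesis unfolding p(2) s(2) unfolding ng_def nf_def p_def g_def by (simp add: mult_ac)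
qed

end


section \<open>From resolvent differences to operator norms\<close>

lemma scale_op_I: "(u, f) \<in> A \<Longrightarrow> (u, \<lambda>x. of_real c * f x) \<in> scale_op c A"
  unfolding scale_op_def by blast

lemma zero_op_I: "u \<in> L2 S \<Longrightarrow> (u, \<lambda>x. 0) \<in> zero_op S"
  unfolding zero_op_def by blast

lemma dsum_op_I: "(u1, v1) \<in> A \<Longrightarrow> (u2, v2) \<in> B \<Longrightarrow> (\<lambda>x. u1 x + u2 x, \<lambda>x. v1 x + v2 x) \<in> dsum_op A B"
  unfolding dsum_op_def by blast

lemma diff_op_I: "(u, v) \<in> A \<Longrightarrow> (u, w) \<in> B \<Longrightarrow> (u, \<lambda>x. v x - w x) \<in> diff_op A B"
  unfolding diff_op_def by blast

text \<open>For the relations that represent the operators, solvability gives the domain $L^2(\mathbb R)$, and an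
  estimate that holds for every pair of solutions bounds the norm; it includes uniqueness modulo null
  sets. The scaling by \<open>c\<close> divides the right hand side by \<open>c\<close>.\<close>

lemma op_norm_resolvent_difference_le:
  assumes A: "\<And>u f. (u, f) \<in> A \<Longrightarrow> u \<in> L2 S \<and> f \<in> L2 S" and B: "\<And>u f. (u, f) \<in> B \<Longrightarrow> u \<in> L2 UNIV \<and> f \<in> L2 UNIV"
    and S: "S \<in> sets borel" and c: "c > 0"
    and solveA: "\<And>f. f \<in> L2 S \<Longrightarrow> \<exists>u. (u, f) \<in> A" and solveB: "\<And>f. f \<in> L2 UNIV \<Longrightarrow> \<exists>u. (u, f) \<in> B"
    and bound: "\<And>f u y. f \<in> L2 UNIV \<Longrightarrow> (u, \<lambda>x. indicator S x * f x) \<in> A \<Longrightarrow> (y, f) \<in> B \<Longrightarrow>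
        l2_norm (\<lambda>x. u x - y x) \<le> c * \<delta> * l2_norm f"
    and \<delta>: "\<delta> \<ge> 0"
  shows "op_norm (diff_op (dsum_op ((scale_op c A)\<inverse>) (zero_op (UNIV - S))) ((scale_op c B)\<inverse>)) \<le> ennreal \<delta>"
proof -
  let ?T = "diff_op (dsum_op ((scale_op c A)\<inverse>) (zero_op (UNIV - S))) ((scale_op c B)\<inverse>)"
  have elim: "F \<in> L2 UNIV \<and> z \<in> L2 UNIV \<and> l2_norm z \<le> \<delta> * l2_norm F" if "(F, z) \<in> ?T" for F z
  proof -
    from that obtain v w where z: "z = (\<lambda>x. v x - w x)"
      and v: "(F, v) \<in> dsum_op ((scale_op c A)\<inverse>) (zero_op (UNIV - S))" and w: "(w, F) \<in> scale_op c B"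
      unfolding diff_op_def by blast
    from v obtain f1 u2 v1 where F: "F = (\<lambda>x. f1 x + u2 x)" and v': "v = (\<lambda>x. v1 x + 0)"
      and v1: "(v1, f1) \<in> scale_op c A" and u2: "u2 \<in> L2 (UNIV - S)"
      unfolding dsum_op_def zero_op_def by auto
    from v1 obtain f0 where f0: "f1 = (\<lambda>x. of_real c * f0 x)" "(v1, f0) \<in> A" unfolding scale_op_def by blast
    from w obtain g where g: "F = (\<lambda>x. of_real c * g x)" "(w, g) \<in> B" unfolding scale_op_def by blast
    note f0L = A[OF f0(2)] and gL = B[OF g(2)]
    have "f0 x = indicator S x * g x" for x
    proof (cases "x \<in> S")
      case True
      have "of_real c * f0 x + u2 x = of_real c * g x" using F f0(1) g(1) by metis
      moreover have "u2 x = 0" using L2_zero_off[OF u2, of x] True by simp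
      ultimately show ?thesis using c True by simp
    next
      case False
      then show ?thesis using L2_zero_off[of f0 S x] f0L by simp
    qed
    then have "(v1, \<lambda>x. indicator S x * g x) \<in> A" using f0(2) by presburger
    then have "l2_norm (\<lambda>x. v1 x - w x) \<le> c * \<delta> * l2_norm g" using bound gL g(2) by blast
    also have "\<dots> = \<delta> * l2_norm F" unfolding g(1) l2_norm_cmult using c by simp
    finally have n: "l2_norm z \<le> \<delta> * l2_norm F" unfolding z v' by simp
    have "F \<in> L2 UNIV" unfolding g(1) by (rule L2_cmult) (use gL in blast)
    moreover have "z \<in> L2 UNIV" unfolding z v' using L2_diff[OF L2_UNIV[of v1 S], of w] f0L gL by simp
    ultimately show ?thesis using n by blast
  qed
  have intro: "F \<in> Domain ?T" if F: "F \<in> L2 UNIV" for F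
  proof -
    let ?g = "\<lambda>x. of_real (1 / c) * F x"
    have gL: "?g \<in> L2 UNIV" by (rule L2_cmult[OF F])
    obtain u where u: "(u, \<lambda>x. indicator S x * ?g x) \<in> A" using solveA[OF L2_restrict[OF gL S]] by blast
    obtain y where y: "(y, ?g) \<in> B" using solveB[OF gL] by blast
    have "UNIV - S \<in> sets borel" using S by auto
    from L2_restrict[OF F this] have F2: "(\<lambda>x. indicator (UNIV - S) x * F x) \<in> L2 (UNIV - S)" .
    have "(\<lambda>x. of_real c * (indicator S x * ?g x), u) \<in> (scale_op c A)\<inverse>"
      by (rule converseI[OF scale_op_I[OF u]])
    from dsum_op_I[OF this zero_op_I[OF F2]]
    have 1: "(\<lambda>x. of_real c * (indicator S x * ?g x) + indicator (UNIV - S) x * F x, \<lambda>x. u x + 0)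
        \<in> dsum_op ((scale_op c A)\<inverse>) (zero_op (UNIV - S))" .
    have F1: "(\<lambda>x. of_real c * (indicator S x * ?g x) + indicator (UNIV - S) x * F x) = F"
      using c by (auto simp: fun_eq_iff split: split_indicator)
    have 2: "(\<lambda>x. of_real c * ?g x, y) \<in> (scale_op c B)\<inverse>" by (rule converseI[OF scale_op_I[OF y]])
    have F2: "(\<lambda>x. of_real c * ?g x) = F" using c by (auto simp: fun_eq_iff)
    have "(F, \<lambda>x. (u x + 0) - y x) \<in> ?T" by (rule diff_op_I[OF 1[unfolded F1] 2[unfolded F2]])
    then show ?thesis by blast
  qed
  have "Domain ?T = L2 UNIV" using elim intro by blast
  moreover have "Range ?T \<subseteq> L2 UNIV" using elim by blast
  moreover have "(SUP (u, v) \<in> {(u, v) \<in> ?T. l2_norm u \<le> 1}. ennreal (l2_norm v)) \<le> ennreal \<delta>"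
  proof (rule SUP_least, clarify)
    fix F z assume "(F, z) \<in> ?T" "l2_norm F \<le> 1"
    then have "l2_norm z \<le> \<delta> * 1" using elim[of F z] mult_left_mono[OF _ \<delta>, of "l2_norm F" 1] by linarith
    then show "ennreal (l2_norm z) \<le> ennreal \<delta>" by (simp add: ennreal_leI)
  qed
  ultimately show ?thesis unfolding op_norm_def by simp
qed

text \<open>Elements of the domain vanish off \<open>S\<close>, so the form sees only the values of the potential on \<open>S\<close>.\<close>

lemma form_op_cong:
  assumes "D \<subseteq> H1 S" "\<And>x. x \<in> S \<Longrightarrow> V x = W x"
  shows "form_op S V D = form_op S W D"
proof -
  have "schroed_form S V u w = schroed_form S W u w" if "u \<in> D" for u w
    unfolding schroed_form_def
  proof (rule Bochner_Integration.integral_cong[OF refl])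
    fix x
    have "of_real (V x) * u x = of_real (W x) * u x"
      using assms L2_zero_off[OF H1_L2, of u S x] that by (cases "x \<in> S") auto
    then show "weak_deriv S u x * cnj (weak_deriv S w x) + of_real (V x) * u x * cnj (w x)
        = weak_deriv S u x * cnj (weak_deriv S w x) + of_real (W x) * u x * cnj (w x)" by simp
  qed
  then show ?thesis unfolding form_op_def by auto
qed

section \<open>The potential near the maximum\<close>

text \<open>One sided comparison with the model potential. The quotient is the product of
  $(M-h)/(c|x|^m)$, which tends to \<open>1\<close> by the expansion, and of $M(M+h)/(2h^2)$, which tends to \<open>1\<close> since
  \<open>h\<close> tends to \<open>M\<close>.\<close>

lemma potential_ratio_tendsto:
  fixes h :: "real \<Rightarrow> real"
  assumes h: "(h \<longlongrightarrow> M) F" and x0: "((\<lambda>x. x) \<longlongrightarrow> 0) F" and xpos: "eventually (\<lambda>x. x \<noteq> 0) F"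
    and M: "M > 0" and c: "c > 0"
    and O: "eventually (\<lambda>x. \<bar>h x - (M - c * \<bar>x\<bar> powr m)\<bar> \<le> C * \<bar>x\<bar> powr (m + 1)) F"
  shows "((\<lambda>x. pi\<^sup>2 * (1 / (h x)\<^sup>2 - 1 / M\<^sup>2) / (2 * pi\<^sup>2 / M ^ 3 * c * \<bar>x\<bar> powr m)) \<longlongrightarrow> 1) F"
proof -
  have "((\<lambda>x. (M - h x) / (c * \<bar>x\<bar> powr m) - 1) \<longlongrightarrow> 0) F"
  proof (rule Lim_null_comparison)
    show "eventually (\<lambda>x. norm ((M - h x) / (c * \<bar>x\<bar> powr m) - 1) \<le> C / c * \<bar>x\<bar>) F"
      using O xpos
    proof eventually_elim
      case (elim x)
      have p: "c * \<bar>x\<bar> powr m > 0" using elim c by simp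
      have "(M - h x) / (c * \<bar>x\<bar> powr m) - 1 = - (h x - (M - c * \<bar>x\<bar> powr m)) / (c * \<bar>x\<bar> powr m)"
        using p elim c by (simp add: field_simps)
      then have "norm ((M - h x) / (c * \<bar>x\<bar> powr m) - 1) = \<bar>h x - (M - c * \<bar>x\<bar> powr m)\<bar> / (c * \<bar>x\<bar> powr m)"
        using p by (simp only: real_norm_def abs_divide abs_minus_cancel abs_of_pos)
      also have "\<dots> \<le> C * \<bar>x\<bar> powr (m + 1) / (c * \<bar>x\<bar> powr m)"
        using elim p by (intro divide_right_mono) auto
      also have "\<dots> = C / c * \<bar>x\<bar>" using elim c by (simp add: powr_add)
      finally show ?case .
    qed
    have "((\<lambda>x. C / c * \<bar>x\<bar>) \<longlongrightarrow> C / c * \<bar>0\<bar>) F" by (intro tendsto_intros x0)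
    then show "((\<lambda>x. C / c * \<bar>x\<bar>) \<longlongrightarrow> 0) F" by simp
  qed
  then have r1: "((\<lambda>x. (M - h x) / (c * \<bar>x\<bar> powr m)) \<longlongrightarrow> 1) F" by (simp add: LIM_zero_iff)
  have "((\<lambda>x. (M - h x) / (c * \<bar>x\<bar> powr m) * (M * (M + h x) / (2 * (h x)\<^sup>2))) \<longlongrightarrow> 1 * (M * (M + M) / (2 * M\<^sup>2))) F"
    using M by (intro tendsto_intros r1 h) auto
  then have lim: "((\<lambda>x. (M - h x) / (c * \<bar>x\<bar> powr m) * (M * (M + h x) / (2 * (h x)\<^sup>2))) \<longlongrightarrow> 1) F"
    using M by (simp add: power2_eq_square)
  have hpos: "eventually (\<lambda>x. h x > 0) F" using order_tendstoD(1)[OF h M] .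
  show ?thesis
  proof (rule Lim_transform_eventually[OF lim])
    show "eventually (\<lambda>x. (M - h x) / (c * \<bar>x\<bar> powr m) * (M * (M + h x) / (2 * (h x)\<^sup>2))
        = pi\<^sup>2 * (1 / (h x)\<^sup>2 - 1 / M\<^sup>2) / (2 * pi\<^sup>2 / M ^ 3 * c * \<bar>x\<bar> powr m)) F"
      using hpos xpos
    proof eventually_elim
      case (elim x)
      define t where "t = \<bar>x\<bar> powr m"
      have t: "t \<noteq> 0" unfolding t_def using elim by simp
      show ?case unfolding t_def[symmetric] using elim(1) M c t pi_gt_zero
        by (simp add: field_simps power2_eq_square power3_eq_cube)
    qed
  qed
qed

locale thin_strip =
  fixes a b M cp cm m :: real and h h' :: "real \<Rightarrow> real" and I :: "real set"
  assumes ab: "a > 0" "b > 0" and I: "I = {-a..b}"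
    and h_cont: "continuous_on I h"
    and h_pos: "\<And>x. x \<in> I \<Longrightarrow> h x > 0"
    and h_max: "\<And>x. x \<in> I \<Longrightarrow> x \<noteq> 0 \<Longrightarrow> h x < h 0"
    and h'_cont: "continuous_on (I - {0}) h'"
    and h'_L2: "set_integrable lborel I (\<lambda>x. (h' x)\<^sup>2)"
    and M: "M > 0" and cpm: "cp > 0" "cm > 0" and m: "m \<ge> 1"
    and expand_right: "(\<lambda>x. h x - (M - cp * x powr m)) \<in> O[at_right 0](\<lambda>x. x powr (m + 1))"
    and expand_left: "(\<lambda>x. h x - (M - cm * \<bar>x\<bar> powr m)) \<in> O[at_left 0](\<lambda>x. \<bar>x\<bar> powr (m + 1))"
begin

text \<open>Up to the factor $\varepsilon^{-2}$ this is the singular part of $W_\varepsilon$, to be compared with \<open>q\<close>.\<close>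

definition V0 :: "real \<Rightarrow> real" where "V0 x = pi\<^sup>2 * (1 / (h x)\<^sup>2 - 1 / M\<^sup>2)"

definition q :: "real \<Rightarrow> real" where "q = q_pot M cp cm m"

lemma zero_interior: "0 \<in> interior I"
  unfolding I using ab by (simp add: interior_atLeastAtMost_real)

lemma h_tendsto: "(h \<longlongrightarrow> h 0) (at 0)"
  using continuous_on_interior[OF h_cont zero_interior] by (simp add: isCont_def)

lemma h_tendsto_sides: "(h \<longlongrightarrow> h 0) (at_right 0)" "(h \<longlongrightarrow> h 0) (at_left 0)"
  by (rule filterlim_mono[OF h_tendsto order_refl at_le], simp)+

lemma expansion:
  obtains C where "C > 0" "eventually (\<lambda>x. \<bar>h x - (M - cp * \<bar>x\<bar> powr m)\<bar> \<le> C * \<bar>x\<bar> powr (m + 1)) (at_right 0)"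
    "eventually (\<lambda>x. \<bar>h x - (M - cm * \<bar>x\<bar> powr m)\<bar> \<le> C * \<bar>x\<bar> powr (m + 1)) (at_left 0)"
proof -
  obtain C1 where C1: "C1 > 0" "eventually (\<lambda>x. norm (h x - (M - cp * x powr m)) \<le> C1 * norm (x powr (m + 1))) (at_right 0)"
    using landau_o.bigE[OF expand_right] by blast
  obtain C2 where C2: "C2 > 0" "eventually (\<lambda>x. norm (h x - (M - cm * \<bar>x\<bar> powr m)) \<le> C2 * norm (\<bar>x\<bar> powr (m + 1))) (at_left 0)"
    using landau_o.bigE[OF expand_left] by blast
  have "eventually (\<lambda>x::real. x > 0) (at_right 0)" by (rule eventually_at_right_less)
  with C1(2) have "eventually (\<lambda>x. \<bar>h x - (M - cp * \<bar>x\<bar> powr m)\<bar> \<le> max C1 C2 * \<bar>x\<bar> powr (m + 1)) (at_right 0)"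
  proof eventually_elim
    case (elim x)
    have "\<bar>h x - (M - cp * x powr m)\<bar> \<le> C1 * x powr (m + 1)" using elim(1) by simp
    also have "\<dots> \<le> max C1 C2 * x powr (m + 1)" by (intro mult_right_mono) auto
    finally show ?case using elim(2) by simp
  qed
  moreover have "eventually (\<lambda>x. \<bar>h x - (M - cm * \<bar>x\<bar> powr m)\<bar> \<le> max C1 C2 * \<bar>x\<bar> powr (m + 1)) (at_left 0)"
    using C2(2)
  proof eventually_elim
    case (elim x)
    have "\<bar>h x - (M - cm * \<bar>x\<bar> powr m)\<bar> \<le> C2 * \<bar>x\<bar> powr (m + 1)" using elim by simp
    also have "\<dots> \<le> max C1 C2 * \<bar>x\<bar> powr (m + 1)" by (intro mult_right_mono) auto
    finally show ?case .
  qed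
  moreover have "max C1 C2 > 0" using C1 by simp
  ultimately show thesis using that by blast
qed

text \<open>The expansion determines the limit of \<open>h\<close> at \<open>0\<close>, and \<open>h\<close> is continuous.\<close>

lemma h_0: "h 0 = M"
proof -
  obtain C where C: "eventually (\<lambda>x. \<bar>h x - (M - cp * \<bar>x\<bar> powr m)\<bar> \<le> C * \<bar>x\<bar> powr (m + 1)) (at_right 0)"
    using expansion by blast
  have z: "((\<lambda>x::real. \<bar>x\<bar> powr p) \<longlongrightarrow> 0) (at_right 0)" if "p > 0" for p
    by (rule tendsto_zero_powrI[OF _ tendsto_const]) (auto intro!: tendsto_rabs_zero tendsto_ident_at that)
  have "((\<lambda>x. h x - (M - cp * \<bar>x\<bar> powr m)) \<longlongrightarrow> 0) (at_right 0)"
  proof (rule Lim_null_comparison)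
    show "eventually (\<lambda>x. norm (h x - (M - cp * \<bar>x\<bar> powr m)) \<le> C * \<bar>x\<bar> powr (m + 1)) (at_right 0)" using C by simp
    show "((\<lambda>x. C * \<bar>x\<bar> powr (m + 1)) \<longlongrightarrow> 0) (at_right 0)"
      using tendsto_mult_right_zero[OF z[of "m + 1"]] m by simp
  qed
  moreover have "((\<lambda>x. h x - (M - cp * \<bar>x\<bar> powr m)) \<longlongrightarrow> h 0 - (M - cp * 0)) (at_right 0)"
    by (intro tendsto_intros h_tendsto_sides z) (use m in simp)
  ultimately have "h 0 - (M - cp * 0) = 0" by (rule tendsto_unique[OF trivial_limit_at_right_real, rotated])
  then show ?thesis by simp
qed

lemma q_eq: "q x = 2 * pi\<^sup>2 / M ^ 3 * (if x > 0 then cp else cm) * \<bar>x\<bar> powr m"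
  unfolding q_def q_pot_def by simp

lemma q_nonneg: "q x \<ge> 0"
  unfolding q_eq using M cpm by simp

text \<open>The one sided limits give the bound in a punctured neighbourhood of \<open>0\<close>; at \<open>0\<close> both functions vanish.\<close>

lemma V0_approx:
  assumes "\<eta> > 0"
  obtains \<rho> where "\<rho> > 0" "{-\<rho>..\<rho>} \<subseteq> interior I" "\<And>x. x \<in> {-\<rho>..\<rho>} \<Longrightarrow> \<bar>q x - V0 x\<bar> \<le> \<eta> * q x"
proof -
  obtain C where C: "eventually (\<lambda>x. \<bar>h x - (M - cp * \<bar>x\<bar> powr m)\<bar> \<le> C * \<bar>x\<bar> powr (m + 1)) (at_right 0)"
    "eventually (\<lambda>x. \<bar>h x - (M - cm * \<bar>x\<bar> powr m)\<bar> \<le> C * \<bar>x\<bar> powr (m + 1)) (at_left 0)"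
    using expansion by blast
  have step: "eventually (\<lambda>x. \<bar>2 * pi\<^sup>2 / M ^ 3 * c * \<bar>x\<bar> powr m - V0 x\<bar> \<le> \<eta> * (2 * pi\<^sup>2 / M ^ 3 * c * \<bar>x\<bar> powr m)) F"
    if lim: "((\<lambda>x. pi\<^sup>2 * (1 / (h x)\<^sup>2 - 1 / M\<^sup>2) / (2 * pi\<^sup>2 / M ^ 3 * c * \<bar>x\<bar> powr m)) \<longlongrightarrow> 1) F"
      and x: "eventually (\<lambda>x::real. x \<noteq> 0) F" and c: "c > 0" for c F
    using tendstoD[OF lim assms] x
  proof eventually_elim
    case (elim x)
    define Q where "Q = 2 * pi\<^sup>2 / M ^ 3 * c * \<bar>x\<bar> powr m"
    have Q: "Q > 0" unfolding Q_def using M c elim by simp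
    have "\<bar>V0 x / Q - 1\<bar> < \<eta>" using elim(1) unfolding V0_def Q_def dist_real_def by simp
    then have "\<bar>V0 x / Q - 1\<bar> * Q \<le> \<eta> * Q" using Q by (intro mult_right_mono) auto
    moreover have "\<bar>V0 x / Q - 1\<bar> * Q = \<bar>(V0 x / Q - 1) * Q\<bar>" using Q by (simp add: abs_mult)
    moreover have "(V0 x / Q - 1) * Q = V0 x - Q" using Q by (simp add: field_simps)
    ultimately have "\<bar>Q - V0 x\<bar> \<le> \<eta> * Q" by (simp add: abs_minus_commute)
    then show ?case unfolding Q_def .
  qed
  have nz: "eventually (\<lambda>x::real. x \<noteq> 0) (at_right 0)" "eventually (\<lambda>x::real. x \<noteq> 0) (at_left 0)"
    by (auto simp: eventually_at_filter)
  have "eventually (\<lambda>x. \<bar>q x - V0 x\<bar> \<le> \<eta> * q x) (at_right 0)"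
    using step[OF potential_ratio_tendsto[OF h_tendsto_sides(1)[unfolded h_0] tendsto_ident_at nz(1) M cpm(1) C(1)] nz(1) cpm(1)]
      eventually_at_right_less[of "0::real"]
    by eventually_elim (simp add: q_eq)
  moreover have "eventually (\<lambda>x. \<bar>q x - V0 x\<bar> \<le> \<eta> * q x) (at_left 0)"
  proof -
    have "eventually (\<lambda>x::real. x < 0) (at_left 0)" by (auto simp: eventually_at_filter)
    with step[OF potential_ratio_tendsto[OF h_tendsto_sides(2)[unfolded h_0] tendsto_ident_at nz(2) M cpm(2) C(2)] nz(2) cpm(2)]
    show ?thesis by eventually_elim (simp add: q_eq)
  qed
  ultimately have "eventually (\<lambda>x. \<bar>q x - V0 x\<bar> \<le> \<eta> * q x) (at 0)"
    by (simp add: eventually_at_split)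
  then obtain d where d: "d > 0" "\<And>x. x \<noteq> 0 \<Longrightarrow> \<bar>x\<bar> < d \<Longrightarrow> \<bar>q x - V0 x\<bar> \<le> \<eta> * q x"
    unfolding eventually_at by (auto simp: dist_real_def)
  define \<rho> where "\<rho> = min (d / 2) (min (a / 2) (b / 2))"
  have \<rho>: "\<rho> > 0" "\<rho> < d" "\<rho> < a" "\<rho> < b" unfolding \<rho>_def using d(1) ab by auto
  show thesis
  proof (rule that[OF \<rho>(1)])
    show "{-\<rho>..\<rho>} \<subseteq> interior I" unfolding I using \<rho> by (auto simp: interior_atLeastAtMost_real)
    show "\<bar>q x - V0 x\<bar> \<le> \<eta> * q x" if "x \<in> {-\<rho>..\<rho>}" for x
    proof (cases "x = 0")
      case True
      then show ?thesis by (simp add: V0_def q_eq h_0)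
    next
      case False
      show ?thesis by (rule d(2)[OF False]) (use that \<rho> in auto)
    qed
  qed
qed

lemma V0_cont: "continuous_on I V0"
  unfolding V0_def[abs_def] using h_pos h_cont by (intro continuous_intros) (auto simp: less_le)

lemma V0_nonneg:
  assumes "x \<in> I" shows "V0 x \<ge> 0" and V0_pos: "x \<noteq> 0 \<Longrightarrow> V0 x > 0"
proof -
  have "h x \<le> M" using h_max[OF assms] h_0 by (cases "x = 0") auto
  then have "(h x)\<^sup>2 \<le> M\<^sup>2" using h_pos[OF assms] by (intro power_mono) auto
  then have "1 / M\<^sup>2 \<le> 1 / (h x)\<^sup>2" using h_pos[OF assms] M by (intro divide_left_mono) auto
  then show "V0 x \<ge> 0" unfolding V0_def by simp
  assume "x \<noteq> 0"
  then have "h x < M" using h_max[OF assms] h_0 by simp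
  then have "(h x)\<^sup>2 < M\<^sup>2" using h_pos[OF assms] by (intro power_strict_mono) auto
  then have "1 / M\<^sup>2 < 1 / (h x)\<^sup>2" using h_pos[OF assms] M by (intro divide_strict_left_mono) auto
  then show "V0 x > 0" unfolding V0_def by simp
qed

text \<open>Near the maximum this is the expansion, away from it compactness.\<close>

lemma potentials_lower_bound:
  obtains \<kappa> where "\<kappa> > 0" "\<And>x. x \<in> I \<Longrightarrow> V0 x \<ge> \<kappa> * \<bar>x\<bar> powr m" "\<And>x. q x \<ge> \<kappa> * \<bar>x\<bar> powr m"
proof -
  obtain \<rho> where \<rho>: "\<rho> > 0" "{-\<rho>..\<rho>} \<subseteq> interior I" "\<And>x. x \<in> {-\<rho>..\<rho>} \<Longrightarrow> \<bar>q x - V0 x\<bar> \<le> 1/2 * q x"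
    using V0_approx[of "1/2"] by auto
  define k1 where "k1 = 2 * pi\<^sup>2 / M ^ 3 * min cp cm"
  have k1: "k1 > 0" unfolding k1_def using M cpm by simp
  have q1: "q x \<ge> k1 * \<bar>x\<bar> powr m" for x
    unfolding q_eq k1_def using M cpm by (intro mult_right_mono mult_left_mono) auto
  let ?K = "I - {-\<rho><..<\<rho>}"
  have cK: "compact ?K" unfolding I by (intro compact_diff) auto
  have \<rho>I: "\<rho> \<in> I" using \<rho>(1,2) interior_subset by fastforce
  then have ne: "?K \<noteq> {}" by auto
  have "continuous_on ?K V0" by (rule continuous_on_subset[OF V0_cont]) auto
  from continuous_attains_inf[OF cK ne this] obtain z where z: "z \<in> ?K" "\<And>x. x \<in> ?K \<Longrightarrow> V0 z \<le> V0 x" by blast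
  have zpos: "V0 z > 0" using z(1) \<rho>(1) by (intro V0_pos) auto
  define L where "L = (a + b) powr m"
  have L: "L > 0" unfolding L_def using ab by simp
  define \<kappa> where "\<kappa> = min (k1 / 2) (V0 z / L)"
  show thesis
  proof (rule that[of \<kappa>])
    show "\<kappa> > 0" unfolding \<kappa>_def using k1 zpos L by simp
    show "q x \<ge> \<kappa> * \<bar>x\<bar> powr m" for x
    proof -
      have "\<kappa> * \<bar>x\<bar> powr m \<le> k1 * \<bar>x\<bar> powr m" unfolding \<kappa>_def using k1 by (intro mult_right_mono) auto
      then show ?thesis using q1[of x] by linarith
    qed
    show "V0 x \<ge> \<kappa> * \<bar>x\<bar> powr m" if x: "x \<in> I" for x
    proof (cases "x \<in> ?K")
      case True
      have "\<bar>x\<bar> powr m \<le> L" unfolding L_def using x m ab by (intro powr_mono2) (auto simp: I)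
      then have "\<kappa> * \<bar>x\<bar> powr m \<le> V0 z / L * L"
        unfolding \<kappa>_def using zpos L k1 by (intro mult_mono) auto
      then show ?thesis using z(2)[OF True] L by simp
    next
      case False
      then have "x \<in> {-\<rho>..\<rho>}" using x by auto
      from \<rho>(3)[OF this] have "V0 x \<ge> q x / 2" by linarith
      moreover have "\<kappa> * \<bar>x\<bar> powr m \<le> k1 / 2 * \<bar>x\<bar> powr m"
        unfolding \<kappa>_def by (rule mult_right_mono[OF min.cobounded1]) simp
      ultimately show ?thesis using q1[of x] by simp
    qed
  qed
qed

text \<open>The part of $W_\varepsilon$ that contains \<open>h'\<close>. It may be unbounded near \<open>0\<close>, but it is integrable and does
  not depend on \<open>\<epsilon>\<close>.\<close>

definition G :: "real \<Rightarrow> real" where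
  "G x = indicator I x * ((pi\<^sup>2 / 3 + 1 / 4) * ((h' x)\<^sup>2 / (h x)\<^sup>2))"

text \<open>Off \<open>I\<close> the functions \<open>h\<close> and \<open>h'\<close> are arbitrary; the value \<open>0\<close> makes the potential measurable on the line.\<close>

definition V :: "real \<Rightarrow> real \<Rightarrow> real" where
  "V \<epsilon> x = indicator I x * W_pot h h' M \<epsilon> x"

lemma V_eq: "V \<epsilon> x = indicator I x * V0 x / \<epsilon>\<^sup>2 + G x"
  unfolding V_def G_def W_pot_def V0_def by (simp add: algebra_simps diff_divide_distrib)

lemma I_borel: "I \<in> sets borel"
  unfolding I by simp

lemma G_nonneg: "G x \<ge> 0"
  unfolding G_def by simp

lemma G_measurable [measurable]: "G \<in> borel_measurable borel"
proof -
  let ?g = "\<lambda>x. (pi\<^sup>2 / 3 + 1 / 4) * ((h' x)\<^sup>2 / (h x)\<^sup>2)"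
  have "continuous_on (I - {0}) ?g"
    using h_pos by (intro continuous_intros h'_cont continuous_on_subset[OF h_cont]) (auto simp: less_le)
  then have "(\<lambda>x. indicator (I - {0}) x *\<^sub>R ?g x) \<in> borel_measurable borel"
    by (rule borel_measurable_continuous_on_indicator[rotated]) (use I_borel in auto)
  then have "(\<lambda>x. indicator (I - {0}) x *\<^sub>R ?g x + indicator {0} x * G 0) \<in> borel_measurable borel"
    by measurable
  also have "(\<lambda>x. indicator (I - {0}) x *\<^sub>R ?g x + indicator {0} x * G 0) = G"
    unfolding G_def by (auto simp: fun_eq_iff split: split_indicator)
  finally show ?thesis .
qed

lemma G_integrable: "integrable lborel G"
proof -
  have ne: "I \<noteq> {}" and c: "compact I" unfolding I using ab by auto
  obtain z where z: "z \<in> I" "\<And>x. x \<in> I \<Longrightarrow> h z \<le> h x" using continuous_attains_inf[OF c ne h_cont] by blast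
  define K where "K = (pi\<^sup>2 / 3 + 1 / 4) / (h z)\<^sup>2"
  have hz: "h z > 0" by (rule h_pos[OF z(1)])
  have "integrable lborel (\<lambda>x. K * (indicator I x *\<^sub>R (h' x)\<^sup>2))"
    using h'_L2 unfolding set_integrable_def by (rule integrable_mult_right)
  then show ?thesis
  proof (rule Bochner_Integration.integrable_bound)
    show "AE x in lborel. norm (G x) \<le> norm (K * (indicator I x *\<^sub>R (h' x)\<^sup>2))"
    proof (rule AE_I2)
      fix x
      show "norm (G x) \<le> norm (K * (indicator I x *\<^sub>R (h' x)\<^sup>2))"
      proof (cases "x \<in> I")
        case True
        have "(h z)\<^sup>2 \<le> (h x)\<^sup>2" using z(2)[OF True] hz by (intro power_mono) auto
        then have "(h' x)\<^sup>2 / (h x)\<^sup>2 \<le> (h' x)\<^sup>2 / (h z)\<^sup>2"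
          using hz h_pos[OF True] by (intro divide_left_mono) auto
        then have "(pi\<^sup>2 / 3 + 1 / 4) * ((h' x)\<^sup>2 / (h x)\<^sup>2) \<le> (pi\<^sup>2 / 3 + 1 / 4) * ((h' x)\<^sup>2 / (h z)\<^sup>2)"
          by (intro mult_left_mono) (auto intro: add_nonneg_nonneg)
        then have "G x \<le> K * (h' x)\<^sup>2" unfolding G_def K_def using True by simp
        then show ?thesis using True G_nonneg[of x] by simp
      qed (simp add: G_def)
    qed
  qed measurable
qed

lemma V_measurable [measurable]: "V \<epsilon> \<in> borel_measurable borel"
proof -
  have "(\<lambda>x. indicator I x *\<^sub>R V0 x) \<in> borel_measurable borel"
    by (rule borel_measurable_continuous_on_indicator[OF I_borel V0_cont])
  then have "(\<lambda>x. indicator I x * V0 x / \<epsilon>\<^sup>2 + G x) \<in> borel_measurable borel" by simp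
  then show ?thesis unfolding V_eq[abs_def] .
qed

lemma V_nonneg: "V \<epsilon> x \<ge> 0"
  unfolding V_eq using V0_nonneg[of x] G_nonneg[of x] by (auto split: split_indicator)

lemma V_integrable: "integrable lborel (V \<epsilon>)"
proof -
  have "compact I" unfolding I by simp
  from borel_integrable_compact[OF this V0_cont] have "integrable lborel (\<lambda>x. indicator I x * V0 x)" by simp
  then have "integrable lborel (\<lambda>x. indicator I x * V0 x / \<epsilon>\<^sup>2 + G x)"
    using G_integrable by (intro Bochner_Integration.integrable_add) auto
  then show ?thesis unfolding V_eq[abs_def] .
qed

lemma I_domain: "interval_domain I"
  unfolding I by simp

lemma I_interval:
  assumes "r \<le> a + b" "r > 0" "x \<in> I" shows "\<exists>s. s \<le> x \<and> x \<le> s + r \<and> {s..s+r} \<subseteq> I"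
proof (rule exI)
  show "max (-a) (x - r) \<le> x \<and> x \<le> max (-a) (x - r) + r \<and> {max (-a) (x - r)..max (-a) (x - r) + r} \<subseteq> I"
    using assms ab unfolding I by auto
qed

lemma schroedinger_V: "schroedinger I (V \<epsilon>)"
  by (rule schroedinger.intro[OF I_domain V_measurable V_nonneg])

lemma schroedinger_q: "schroedinger UNIV (\<lambda>x. q x / \<epsilon>\<^sup>2)"
proof (rule schroedinger.intro)
  show "(\<lambda>x. q x / \<epsilon>\<^sup>2) \<in> borel_measurable borel" unfolding q_eq by measurable
qed (use q_nonneg in auto)

text \<open>Functions of $H^1(I)$ are bounded and the potential is integrable.\<close>

lemma form_dom_I_eq: "schroedinger.form_dom I (V \<epsilon>) = H1 I"
proof -
  interpret Q: schroedinger I "V \<epsilon>" by (rule schroedinger_V)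
  have "integrable lborel (\<lambda>x. V \<epsilon> x * (cmod (u x))\<^sup>2)" if u: "u \<in> H1 I" for u
  proof -
    define s where "s = 2 / (a + b) * (l2_norm u)\<^sup>2 + 2 * (a + b) * (l2_norm (weak_deriv I u))\<^sup>2"
    have s: "AE x in lborel. (cmod (u x))\<^sup>2 \<le> s" unfolding s_def
      by (rule sobolev_sup_bound[OF I_domain u _ I_interval]) (use ab in auto)
    show ?thesis
    proof (rule Bochner_Integration.integrable_bound)
      show "integrable lborel (\<lambda>x. V \<epsilon> x * s)" using V_integrable by simp
      show "AE x in lborel. norm (V \<epsilon> x * (cmod (u x))\<^sup>2) \<le> norm (V \<epsilon> x * s)"
        using s
      proof eventually_elim
        case (elim x)
        then have "V \<epsilon> x * (cmod (u x))\<^sup>2 \<le> V \<epsilon> x * s" using V_nonneg by (intro mult_left_mono)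
        then show ?case using V_nonneg[of \<epsilon> x] by simp
      qed
      show "(\<lambda>x. V \<epsilon> x * (cmod (u x))\<^sup>2) \<in> borel_measurable lborel"
        using L2_measurable[OF H1_L2[OF u]] by measurable
    qed
  qed
  then show ?thesis unfolding Q.form_dom_def by auto
qed

text \<open>With the length scale $r = \varepsilon^\alpha$ the relation $\alpha (m+2) = 2$ reads
  $r^m/\varepsilon^2 = r^{-2}$: at distance \<open>r\<close> from the origin the potential balances the kinetic
  energy.\<close>

lemma potential_at_scale:
  assumes e: "\<epsilon> > 0" and r: "r = \<epsilon> powr (2 / (m + 2))" and \<kappa>: "\<kappa> > 0" and x: "\<bar>x\<bar> \<ge> r"
  shows "\<kappa> * \<bar>x\<bar> powr m / \<epsilon>\<^sup>2 \<ge> \<kappa> / r\<^sup>2"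
proof -
  have r0: "r > 0" unfolding r using e by simp
  have "r powr m * r\<^sup>2 = r powr (m + 2)" using r0 by (simp add: powr_add powr_numeral)
  also have "\<dots> = \<epsilon> powr (2 / (m + 2) * (m + 2))" unfolding r powr_powr ..
  also have "\<dots> = \<epsilon> powr 2"
    by (rule arg_cong[where f = "\<lambda>t. \<epsilon> powr t"]) (use m in \<open>simp add: field_simps\<close>)
  also have "\<dots> = \<epsilon>\<^sup>2" using e by (simp add: powr_numeral)
  finally have eq: "r powr m * r\<^sup>2 = \<epsilon>\<^sup>2" .
  have "\<kappa> / r\<^sup>2 = \<kappa> * r powr m / \<epsilon>\<^sup>2" unfolding eq[symmetric] using r0 by (simp add: field_simps)
  also have "\<dots> \<le> \<kappa> * \<bar>x\<bar> powr m / \<epsilon>\<^sup>2"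
    using x r0 m \<kappa> by (intro divide_right_mono mult_left_mono powr_mono2) auto
  finally show ?thesis .
qed

text \<open>What the proof uses of the form domains $H^1_0(I)$ and $H^1(I)$.\<close>

lemma boundary_condition_domain:
  assumes D: "D = H10 I \<or> D = H1 I"
  shows "D \<subseteq> H1 I" "H10 I \<subseteq> D" "(\<lambda>x. 0) \<in> D" "\<And>u w c. u \<in> D \<Longrightarrow> w \<in> D \<Longrightarrow> (\<lambda>x. u x + c * w x) \<in> D"
    "\<And>s u. (\<And>n::nat. s n \<in> D) \<Longrightarrow> u \<in> H1 I \<Longrightarrow> (\<lambda>n. h1_norm I (\<lambda>x. u x - s n x)) \<longlonglongrightarrow> 0 \<Longrightarrow> u \<in> D"
proof -
  show "D \<subseteq> H1 I" "H10 I \<subseteq> D" using D H10_H1 by auto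
  show "(\<lambda>x. 0) \<in> D" using D H10_zero[OF I_domain] H10_H1 by blast
  show "(\<lambda>x. u x + c * w x) \<in> D" if "u \<in> D" "w \<in> D" for u w c
    using D that H10_comb[OF I_domain] H1_comb by blast
  show "u \<in> D" if "\<And>n::nat. s n \<in> D" "u \<in> H1 I" "(\<lambda>n. h1_norm I (\<lambda>x. u x - s n x)) \<longlonglongrightarrow> 0" for s u
    using D that H10_closed[OF I_domain, of s u] by blast
qed

text \<open>The comparison for fixed \<open>\<epsilon>\<close>, with the powers of \<open>r\<close> and \<open>\<epsilon>\<close> made explicit: away from the maximum the
  potentials are at least $(k_1/\varepsilon)^2$.\<close>

lemma op_norm_bound_at_scale:
  assumes D: "D = H10 I \<or> D = H1 I" and e: "\<epsilon> > 0" and r: "r = \<epsilon> powr (2 / (m + 2))" and ra: "3 * r \<le> a" "3 * r \<le> b"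
    and \<kappa>: "\<kappa> > 0" "\<And>x. x \<in> I \<Longrightarrow> V0 x \<ge> \<kappa> * \<bar>x\<bar> powr m" "\<And>x. q x \<ge> \<kappa> * \<bar>x\<bar> powr m"
    and \<rho>: "\<rho> > 0" "{-\<rho>..\<rho>} \<subseteq> interior I" "\<And>x. x \<in> {-\<rho>..\<rho>} \<Longrightarrow> \<bar>q x - V0 x\<bar> \<le> \<eta> * q x"
    and \<eta>: "0 \<le> \<eta>" "\<eta> \<le> 1 / 2"
    and \<theta>: "\<And>x. (\<theta> has_real_derivative \<theta>' x) (at x)" "continuous_on UNIV \<theta>'" "\<And>x. 0 \<le> \<theta> x" "\<And>x. \<theta> x \<le> 1"
      "\<And>x. \<bar>x\<bar> \<le> \<rho> / 2 \<Longrightarrow> \<theta> x = 1" "\<And>x. x \<notin> {-\<rho>..\<rho>} \<Longrightarrow> \<theta> x = 0"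
      "\<And>x. x \<notin> {-\<rho>..\<rho>} \<Longrightarrow> \<theta>' x = 0" "\<And>x. \<bar>x\<bar> < \<rho> / 2 \<Longrightarrow> \<theta>' x = 0" "\<And>x. \<bar>\<theta>' x\<bar> \<le> B" "B \<ge> 0"
    and C: "C = 8 + 3 / \<kappa>" and k1: "k1 = sqrt (\<kappa> * (\<rho> / 2) powr m)"
  shows "op_norm (diff_op (dsum_op ((scale_op (r\<^sup>2) (form_op I (W_pot h h' M \<epsilon>) D))\<inverse>) (zero_op (UNIV - I)))
      ((scale_op (r\<^sup>2) (H_op M cp cm m \<epsilon>))\<inverse>))
    \<le> ennreal (2 * B * C * \<epsilon> / k1 + 2 * \<eta> * C + (2 * C\<^sup>2 + 2 * C) * r * (\<integral>x. G x \<partial>lborel) + 2 * sqrt C * (\<epsilon> / r) / k1)"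
proof -
  let ?W = "\<lambda>x. q x / \<epsilon>\<^sup>2"
  interpret Q: schroedinger I "V \<epsilon>" by (rule schroedinger_V)
  interpret H: schroedinger UNIV ?W by (rule schroedinger_q)
  note DD = boundary_condition_domain[OF D]
  have QF: "Q.form_dom = H1 I" by (rule form_dom_I_eq)
  have r0: "r > 0" unfolding r using e by simp
  have C0: "C > 0" unfolding C using \<kappa>(1) by (simp add: add_pos_pos)
  have e2: "\<epsilon>\<^sup>2 > 0" using e by simp
  have V_lower: "V \<epsilon> x \<ge> \<kappa> * \<bar>x\<bar> powr m / \<epsilon>\<^sup>2" if "x \<in> I" for x
  proof -
    have "\<kappa> * \<bar>x\<bar> powr m / \<epsilon>\<^sup>2 \<le> V0 x / \<epsilon>\<^sup>2" using \<kappa>(2)[OF that] by (intro divide_right_mono) auto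
    then show ?thesis using that G_nonneg[of x] unfolding V_eq by simp
  qed
  have W_lower: "?W x \<ge> \<kappa> * \<bar>x\<bar> powr m / \<epsilon>\<^sup>2" for x
    using \<kappa>(3)[of x] by (intro divide_right_mono) auto
  have rI: "{-r..3*r} \<subseteq> I" unfolding I using ra r0 by auto
  have cQ: "(l2_norm u)\<^sup>2 \<le> (C * r\<^sup>2) * Q.energy u" if "u \<in> Q.form_dom" for u
    unfolding C by (rule Q.energy_coercive[OF that r0 rI \<kappa>(1)])
      (use V_lower potential_at_scale[OF e r \<kappa>(1)] order_trans in blast)
  have cH: "(l2_norm u)\<^sup>2 \<le> (C * r\<^sup>2) * H.energy u" if "u \<in> H.form_dom" for u
    unfolding C by (rule H.energy_coercive[OF that r0 subset_UNIV \<kappa>(1)])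
      (use W_lower potential_at_scale[OF e r \<kappa>(1)] order_trans in blast)
  have VW: "\<bar>?W x - V \<epsilon> x\<bar> \<le> \<eta> * ?W x + G x" "?W x \<le> 2 * V \<epsilon> x" if "x \<in> {-\<rho>..\<rho>}" for x
  proof -
    have xI: "x \<in> I" using that \<rho>(2) interior_subset by blast
    have Vx: "V \<epsilon> x = V0 x / \<epsilon>\<^sup>2 + G x" unfolding V_eq using xI by simp
    have d: "\<bar>?W x - V0 x / \<epsilon>\<^sup>2\<bar> \<le> \<eta> * ?W x"
    proof -
      have "\<bar>?W x - V0 x / \<epsilon>\<^sup>2\<bar> = \<bar>q x - V0 x\<bar> / \<epsilon>\<^sup>2" by (simp add: diff_divide_distrib[symmetric] abs_divide)
      also have "\<dots> \<le> \<eta> * q x / \<epsilon>\<^sup>2" using \<rho>(3)[OF that] by (intro divide_right_mono) auto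
      finally show ?thesis by simp
    qed
    show "\<bar>?W x - V \<epsilon> x\<bar> \<le> \<eta> * ?W x + G x" using d G_nonneg[of x] unfolding Vx by linarith
    have "\<eta> * ?W x \<le> 1 / 2 * ?W x" using \<eta>(2) H.V_nonneg[of x] by (intro mult_right_mono) auto
    then have "?W x - V0 x / \<epsilon>\<^sup>2 \<le> 1 / 2 * ?W x" using abs_le_D1[OF d] by (rule order_trans[rotated])
    then have "?W x \<le> 2 * (V0 x / \<epsilon>\<^sup>2)" by (simp add: field_simps)
    then show "?W x \<le> 2 * V \<epsilon> x" using G_nonneg[of x] unfolding Vx by simp
  qed
  interpret schroedinger_comparison I "V \<epsilon>" ?W D \<theta> \<theta>' G \<rho> B \<eta>
  proof unfold_locales
    show "D \<subseteq> Q.form_dom" using DD(1) QF by simp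
    show "H10 I \<subseteq> D" by (rule DD(2))
    show "I \<in> sets borel" by (rule I_borel)
    show "\<rho> > 0" "{-\<rho>..\<rho>} \<subseteq> interior I" by (rule \<rho>(1), rule \<rho>(2))
    show "(\<theta> has_real_derivative \<theta>' x) (at x)" "0 \<le> \<theta> x" "\<theta> x \<le> 1" "\<bar>\<theta>' x\<bar> \<le> B" for x
      by (rule \<theta>(1), rule \<theta>(3), rule \<theta>(4), rule \<theta>(9))
    show "continuous_on UNIV \<theta>'" by (rule \<theta>(2))
    show "\<theta> x = 1" if "\<bar>x\<bar> \<le> \<rho> / 2" for x by (rule \<theta>(5)[OF that])
    show "\<theta> x = 0" "\<theta>' x = 0" if "x \<notin> {-\<rho>..\<rho>}" for x by (rule \<theta>(6)[OF that], rule \<theta>(7)[OF that])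
    show "\<theta>' x = 0" if "\<bar>x\<bar> < \<rho> / 2" for x by (rule \<theta>(8)[OF that])
    show "\<eta> \<ge> 0" by (rule \<eta>(1))
    show "\<bar>?W x - V \<epsilon> x\<bar> \<le> \<eta> * ?W x + G x" "?W x \<le> 2 * V \<epsilon> x" if "x \<in> {-\<rho>..\<rho>}" for x
      by (rule VW(1)[OF that], rule VW(2)[OF that])
    show "integrable lborel G" by (rule G_integrable)
    show "G x \<ge> 0" for x by (rule G_nonneg)
  qed
  define k where "k = \<kappa> * (\<rho> / 2) powr m / \<epsilon>\<^sup>2"
  have k0: "k > 0" unfolding k_def using \<kappa>(1) \<rho>(1) e by simp
  have sk: "sqrt k = k1 / \<epsilon>" unfolding k_def k1 using e by (simp add: real_sqrt_divide)
  have k10: "k1 > 0" unfolding k1 using \<kappa>(1) \<rho>(1) by simp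
  have far: "\<kappa> * \<bar>x\<bar> powr m / \<epsilon>\<^sup>2 \<ge> k" if "\<bar>x\<bar> \<ge> \<rho> / 2" for x
    unfolding k_def using that \<rho>(1) m \<kappa>(1) by (intro divide_right_mono mult_left_mono powr_mono2) auto
  have solveH: "\<exists>y. (y, f) \<in> form_op UNIV ?W H.form_dom" if "f \<in> L2 UNIV" for f
  proof -
    have z: "(\<lambda>x. 0) \<in> H.form_dom"
      using H10_zero[of UNIV] H10_H1 H.form_dom_I[of "\<lambda>x. 0"] L2_0 by (auto simp: H.root_mult_def[abs_def])
    show ?thesis
    proof (rule H.form_op_surjective[where D = H.form_dom and f = f and C = "C * r\<^sup>2"])
      show "(\<lambda>x. u x + c * w x) \<in> H.form_dom" if "u \<in> H.form_dom" "w \<in> H.form_dom" for u w c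
        by (rule H.form_dom_comb[OF that])
      show "(l2_norm u)\<^sup>2 \<le> C * r\<^sup>2 * H.energy u" if "u \<in> H.form_dom" for u by (rule cH[OF that])
    qed (use z that in blast)+
  qed
  have solveQ: "\<exists>u. (u, f) \<in> form_op I (V \<epsilon>) D" if "f \<in> L2 I" for f
  proof -
    have sub: "D \<subseteq> Q.form_dom" using DD(1) QF by simp
    have cQ': "(l2_norm u)\<^sup>2 \<le> (C * r\<^sup>2) * Q.energy u" if "u \<in> D" for u using cQ sub that by blast
    show ?thesis
    proof (rule Q.form_op_surjective[where D = D and f = f and C = "C * r\<^sup>2"])
      show "(\<lambda>x. u x + c * w x) \<in> D" if "u \<in> D" "w \<in> D" for u w c by (rule DD(4)[OF that])
      show "u \<in> D" if "\<And>n::nat. s n \<in> D" "u \<in> Q.form_dom" "(\<lambda>n. h1_norm I (\<lambda>x. u x - s n x)) \<longlonglongrightarrow> 0" for s u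
        by (rule DD(5)[OF that(1) that(2)[unfolded QF] that(3)])
      show "(l2_norm u)\<^sup>2 \<le> C * r\<^sup>2 * Q.energy u" if "u \<in> D" for u by (rule cQ'[OF that])
    qed (use sub DD(3) that in blast)+
  qed
  define \<delta> where "\<delta> = 2 * B * C * \<epsilon> / k1 + 2 * \<eta> * C + (2 * C\<^sup>2 + 2 * C) * r * (\<integral>x. G x \<partial>lborel) + 2 * sqrt C * (\<epsilon> / r) / k1"
  have Gn: "(\<integral>x. G x \<partial>lborel) \<ge> 0" using G_nonneg by simp
  have \<delta>0: "\<delta> \<ge> 0"
    unfolding \<delta>_def using C0 e k10 r0 Gn \<eta>(1) \<theta>(10)
    by (intro add_nonneg_nonneg divide_nonneg_nonneg mult_nonneg_nonneg) auto
  have "op_norm (diff_op (dsum_op ((scale_op (r\<^sup>2) (form_op I (V \<epsilon>) D))\<inverse>) (zero_op (UNIV - I)))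
      ((scale_op (r\<^sup>2) (form_op UNIV ?W H.form_dom))\<inverse>)) \<le> ennreal \<delta>"
  proof (rule op_norm_resolvent_difference_le[OF _ _ I_borel _ solveQ solveH _ \<delta>0])
    show "u \<in> L2 I \<and> f \<in> L2 I" if "(u, f) \<in> form_op I (V \<epsilon>) D" for u f
      using that DD(1) H1_L2 unfolding form_op_def by blast
    show "u \<in> L2 UNIV \<and> f \<in> L2 UNIV" if "(u, f) \<in> form_op UNIV ?W H.form_dom" for u f
      using that H.form_dom_L2 unfolding form_op_def by blast
    show "r\<^sup>2 > 0" using r0 by simp
    fix f u y
    assume f: "f \<in> L2 UNIV" and u: "(u, \<lambda>x. indicator I x * f x) \<in> form_op I (V \<epsilon>) D" and y: "(y, f) \<in> form_op UNIV ?W H.form_dom"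
    have uF: "u \<in> Q.form_dom" using u DD(1) QF unfolding form_op_def by blast
    have yF: "y \<in> H.form_dom" using y unfolding form_op_def by blast
    have "(\<lambda>x. u x - y x) \<in> L2 UNIV" by (rule L2_diff[OF L2_UNIV[OF Q.form_dom_L2[OF uF]] H.form_dom_L2[OF yF]])
    from solveH[OF this] obtain w where w: "(w, \<lambda>x. u x - y x) \<in> form_op UNIV ?W H.form_dom" by blast
    have wF: "w \<in> H.form_dom" using w unfolding form_op_def by blast
    have rab: "r \<le> a + b" using ra r0 by linarith
    have "l2_norm (\<lambda>x. u x - y x) \<le> (2 * B * C * r\<^sup>2 / sqrt k + 2 * \<eta> * C * r\<^sup>2
      + (2 * C\<^sup>2 + 2 * C) * r^3 * (\<integral>x. G x \<partial>lborel) + 2 * sqrt C * r / sqrt k) * l2_norm f"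
      by (rule resolvent_difference_bound[OF u f y w C0 r0 cQ[OF uF] cH[OF wF] I_interval[OF rab r0] k0])
        (use far V_lower W_lower order_trans in blast)+
    also have "2 * B * C * r\<^sup>2 / sqrt k + 2 * \<eta> * C * r\<^sup>2
      + (2 * C\<^sup>2 + 2 * C) * r^3 * (\<integral>x. G x \<partial>lborel) + 2 * sqrt C * r / sqrt k = r\<^sup>2 * \<delta>"
      unfolding sk \<delta>_def using r0 e k10 by (simp add: field_simps power2_eq_square power3_eq_cube)
    finally show "l2_norm (\<lambda>x. u x - y x) \<le> r\<^sup>2 * \<delta> * l2_norm f" .
  qed
  moreover have "form_op I (W_pot h h' M \<epsilon>) D = form_op I (V \<epsilon>) D"
    by (rule form_op_cong[OF DD(1)]) (simp add: V_def)
  moreover have "H_op M cp cm m \<epsilon> = form_op UNIV ?W H.form_dom"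
    unfolding H_op_def schroed_line_def H.form_dom_def by (simp only: q_def)
  ultimately show ?thesis unfolding \<delta>_def by simp
qed

text \<open>The term $2\eta C$ does not tend to zero with \<open>\<epsilon>\<close>, so \<open>\<eta>\<close> is chosen first, depending on the desired bound;
  it determines the support of the cutoff, and then the other terms tend to zero since $0 < \alpha < 1$.\<close>

lemma resolvent_convergence:
  assumes D: "D = H10 I \<or> D = H1 I"
  shows "((\<lambda>\<epsilon>. op_norm (diff_op
      (dsum_op ((scale_op (\<epsilon> powr (2 * (2 / (m + 2)))) (form_op I (W_pot h h' M \<epsilon>) D))\<inverse>) (zero_op (UNIV - I)))
      ((scale_op (\<epsilon> powr (2 * (2 / (m + 2)))) (H_op M cp cm m \<epsilon>))\<inverse>))) \<longlongrightarrow> 0) (at_right 0)"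
    (is "(?N \<longlongrightarrow> 0) _")
proof -
  have small: "eventually (\<lambda>\<epsilon>. ?N \<epsilon> \<le> ennreal \<delta>) (at_right 0)" if \<delta>: "\<delta> > 0" for \<delta>
  proof -
    obtain \<kappa> where \<kappa>: "\<kappa> > 0" "\<And>x. x \<in> I \<Longrightarrow> V0 x \<ge> \<kappa> * \<bar>x\<bar> powr m" "\<And>x. q x \<ge> \<kappa> * \<bar>x\<bar> powr m"
      using potentials_lower_bound by blast
    define C where "C = 8 + 3 / \<kappa>"
    have C: "C > 0" unfolding C_def using \<kappa>(1) by (simp add: add_pos_pos)
    define \<eta> where "\<eta> = min (1 / 2) (\<delta> / (4 * C))"
    have \<eta>: "\<eta> > 0" "\<eta> \<le> 1 / 2" unfolding \<eta>_def using \<delta> C by auto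
    have "\<eta> \<le> \<delta> / (4 * C)" unfolding \<eta>_def by simp
    then have \<eta>C: "2 * \<eta> * C \<le> \<delta> / 2" using C by (simp add: field_simps)
    obtain \<rho> where \<rho>: "\<rho> > 0" "{-\<rho>..\<rho>} \<subseteq> interior I" "\<And>x. x \<in> {-\<rho>..\<rho>} \<Longrightarrow> \<bar>q x - V0 x\<bar> \<le> \<eta> * q x"
      using V0_approx[OF \<eta>(1)] by blast
    obtain \<theta> \<theta>' :: "real \<Rightarrow> real" and B :: real
      where \<theta>: "\<And>x. (\<theta> has_real_derivative \<theta>' x) (at x)" "continuous_on UNIV \<theta>'" "\<And>x. 0 \<le> \<theta> x" "\<And>x. \<theta> x \<le> 1"
      "\<And>x. \<bar>x\<bar> \<le> \<rho> / 2 \<Longrightarrow> \<theta> x = 1" "\<And>x. x \<notin> {-\<rho>..\<rho>} \<Longrightarrow> \<theta> x = 0"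
      "\<And>x. x \<notin> {-\<rho>..\<rho>} \<Longrightarrow> \<theta>' x = 0" "\<And>x. \<bar>x\<bar> < \<rho> / 2 \<Longrightarrow> \<theta>' x = 0" "\<And>x. \<bar>\<theta>' x\<bar> \<le> B" "B \<ge> 0"
      using \<rho>(1) by (rule C1_cutoff) (rule that)
    define k1 where "k1 = sqrt (\<kappa> * (\<rho> / 2) powr m)"
    have k1: "k1 > 0" unfolding k1_def using \<kappa>(1) \<rho>(1) by simp
    define p where "p = 2 / (m + 2)"
    have p: "0 < p" "p < 1" unfolding p_def using m by auto
    have z: "((\<lambda>\<epsilon>::real. \<epsilon> powr t) \<longlongrightarrow> 0) (at_right 0)" if "t > 0" for t
      by (rule tendsto_zero_powrI[OF tendsto_ident_at tendsto_const _ that])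
        (auto simp: eventually_at_filter)
    have "((\<lambda>\<epsilon>. 2 * B * C * \<epsilon> / k1 + (2 * C\<^sup>2 + 2 * C) * \<epsilon> powr p * (\<integral>x. G x \<partial>lborel) + 2 * sqrt C * \<epsilon> powr (1 - p) / k1)
        \<longlongrightarrow> 2 * B * C * 0 / k1 + (2 * C\<^sup>2 + 2 * C) * 0 * (\<integral>x. G x \<partial>lborel) + 2 * sqrt C * 0 / k1) (at_right 0)"
      using k1 p by (intro tendsto_intros z) auto
    then have "((\<lambda>\<epsilon>. 2 * B * C * \<epsilon> / k1 + (2 * C\<^sup>2 + 2 * C) * \<epsilon> powr p * (\<integral>x. G x \<partial>lborel) + 2 * sqrt C * \<epsilon> powr (1 - p) / k1)
        \<longlongrightarrow> 0) (at_right 0)" by simp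
    from order_tendstoD(2)[OF this, of "\<delta> / 2"] \<delta>
    have ev1: "eventually (\<lambda>\<epsilon>. 2 * B * C * \<epsilon> / k1 + (2 * C\<^sup>2 + 2 * C) * \<epsilon> powr p * (\<integral>x. G x \<partial>lborel) + 2 * sqrt C * \<epsilon> powr (1 - p) / k1 < \<delta> / 2) (at_right 0)"
      by simp
    have ev2: "eventually (\<lambda>\<epsilon>::real. \<epsilon> powr p < min (a / 3) (b / 3)) (at_right 0)"
      by (rule order_tendstoD(2)[OF z[OF p(1)]]) (use ab in auto)
    show ?thesis
      using ev1 ev2 eventually_at_right_less[of "0::real"]
    proof eventually_elim
      case (elim \<epsilon>)
      define r where "r = \<epsilon> powr p"
      have r0: "r > 0" unfolding r_def using elim by simp
      have r2: "\<epsilon> powr (2 * (2 / (m + 2))) = r\<^sup>2"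
        unfolding r_def p_def using elim by (simp add: powr_numeral[symmetric] powr_powr mult.commute)
      have er: "\<epsilon> / r = \<epsilon> powr (1 - p)" unfolding r_def using elim by (simp add: powr_diff)
      have "?N \<epsilon> \<le> ennreal (2 * B * C * \<epsilon> / k1 + 2 * \<eta> * C + (2 * C\<^sup>2 + 2 * C) * r * (\<integral>x. G x \<partial>lborel) + 2 * sqrt C * (\<epsilon> / r) / k1)"
        unfolding r2
        by (rule op_norm_bound_at_scale[OF D elim(3) r_def[unfolded p_def] _ _ \<kappa> \<rho> less_imp_le[OF \<eta>(1)] \<eta>(2) \<theta> C_def k1_def])
          (use elim r_def in auto)
      also have "\<dots> \<le> ennreal \<delta>"
        using elim(1) \<eta>C unfolding er r_def[symmetric] by (intro ennreal_leI) linarith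
      finally show ?case .
    qed
  qed
  show ?thesis
  proof (rule order_tendstoI)
    fix x :: ennreal assume "x > 0"
    then obtain \<delta> where \<delta>: "\<delta> > 0" "ennreal \<delta> < x"
    proof -
      obtain y where y: "0 < y" "y < x" using dense[OF \<open>x > 0\<close>] by blast
      have "y < top" using y(2) top_greatest by (rule less_le_trans)
      then show thesis using y that[of "enn2real y"] by (simp add: enn2real_positive_iff)
    qed
    from small[OF \<delta>(1)] show "eventually (\<lambda>\<epsilon>. ?N \<epsilon> < x) (at_right 0)"
      by eventually_elim (use \<delta>(2) in auto)
  qed simp
qed

end

theorem theorem2p3:
  fixes a b M cp cm m \<alpha> :: real
    and h h' :: "real \<Rightarrow> real"
    and I :: "real set"
    and Q :: "real \<Rightarrow> l2_op"
  assumes "a > 0" and "b > 0" and I: "I = {-a..b}"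
    and h_cont: "continuous_on I h"
    and h_pos: "\<And>x. x \<in> I \<Longrightarrow> h x > 0"
    and h_max: "\<And>x. x \<in> I \<Longrightarrow> x \<noteq> 0 \<Longrightarrow> h x < h 0"
    and h_deriv: "\<And>x. x \<in> I - {0} \<Longrightarrow> (h has_real_derivative h' x) (at x within I)"
    and h'_cont: "continuous_on (I - {0}) h'"
    and h'_L2: "set_integrable lborel I (\<lambda>x. (h' x)\<^sup>2)"
    and "M > 0" and "cp > 0" and "cm > 0" and "m \<ge> 1"
    and expand_right: "(\<lambda>x. h x - (M - cp * x powr m)) \<in> O[at_right 0](\<lambda>x. x powr (m + 1))"
    and expand_left: "(\<lambda>x. h x - (M - cm * \<bar>x\<bar> powr m)) \<in> O[at_left 0](\<lambda>x. \<bar>x\<bar> powr (m + 1))"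
    and \<alpha>: "\<alpha> = 2 / (m + 2)"
    and Q: "Q = Q_D I h h' M \<or> Q = Q_N I h h' M"
  shows "((\<lambda>\<epsilon>. op_norm
            (diff_op
              (dsum_op ((scale_op (\<epsilon> powr (2 * \<alpha>)) (Q \<epsilon>))\<inverse>) (zero_op (UNIV - I)))
              ((scale_op (\<epsilon> powr (2 * \<alpha>)) (H_op M cp cm m \<epsilon>))\<inverse>)))
          \<longlongrightarrow> 0) (at_right 0)"
proof -
  interpret thin_strip a b M cp cm m h h' I
    by unfold_locales (use assms in auto)
  obtain D where D: "D = H10 I \<or> D = H1 I" and QD: "Q = (\<lambda>\<epsilon>. form_op I (W_pot h h' M \<epsilon>) D)"
    using Q unfolding Q_D_def[abs_def] Q_N_def[abs_def] by blast
  show ?thesis unfolding QD \<alpha> by (rule resolvent_convergence[OF D])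
qed

end
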